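(* For every integer $n\ge 2$ and every $g\in\mathrm{PU}(n,1)$, there exist $x,y\in\mathrm{PU}(n,1)$ and a nontrivial holomorphic involution $I\in\mathrm{PU}(n,1)$ (that is, $I^2=1$, $I\neq 1$) such that $$g=[x,y]_{\mathrm c},\qquad IxI=x^{-1},\qquad IyI=y^{-1}.$$ In particular, $\operatorname{cl}(\mathrm{PU}(n,1))=1$.
   Context: Let $V=\mathbb C^{n+1}$ be endowed with a nondegenerate Hermitian form of signature $(n,1)$ ($n$ positive directions, one negative direction). Let $\mathrm U(n,1)$ be the group of linear automorphisms of $V$ preserving this form, and $\mathrm{PU}(n,1)=\mathrm U(n,1)/\{e^{i\theta}\mathrm I:\theta\in\mathbb R\}$. The commutator is $[x,y]_{\mathrm c}=xyx^{-1}y^{-1}$. For a group $G$ and $g\in G$, $$\operatorname{cl}_G(g)=\inf\Big\{k\in\mathbb Z_{\ge 0}: g=\prod_{j=1}^k[x_j,y_j]_{\mathrm c},\ x_j,y_j\in G\Big\},\qquad \operatorname{cl}(G)=\sup_{g\in G}\operatorname{cl}_G(g),$$ where the empty product is $1$ and $\inf\varnothing=+\infty$. *)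

theory Defs
  imports
    Complex_Main
    "HOL-Library.Extended_Nat"
    "HOL-Algebra.Coset"
    "Jordan_Normal_Form.Matrix"
begin

definition hermitian_form :: "nat \<Rightarrow> (complex vec \<Rightarrow> complex vec \<Rightarrow> complex) \<Rightarrow> bool" where
  "hermitian_form m h \<longleftrightarrow>
     (\<forall>u\<in>carrier_vec m. \<forall>v\<in>carrier_vec m. \<forall>w\<in>carrier_vec m. h (u + v) w = h u w + h v w) \<and>
     (\<forall>a. \<forall>v\<in>carrier_vec m. \<forall>w\<in>carrier_vec m. h (a \<cdot>\<^sub>v v) w = a * h v w) \<and>
     (\<forall>v\<in>carrier_vec m. \<forall>w\<in>carrier_vec m. h w v = cnj (h v w))"

definition nondegenerate_form :: "nat \<Rightarrow> (complex vec \<Rightarrow> complex vec \<Rightarrow> complex) \<Rightarrow> bool" where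
  "nondegenerate_form m h \<longleftrightarrow>
     (\<forall>v\<in>carrier_vec m. (\<forall>w\<in>carrier_vec m. h v w = 0) \<longrightarrow> v = 0\<^sub>v m)"

(* Signature (p, q), in the sense of Sylvester's law of inertia: the columns of P are an
   orthogonal basis with p positive and q negative vectors. *)
definition has_signature ::
    "nat \<Rightarrow> (complex vec \<Rightarrow> complex vec \<Rightarrow> complex) \<Rightarrow> nat \<Rightarrow> nat \<Rightarrow> bool" where
  "has_signature m h p q \<longleftrightarrow>
     (\<exists>P\<in>carrier_mat m m. invertible_mat P \<and>
        (\<forall>i<m. \<forall>j<m. i \<noteq> j \<longrightarrow> h (col P i) (col P j) = 0) \<and>
        card {i. i < m \<and> Re (h (col P i) (col P i)) > 0} = p \<and>
        card {i. i < m \<and> Re (h (col P i) (col P i)) < 0} = q)"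

(* Linear automorphisms of C^m are identified with their matrices in the standard basis. *)
definition unitary_group ::
    "nat \<Rightarrow> (complex vec \<Rightarrow> complex vec \<Rightarrow> complex) \<Rightarrow> complex mat monoid" where
  "unitary_group m h =
     \<lparr>carrier = {A \<in> carrier_mat m m. invertible_mat A \<and>
        (\<forall>v\<in>carrier_vec m. \<forall>w\<in>carrier_vec m. h (A *\<^sub>v v) (A *\<^sub>v w) = h v w)},
      monoid.mult = (*), one = 1\<^sub>m m\<rparr>"

definition unit_scalars :: "nat \<Rightarrow> complex mat set" where
  "unit_scalars m = {exp (\<i> * complex_of_real \<theta>) \<cdot>\<^sub>m 1\<^sub>m m | \<theta>. True}"

(* Elements of the projective unitary group are cosets A * unit_scalars (n + 1). *)
definition PU ::
    "nat \<Rightarrow> (complex vec \<Rightarrow> complex vec \<Rightarrow> complex) \<Rightarrow> complex mat set monoid" where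
  "PU n h = unitary_group (n + 1) h Mod unit_scalars (n + 1)"

lemma unitary_group_is_group: "group (unitary_group m h)"
proof (rule groupI, goal_cases)
  case (1 A B)
  then have A: "A \<in> carrier_mat m m" and B: "B \<in> carrier_mat m m"
    and iA: "invertible_mat A" and iB: "invertible_mat B"
    and hA: "\<And>v w. v \<in> carrier_vec m \<Longrightarrow> w \<in> carrier_vec m \<Longrightarrow> h (A *\<^sub>v v) (A *\<^sub>v w) = h v w"
    and hB: "\<And>v w. v \<in> carrier_vec m \<Longrightarrow> w \<in> carrier_vec m \<Longrightarrow> h (B *\<^sub>v v) (B *\<^sub>v w) = h v w"
    by (auto simp: unitary_group_def)
  from iA A obtain A' where A': "A * A' = 1\<^sub>m m" "A' * A = 1\<^sub>m (dim_row A')"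
    unfolding invertible_mat_def inverts_mat_def by auto
  from iB B obtain B' where B': "B * B' = 1\<^sub>m m" "B' * B = 1\<^sub>m (dim_row B')"
    unfolding invertible_mat_def inverts_mat_def by auto
  have cA': "A' \<in> carrier_mat m m"
    using A A' by (metis carrier_matD(2) carrier_matI index_mult_mat(3) index_one_mat(3))
  have cB': "B' \<in> carrier_mat m m"
    using B B' by (metis carrier_matD(2) carrier_matI index_mult_mat(3) index_one_mat(3))
  have "(A * B) * (B' * A') = A * ((B * B') * A')" 
    using A B cA' cB' by (simp add: assoc_mult_mat[of _ m m _ m _ m])
  then have e1: "(A * B) * (B' * A') = 1\<^sub>m m" using A' B' cA' by simp
  have "(B' * A') * (A * B) = B' * ((A' * A) * B)" 
    using A B cA' cB' by (simp add: assoc_mult_mat[of _ m m _ m _ m])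
  then have e2: "(B' * A') * (A * B) = 1\<^sub>m m" using A' B' cA' cB' B by simp
  have "invertible_mat (A * B)"
    unfolding invertible_mat_def inverts_mat_def
    using e1 e2 A B cB' by (intro conjI exI[of _ "B' * A'"]) (auto simp: square_mat.simps)
  moreover have "h ((A * B) *\<^sub>v v) ((A * B) *\<^sub>v w) = h v w"
    if "v \<in> carrier_vec m" "w \<in> carrier_vec m" for v w
    using that A B hA hB by (simp add: assoc_mult_mat_vec[of _ m m _ m])
  ultimately show ?case using A B by (auto simp: unitary_group_def)
next
  case 2
  have "invertible_mat (1\<^sub>m m :: complex mat)"
    unfolding invertible_mat_def inverts_mat_def
    by (intro conjI exI[of _ "1\<^sub>m m"]) (auto simp: square_mat.simps)
  then show ?case by (auto simp: unitary_group_def)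
next
  case (3 A B C)
  then show ?case by (auto simp: unitary_group_def intro!: assoc_mult_mat[of _ m m _ m _ m])
next
  case (4 A)
  then show ?case by (auto simp: unitary_group_def)
next
  case (5 A)
  then have A: "A \<in> carrier_mat m m" and iA: "invertible_mat A"
    and hA: "\<And>v w. v \<in> carrier_vec m \<Longrightarrow> w \<in> carrier_vec m \<Longrightarrow> h (A *\<^sub>v v) (A *\<^sub>v w) = h v w"
    by (auto simp: unitary_group_def)
  from iA A obtain B where B: "A * B = 1\<^sub>m m" "B * A = 1\<^sub>m (dim_row B)"
    unfolding invertible_mat_def inverts_mat_def by auto
  have cB: "B \<in> carrier_mat m m"
    using A B by (metis carrier_matD(2) carrier_matI index_mult_mat(3) index_one_mat(3))
  have "invertible_mat B"
    unfolding invertible_mat_def inverts_mat_def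
    using A B cB by (intro conjI exI[of _ A]) (auto simp: square_mat.simps)
  moreover have "h (B *\<^sub>v v) (B *\<^sub>v w) = h v w"
    if "v \<in> carrier_vec m" "w \<in> carrier_vec m" for v w
  proof -
    have "A *\<^sub>v (B *\<^sub>v u) = u" if "u \<in> carrier_vec m" for u
      using that A cB B(1) by (simp flip: assoc_mult_mat_vec[of _ m m _ m])
    then show ?thesis using hA[of "B *\<^sub>v v" "B *\<^sub>v w"] that cB by simp
  qed
  ultimately have "B \<in> carrier (unitary_group m h)" using cB by (auto simp: unitary_group_def)
  then show ?case using B cB by (auto simp: unitary_group_def intro!: bexI[of _ B])
qed

lemma hermitian_form_smult:
  assumes "hermitian_form m h" "v \<in> carrier_vec m" "w \<in> carrier_vec m"
  shows "h (a \<cdot>\<^sub>v v) (b \<cdot>\<^sub>v w) = a * cnj b * h v w"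
proof -
  have "h (a \<cdot>\<^sub>v v) (b \<cdot>\<^sub>v w) = a * h v (b \<cdot>\<^sub>v w)"
    using assms smult_carrier_vec unfolding hermitian_form_def by blast
  also have "h v (b \<cdot>\<^sub>v w) = cnj (h (b \<cdot>\<^sub>v w) v)"
    using assms smult_carrier_vec unfolding hermitian_form_def by blast
  also have "h (b \<cdot>\<^sub>v w) v = b * h w v"
    using assms unfolding hermitian_form_def by blast
  also have "h w v = cnj (h v w)" using assms unfolding hermitian_form_def by blast
  finally show ?thesis by simp
qed

lemma unit_scalars_normal:
  assumes "hermitian_form m h"
  shows "unit_scalars m \<lhd> unitary_group m h"
proof -
  let ?U = "unitary_group m h"
  let ?s = "\<lambda>t::real. exp (\<i> * complex_of_real t) \<cdot>\<^sub>m (1\<^sub>m m :: complex mat)"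
  interpret group ?U by (rule unitary_group_is_group)
  have mul: "?s a * ?s b = ?s (a + b)" for a b
    by (intro eq_matI) (auto simp: algebra_simps exp_add)
  have one: "?s 0 = 1\<^sub>m m" by (intro eq_matI) auto
  have app: "?s a *\<^sub>v v = exp (\<i> * complex_of_real a) \<cdot>\<^sub>v v" if "v \<in> carrier_vec m" for a v
    using that by (intro eq_vecI) (auto simp: row_smult)
  have unit: "exp (\<i> * complex_of_real a) * cnj (exp (\<i> * complex_of_real a)) = 1" for a
    by (simp add: cis_cnj cis_mult flip: cis_conv_exp)
  have inU: "?s a \<in> carrier ?U" for a
  proof -
    have "invertible_mat (?s a)"
      unfolding invertible_mat_def inverts_mat_def
      by (intro conjI exI[of _ "?s (-a)"]) (auto simp only: mul square_mat.simps one add.right_inverse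
          add.left_inverse index_smult_mat index_one_mat)
    moreover have "h (?s a *\<^sub>v v) (?s a *\<^sub>v w) = h v w"
      if "v \<in> carrier_vec m" "w \<in> carrier_vec m" for v w
      by (simp only: app that hermitian_form_smult[OF assms that] unit mult_1)
    ultimately show ?thesis by (auto simp: unitary_group_def)
  qed
  have mU: "A \<otimes>\<^bsub>?U\<^esub> B = A * B" for A B by (simp add: unitary_group_def)
  have oU: "\<one>\<^bsub>?U\<^esub> = 1\<^sub>m m" by (simp add: unitary_group_def)
  have invs: "inv\<^bsub>?U\<^esub> (?s a) = ?s (- a)" for a
    by (rule inv_equality) (simp_all only: mU oU mul one add.left_inverse inU)
  have central: "A * ?s a = ?s a * A" if "A \<in> carrier ?U" for A a
    using that by (auto simp: unitary_group_def mult_smult_distrib[of _ m m _ m] mult_smult_assoc_mat[of _ m m _ m])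
  have sub: "subgroup (unit_scalars m) ?U"
  proof
    show "unit_scalars m \<subseteq> carrier ?U" using inU by (auto simp: unit_scalars_def)
    show "x \<otimes>\<^bsub>?U\<^esub> y \<in> unit_scalars m" if "x \<in> unit_scalars m" "y \<in> unit_scalars m" for x y
      using that mul unfolding mU unit_scalars_def by blast
    show "\<one>\<^bsub>?U\<^esub> \<in> unit_scalars m" using one[symmetric] unfolding oU unit_scalars_def by blast
    show "inv\<^bsub>?U\<^esub> x \<in> unit_scalars m" if "x \<in> unit_scalars m" for x
      using that invs unfolding unit_scalars_def by blast
  qed
  show ?thesis unfolding normal_inv_iff
  proof (intro conjI sub ballI)
    fix A S assume A: "A \<in> carrier ?U" and S: "S \<in> unit_scalars m"
    then obtain a where a: "S = ?s a" by (auto simp: unit_scalars_def)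
    have "A \<otimes>\<^bsub>?U\<^esub> S = S \<otimes>\<^bsub>?U\<^esub> A" unfolding mU a using central[OF A] .
    then have "A \<otimes>\<^bsub>?U\<^esub> S \<otimes>\<^bsub>?U\<^esub> inv\<^bsub>?U\<^esub> A = S"
      using A inU[of a] a by (simp add: m_assoc)
    then show "A \<otimes>\<^bsub>?U\<^esub> S \<otimes>\<^bsub>?U\<^esub> inv\<^bsub>?U\<^esub> A \<in> unit_scalars m" using S by simp
  qed
qed

lemma PU_is_group: "hermitian_form (n + 1) h \<Longrightarrow> group (PU n h)"
  unfolding PU_def by (rule normal.factorgroup_is_group[OF unit_scalars_normal])

definition commutator :: "('a, 'b) monoid_scheme \<Rightarrow> 'a \<Rightarrow> 'a \<Rightarrow> 'a" where
  "commutator G x y = x \<otimes>\<^bsub>G\<^esub> y \<otimes>\<^bsub>G\<^esub> inv\<^bsub>G\<^esub> x \<otimes>\<^bsub>G\<^esub> inv\<^bsub>G\<^esub> y"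

definition list_product :: "('a, 'b) monoid_scheme \<Rightarrow> 'a list \<Rightarrow> 'a" where
  "list_product G gs = foldr (\<lambda>a b. a \<otimes>\<^bsub>G\<^esub> b) gs \<one>\<^bsub>G\<^esub>"

(* In enat the infimum of the empty set is \<infinity>. *)
definition commutator_length :: "('a, 'b) monoid_scheme \<Rightarrow> 'a \<Rightarrow> enat" where
  "commutator_length G g =
     Inf {enat k | k. \<exists>x y. (\<forall>j\<in>{1..k}. x j \<in> carrier G \<and> y j \<in> carrier G) \<and>
            g = list_product G (map (\<lambda>j. commutator G (x j) (y j)) [1..<k + 1])}"

definition group_commutator_length :: "('a, 'b) monoid_scheme \<Rightarrow> enat" where
  "group_commutator_length G = (SUP g\<in>carrier G. commutator_length G g)"

end

theory Submission
  imports
    Defs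
    "Jordan_Normal_Form.Determinant"
    "HOL-Computational_Algebra.Fundamental_Theorem_Algebra"
begin

text \<open>If \<open>I\<close>, \<open>A\<close>, \<open>B\<close> are involutions, then \<open>I\<close> inverts both \<open>x = AI\<close> and \<open>y = IB\<close>, and the commutator of
\<open>x\<close> and \<open>y\<close> is \<open>(ABI)\<^sup>2\<close>.  So it suffices that every element of the projective unitary group is the square
of a product of three involutions.  Lifted to the unitary group this asks, for an isometry \<open>g\<close>, for a unit
scalar \<open>c\<close>, an isometry \<open>f\<close> with \<open>f\<^sup>2 = cg\<close>, and involutive isometries \<open>A\<close> and \<open>C\<close> such that \<open>C\<close> conjugates
\<open>R = Af\<close> to its inverse: then \<open>B = RC\<close> is an involution and \<open>f = ABC\<close>.  \<open>A\<close> and \<open>C\<close> are built up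
from reflections in non-null vectors.

Choose a maximal orthonormal set \<open>E\<close> of eigenvectors of \<open>g\<close> with positive norm.  On the orthogonal complement
\<open>W\<close> of \<open>E\<close> the map \<open>g\<close> has no positive eigenvector, and signature leaves few possibilities: \<open>W\<close> is a negative
line (elliptic), or a hyperbolic plane with eigenvalues \<open>l\<close> and \<open>1 / cnj l\<close> off the unit circle (loxodromic), or \<open>g\<close>
is a scalar times a unipotent map with a single Jordan block of size 2 or 3 on \<open>W\<close> (parabolic).  The root \<open>f\<close> is
built on \<open>W\<close> and on the vectors of \<open>E\<close> separately.  Two freedoms are left: the sign of each eigenvalue of \<open>f\<close> on
\<open>E\<close>, and the scalar \<open>c\<close>, which is normalized by \<open>c ^ m = 1 / det g\<close> in dimension \<open>m\<close> and can still be multiplied by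
an \<open>m\<close>-th root of unity.

The head.  Unless \<open>g\<close> is a scalar, in \<open>W\<close> (for elliptic \<open>g\<close>, in \<open>W\<close> together with one vector of \<open>E\<close>) there is a reflection \<open>A\<close> for which
\<open>R = Af\<close> leaves a subspace of codimension one invariant, is conjugate to its inverse there, and has one
further positive eigenvector \<open>u\<close>, with eigenvalue \<open>z\<close>.  If \<open>p\<close> and \<open>q\<close> have equal norm and real product, the
reflection in \<open>p - q\<close> swaps them; so a negative vector \<open>u0\<close> with \<open>h (f u0) u0\<close> real can be made an eigenvector
of \<open>R\<close> with eigenvalue \<open>1\<close> or \<open>-1\<close> (\<open>head_negative_vector\<close>), and a null vector \<open>p\<close> with \<open>h (f p) p\<close> real and
nonzero an eigenvector with eigenvalue \<open>2\<close>, whose dual eigenvalue is \<open>1/2\<close> (\<open>head_null_vector\<close>, needed for Jordan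
blocks of size 3).  That such vectors exist is where \<open>c\<close> has to be chosen: since \<open>m\<close> is at least 3, the \<open>m\<close>-th
roots meet every open half plane (\<open>root_in_half_plane\<close>).

The chain.  The remaining vectors of \<open>E\<close> are absorbed two at a time.  A further reflection inside their plane
gives \<open>R\<close> an eigenvector \<open>p\<close> there with eigenvalue \<open>cnj z\<close>, and composing \<open>C\<close> with the swap of \<open>u\<close> and \<open>p\<close> makes \<open>C\<close>
invert \<open>R\<close> on their span; the other eigenvector of \<open>R\<close> in the plane is the new \<open>u\<close>.  After suitable sign changes of
the eigenvalues of \<open>f\<close> this is always possible (\<open>chain_step\<close>).  At the end one vector, or two if one element of \<open>E\<close>
remains, have to fit; the determinant settles this, because the normalization of \<open>c\<close> gives \<open>(det f)\<^sup>2 = 1\<close>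
(\<open>chain_complete\<close>).\<close>

section \<open>Commutators of products of involutions\<close>

lemma (in group) commutator_of_involution_products:
  assumes G: "a \<in> carrier G" "b \<in> carrier G" "c \<in> carrier G"
    and sq: "a \<otimes> a = \<one>" "b \<otimes> b = \<one>" "c \<otimes> c = \<one>"
  shows "commutator G (a \<otimes> c) (c \<otimes> b) = (a \<otimes> b \<otimes> c) \<otimes> (a \<otimes> b \<otimes> c)"
    "c \<otimes> (a \<otimes> c) \<otimes> c = inv (a \<otimes> c)" "c \<otimes> (c \<otimes> b) \<otimes> c = inv (c \<otimes> b)"
proof -
  have inv: "inv a = a" "inv b = b" "inv c = c" using G sq by (auto intro: inv_equality)
  have cancel: "c \<otimes> (c \<otimes> x) = x" if "x \<in> carrier G" for x
    using G sq that by (simp flip: m_assoc)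
  show "commutator G (a \<otimes> c) (c \<otimes> b) = (a \<otimes> b \<otimes> c) \<otimes> (a \<otimes> b \<otimes> c)"
    using G by (simp add: commutator_def inv_mult_group inv m_assoc cancel)
  show "c \<otimes> (a \<otimes> c) \<otimes> c = inv (a \<otimes> c)" "c \<otimes> (c \<otimes> b) \<otimes> c = inv (c \<otimes> b)"
    using G sq by (simp_all add: inv_mult_group inv m_assoc cancel)
qed

text \<open>The third involution is the one that inverts both factors of the commutator, so it must not be trivial.  If it is,
the product has at most two factors and can be padded.\<close>

lemma (in group) nontrivial_third_involution:
  assumes G: "a \<in> carrier G" "b \<in> carrier G" "c \<in> carrier G" "s \<in> carrier G"
    and sq: "a \<otimes> a = \<one>" "b \<otimes> b = \<one>" "c \<otimes> c = \<one>" "s \<otimes> s = \<one>" and s: "s \<noteq> \<one>"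
  obtains a' b' c' where "a' \<in> carrier G" "b' \<in> carrier G" "c' \<in> carrier G"
    "a' \<otimes> a' = \<one>" "b' \<otimes> b' = \<one>" "c' \<otimes> c' = \<one>" "c' \<noteq> \<one>"
    "(a \<otimes> b \<otimes> c) \<otimes> (a \<otimes> b \<otimes> c) = (a' \<otimes> b' \<otimes> c') \<otimes> (a' \<otimes> b' \<otimes> c')"
proof -
  consider "c \<noteq> \<one>" | "c = \<one>" "b \<noteq> \<one>" | "c = \<one>" "b = \<one>" by blast
  then show ?thesis
  proof cases
    case 1
    then show ?thesis using that[of a b c] G sq by simp
  next
    case 2
    then show ?thesis using that[of a "\<one>" b] G sq by simp
  next
    case 3
    then show ?thesis using that[of "\<one>" s s] G sq s by simp
  qed
qed

lemma (in group) commutator_length_le_one: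
  assumes "x \<in> carrier G" "y \<in> carrier G" "g = commutator G x y"
  shows "commutator_length G g \<le> 1"
proof -
  have "commutator G x y \<in> carrier G" using assms by (simp add: commutator_def)
  then have "g = list_product G (map (\<lambda>j. commutator G x y) [1..<1 + 1])"
    using assms by (simp add: list_product_def)
  then have "enat 1 \<in> {enat k | k. \<exists>x y. (\<forall>j\<in>{1..k}. x j \<in> carrier G \<and> y j \<in> carrier G) \<and>
            g = list_product G (map (\<lambda>j. commutator G (x j) (y j)) [1..<k + 1])}"
    using assms by (intro CollectI exI[of _ 1] exI[of _ "\<lambda>_. x"] exI[of _ "\<lambda>_. y"]) auto
  then show ?thesis unfolding commutator_length_def one_enat_def by (rule Inf_lower)
qed

lemma commutator_length_ge_one:
  assumes "g \<noteq> \<one>\<^bsub>G\<^esub>"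
  shows "1 \<le> commutator_length G g"
  unfolding commutator_length_def
proof (rule Inf_greatest)
  fix t assume "t \<in> {enat k | k. \<exists>x y. (\<forall>j\<in>{1..k}. x j \<in> carrier G \<and> y j \<in> carrier G) \<and>
            g = list_product G (map (\<lambda>j. commutator G (x j) (y j)) [1..<k + 1])}"
  then obtain k x y where k: "t = enat k" "g = list_product G (map (\<lambda>j. commutator G (x j) (y j)) [1..<k + 1])"
    by blast
  have "k \<noteq> 0"
  proof
    assume "k = 0"
    then have "g = \<one>\<^bsub>G\<^esub>" using k(2) by (simp add: list_product_def)
    then show False using assms by simp
  qed
  then show "1 \<le> t" unfolding k(1) one_enat_def by simp
qed

section \<open>Complex numbers and matrices\<close>

text \<open>The \<open>m\<close>-th roots of \<open>D\<close> sum to zero.  So if none of their multiples by \<open>al\<close> lies in the open right half plane, all of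
these lie on the imaginary axis, which is impossible for two successive roots: their quotient is not real because
\<open>m\<close> is at least 3.\<close>

lemma root_in_half_plane:
  assumes D: "cmod D = 1" and m: "3 \<le> m" and al: "al \<noteq> 0"
  obtains c where "cmod c = 1" "c ^ m = D" "Re (c * al) > 0"
proof -
  have "cis (Arg D) = sgn D" using D by (intro cis_Arg) auto
  then obtain t where t: "D = cis t" using D by (metis sgn_eq div_by_1 of_real_1)
  define c0 where "c0 = cis (t / m)"
  define zeta where "zeta = cis (2 * pi / m)"
  have mpos: "real m > 0" using m by simp
  have c0m: "c0 ^ m = D" using mpos unfolding c0_def t by (simp add: DeMoivre)
  have zm: "zeta ^ m = 1" using mpos unfolding zeta_def by (simp add: DeMoivre)
  have "0 < 2 * pi / m" "2 * pi / m < pi" using m by (auto simp: field_simps)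
  then have im: "Im zeta > 0" unfolding zeta_def by (simp add: sin_gt_zero)
  then have z1: "zeta \<noteq> 1" by auto
  have "(\<Sum>k<m. c0 * zeta ^ k * al) = c0 * (\<Sum>k<m. zeta ^ k) * al"
    by (simp add: sum_distrib_left sum_distrib_right)
  also have "\<dots> = 0" using geometric_sum[OF z1, of m] zm by simp
  finally have "Re (\<Sum>k<m. c0 * zeta ^ k * al) = 0" by simp
  then have s: "(\<Sum>k<m. - Re (c0 * zeta ^ k * al)) = 0"
    by (simp only: sum_negf Re_sum neg_equal_0_iff_equal)
  have "\<exists>k<m. Re (c0 * zeta ^ k * al) > 0"
  proof (rule ccontr)
    assume "\<not> ?thesis"
    then have "\<forall>k\<in>{..<m}. 0 \<le> - Re (c0 * zeta ^ k * al)" by force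
    then have z: "\<forall>k\<in>{..<m}. - Re (c0 * zeta ^ k * al) = 0"
      using s by (subst (asm) sum_nonneg_eq_0_iff) auto
    define b where "b = c0 * al"
    have "Re b = 0" using bspec[OF z, of 0] m by (simp add: b_def)
    moreover have "Re (b * zeta) = 0" using bspec[OF z, of 1] m by (simp add: b_def ac_simps)
    ultimately have "b = 0" using im by (simp add: complex_eq_iff)
    then show False using al by (simp add: b_def c0_def)
  qed
  then obtain k where "Re (c0 * zeta ^ k * al) > 0" by blast
  moreover have "(c0 * zeta ^ k) ^ m = D"
    using c0m zm by (metis mult.right_neutral power_commutes power_mult power_mult_distrib mult.commute power_one)
  moreover have "cmod (c0 * zeta ^ k) = 1" by (simp add: c0_def zeta_def norm_mult norm_power)
  ultimately show ?thesis using that by blast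
qed

text \<open>The weights of the vector in \<open>chain_step_balanced\<close>: with free signs, zero is a convex combination of any two reals.\<close>

lemma balance_with_signs:
  fixes i j :: real
  obtains s t al be :: real where "s = 1 \<or> s = - 1" "t = 1 \<or> t = - 1" "al\<^sup>2 + be\<^sup>2 = 1"
    "al\<^sup>2 * (s * i) + be\<^sup>2 * (t * j) = 0"
proof (cases "i = 0 \<and> j = 0")
  case True
  then show ?thesis using that[of 1 1 1 0] by simp
next
  case False
  define k where "k = \<bar>i\<bar> + \<bar>j\<bar>"
  have k: "k > 0" using False by (auto simp: k_def)
  have "\<bar>j\<bar> / k + \<bar>i\<bar> / k = 1" using k by (simp add: k_def flip: add_divide_distrib)
  moreover have "\<bar>j\<bar> / k * \<bar>i\<bar> + \<bar>i\<bar> / k * (- \<bar>j\<bar>) = 0" by simp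
  moreover have "(if i < 0 then - 1 else 1) * i = \<bar>i\<bar>" "(if j < 0 then 1 else - 1) * j = - \<bar>j\<bar>" by auto
  ultimately show ?thesis using that[of "if i < 0 then - 1 else 1" "if j < 0 then 1 else - 1"
        "sqrt (\<bar>j\<bar> / k)" "sqrt (\<bar>i\<bar> / k)"] k by (simp add: real_sqrt_pow2)
qed

text \<open>Compare determinants in \<open>[1, 0; B, 1] * [1 + AB, A; 0, 1] = [1, A; 0, 1 + BA] * [1, 0; B, 1]\<close>.\<close>

lemma det_one_plus_column_times_row:
  fixes A B :: "complex mat"
  assumes A: "A \<in> carrier_mat m 1" and B: "B \<in> carrier_mat 1 m"
  shows "det (1\<^sub>m m + A * B) = 1 + (B * A) $$ (0, 0)"
proof -
  have AB: "A * B \<in> carrier_mat m m" and BA: "B * A \<in> carrier_mat 1 1" using A B by auto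
  let ?L = "four_block_mat (1\<^sub>m m) (0\<^sub>m m 1) B (1\<^sub>m 1)"
  let ?X = "four_block_mat (1\<^sub>m m + A * B) A (0\<^sub>m 1 m) (1\<^sub>m 1)"
  let ?Y = "four_block_mat (1\<^sub>m m) A (0\<^sub>m 1 m) (1\<^sub>m 1 + B * A)"
  have L: "?L \<in> carrier_mat (m+1) (m+1)" and X: "?X \<in> carrier_mat (m+1) (m+1)"
    and Y: "?Y \<in> carrier_mat (m+1) (m+1)" using A B by auto
  have comm: "B * A + 1\<^sub>m 1 = 1\<^sub>m 1 + B * A" by (rule comm_add_mat[OF BA]) simp
  have "?L * ?X = four_block_mat (1\<^sub>m m + A * B) A (B + B * (A * B)) (1\<^sub>m 1 + B * A)"
  proof -
    have "B * (1\<^sub>m m + A * B) + 1\<^sub>m 1 * 0\<^sub>m 1 m = B + B * (A * B)"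
      using A B AB mult_add_distrib_mat[OF B one_carrier_mat AB] by simp
    moreover have "1\<^sub>m m * (1\<^sub>m m + A * B) + 0\<^sub>m m 1 * 0\<^sub>m 1 m = 1\<^sub>m m + A * B"
      using add_carrier_mat[OF AB, of "1\<^sub>m m"] left_mult_one_mat[of "1\<^sub>m m + A * B" m m] by simp
    ultimately show ?thesis
      using A B AB BA mult_four_block_mat[of "1\<^sub>m m" m m "0\<^sub>m m 1" 1 B 1 "1\<^sub>m 1"
          "1\<^sub>m m + A * B" m A 1 "0\<^sub>m 1 m" "1\<^sub>m 1"] comm by simp
  qed
  also have "\<dots> = ?Y * ?L"
  proof -
    have "0\<^sub>m 1 m * 1\<^sub>m m + (1\<^sub>m 1 + B * A) * B = B + B * (A * B)"
      using A B BA add_mult_distrib_mat[OF one_carrier_mat BA B] by simp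
    then show ?thesis
      using A B AB BA mult_four_block_mat[of "1\<^sub>m m" m m A 1 "0\<^sub>m 1 m" 1 "1\<^sub>m 1 + B * A"
          "1\<^sub>m m" m "0\<^sub>m m 1" 1 B "1\<^sub>m 1"] by simp
  qed
  finally have "det ?L * det ?X = det ?Y * det ?L"
    using det_mult[OF L X] det_mult[OF Y L] by simp
  moreover have "det ?L = 1"
    using det_four_block_mat_upper_right_zero[of "1\<^sub>m m" m "0\<^sub>m m 1" 1 B "1\<^sub>m 1"] B by simp
  moreover have "det ?X = det (1\<^sub>m m + A * B)"
    using det_four_block_mat_lower_left_zero[of "1\<^sub>m m + A * B" m A 1 "0\<^sub>m 1 m" "1\<^sub>m 1"] A AB by simp
  moreover have "det ?Y = det (1\<^sub>m 1 + B * A)"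
    using det_four_block_mat_lower_left_zero[of "1\<^sub>m m" m A 1 "0\<^sub>m 1 m" "1\<^sub>m 1 + B * A"] A BA by simp
  moreover have "det (1\<^sub>m 1 + B * A) = 1 + (B * A) $$ (0,0)"
    using A B BA by (subst det_single) auto
  ultimately show ?thesis by simp
qed

lemma injective_imp_surjective_mat:
  fixes A :: "complex mat"
  assumes A: "A \<in> carrier_mat m m" and inj: "\<And>x. x \<in> carrier_vec m \<Longrightarrow> A *\<^sub>v x = 0\<^sub>v m \<Longrightarrow> x = 0\<^sub>v m"
  obtains B where "B \<in> carrier_mat m m" "A * B = 1\<^sub>m m" "B * A = 1\<^sub>m m"
proof -
  have "det A \<noteq> 0" using det_0_iff_vec_prod_zero[OF A] inj by auto
  from det_non_zero_imp_unit[OF A this, unfolded Units_def ring_mat_def]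
  show ?thesis using that by auto
qed

lemma mat_eq_by_action:
  fixes A B :: "complex mat"
  assumes A: "A \<in> carrier_mat m m" and B: "B \<in> carrier_mat m m"
    and e: "\<And>x. x \<in> carrier_vec m \<Longrightarrow> A *\<^sub>v x = B *\<^sub>v x"
  shows "A = B"
proof (rule eq_matI)
  fix i j assume ij: "i < dim_row B" "j < dim_col B"
  then have "(A *\<^sub>v unit_vec m j) $ i = (B *\<^sub>v unit_vec m j) $ i" using e by simp
  then show "A $$ (i,j) = B $$ (i,j)" using ij A B by simp
qed (use A B in auto)

lemma underdetermined_system:
  fixes a :: "nat \<Rightarrow> nat \<Rightarrow> complex"
  assumes "n < k"
  obtains c where "c \<in> carrier_vec k" "c \<noteq> 0\<^sub>v k" "\<And>i. i < n \<Longrightarrow> (\<Sum>j<k. a i j * c $ j) = 0"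
proof -
  let ?K = "mat k k (\<lambda>(i, j). if i < n then a i j else 0)"
  have K: "?K \<in> carrier_mat k k" by simp
  have ne: "unit_vec k (k - 1) \<noteq> (0\<^sub>v k :: complex vec)"
    using assms by (intro unit_vec_nonzero) simp
  have "?K\<^sup>T *\<^sub>v unit_vec k (k - 1) = 0\<^sub>v k"
    using assms by (intro eq_vecI) auto
  then have "det (?K\<^sup>T) = 0"
    using det_0_iff_vec_prod_zero[of "?K\<^sup>T" k] ne by (auto intro!: exI[of _ "unit_vec k (k - 1)"])
  then have "det ?K = 0" using det_transpose[OF K] by simp
  then obtain c where c: "c \<in> carrier_vec k" "c \<noteq> 0\<^sub>v k" "?K *\<^sub>v c = 0\<^sub>v k"
    using det_0_iff_vec_prod_zero[OF K] by blast
  have "(\<Sum>j<k. a i j * c $ j) = 0" if "i < n" for i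
  proof -
    have "(?K *\<^sub>v c) $ i = 0" using c(3) that assms by simp
    then show ?thesis using that assms c(1) by (simp add: scalar_prod_def lessThan_atLeast0)
  qed
  then show ?thesis using that c by blast
qed

section \<open>Isometries of a Hermitian form\<close>

locale hermitian_space =
  fixes m :: nat and h :: "complex vec \<Rightarrow> complex vec \<Rightarrow> complex"
  assumes form: "hermitian_form m h" and nondeg: "nondegenerate_form m h"
begin

abbreviation V where "V \<equiv> (carrier_vec m :: complex vec set)"
abbreviation M where "M \<equiv> (carrier_mat m m :: complex mat set)"

lemma h_add_left [simp]: "x \<in> V \<Longrightarrow> y \<in> V \<Longrightarrow> z \<in> V \<Longrightarrow> h (x + y) z = h x z + h y z"
  and h_smult_left [simp]: "x \<in> V \<Longrightarrow> z \<in> V \<Longrightarrow> h (a \<cdot>\<^sub>v x) z = a * h x z"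
  and h_commute: "x \<in> V \<Longrightarrow> y \<in> V \<Longrightarrow> h y x = cnj (h x y)"
  using form unfolding hermitian_form_def by blast+

lemma h_add_right [simp]: "x \<in> V \<Longrightarrow> y \<in> V \<Longrightarrow> z \<in> V \<Longrightarrow> h z (x + y) = h z x + h z y"
  using h_commute[of z "x + y"] h_commute[of z x] h_commute[of z y]
  by (metis add_carrier_vec complex_cnj_add complex_cnj_cnj h_add_left h_commute)

lemma h_smult_right [simp]: "x \<in> V \<Longrightarrow> z \<in> V \<Longrightarrow> h z (a \<cdot>\<^sub>v x) = cnj a * h z x"
  by (metis complex_cnj_mult complex_cnj_cnj h_commute h_smult_left smult_carrier_vec)

lemma h_zero_left [simp]: "x \<in> V \<Longrightarrow> h (0\<^sub>v m) x = 0"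
  using h_add_left[of "0\<^sub>v m" "0\<^sub>v m" x] by (simp del: h_add_left)

lemma h_zero_right [simp]: "x \<in> V \<Longrightarrow> h x (0\<^sub>v m) = 0"
  using h_add_right[of "0\<^sub>v m" "0\<^sub>v m" x] by (simp del: h_add_right)

lemma h_self_real: "x \<in> V \<Longrightarrow> h x x = complex_of_real (Re (h x x))"
  using h_commute[of x x] by (simp add: complex_eq_iff)

lemma h_orth_sym: "x \<in> V \<Longrightarrow> y \<in> V \<Longrightarrow> h x y = 0 \<longleftrightarrow> h y x = 0"
  using h_commute[of x y] by simp

lemma nondegD: "x \<in> V \<Longrightarrow> (\<And>y. y \<in> V \<Longrightarrow> h x y = 0) \<Longrightarrow> x = 0\<^sub>v m"
  using nondeg unfolding nondegenerate_form_def by blast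

lemma mv_carrier [simp]: "A \<in> M \<Longrightarrow> x \<in> V \<Longrightarrow> A *\<^sub>v x \<in> V"
  by (rule mult_mat_vec_carrier)

lemma mv_add [simp]: "A \<in> M \<Longrightarrow> x \<in> V \<Longrightarrow> y \<in> V \<Longrightarrow> A *\<^sub>v (x + y) = A *\<^sub>v x + A *\<^sub>v y"
  by (rule mult_add_distrib_mat_vec)

lemma mv_smult [simp]: "A \<in> M \<Longrightarrow> x \<in> V \<Longrightarrow> A *\<^sub>v (a \<cdot>\<^sub>v x) = a \<cdot>\<^sub>v (A *\<^sub>v x)"
  by (rule mult_mat_vec)

lemma mv_mult [simp]: "A \<in> M \<Longrightarrow> B \<in> M \<Longrightarrow> x \<in> V \<Longrightarrow> (A * B) *\<^sub>v x = A *\<^sub>v (B *\<^sub>v x)"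
  by (rule assoc_mult_mat_vec)

lemma mv_mat_add: "A \<in> M \<Longrightarrow> B \<in> M \<Longrightarrow> x \<in> V \<Longrightarrow> (A + B) *\<^sub>v x = A *\<^sub>v x + B *\<^sub>v x"
  by (rule add_mult_distrib_mat_vec)

lemma mv_mat_smult: "A \<in> M \<Longrightarrow> x \<in> V \<Longrightarrow> (a \<cdot>\<^sub>m A) *\<^sub>v x = a \<cdot>\<^sub>v (A *\<^sub>v x)"
  by (intro eq_vecI) (auto simp: row_smult)

lemma h_coordinates: "x \<in> V \<Longrightarrow> w \<in> V \<Longrightarrow> h x w = (\<Sum>j<m. x $ j * h (unit_vec m j) w)"
proof -
  assume x: "x \<in> V" and w: "w \<in> V"
  let ?t = "\<lambda>k. vec m (\<lambda>i. if i < k then x $ i else 0)"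
  have "k \<le> m \<Longrightarrow> h (?t k) w = (\<Sum>j<k. x $ j * h (unit_vec m j) w)" for k
  proof (induction k)
    case 0
    have "?t 0 = 0\<^sub>v m" by auto
    then show ?case using w by simp
  next
    case (Suc k)
    have "?t (Suc k) = ?t k + x $ k \<cdot>\<^sub>v unit_vec m k" by (intro eq_vecI) (auto simp: less_Suc_eq unit_vec_def)
    then show ?case using Suc w by simp
  qed
  moreover have "?t m = x" using x by auto
  ultimately show ?thesis by (metis order_refl)
qed

lemma smult_zero_vec [simp]: "x \<in> V \<Longrightarrow> 0 \<cdot>\<^sub>v x = 0\<^sub>v m"
  by (intro eq_vecI) auto

lemma smult_zero_right [simp]: "a \<cdot>\<^sub>v 0\<^sub>v m = (0\<^sub>v m :: complex vec)"
  by (intro eq_vecI) auto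

text \<open>The matrix of the linear map that sends \<open>x\<close> to \<open>h x w\<close> times \<open>a\<close>.\<close>

definition rank_one :: "complex vec \<Rightarrow> complex vec \<Rightarrow> complex mat" where
  "rank_one a w = mat m m (\<lambda>(i, j). a $ i * h (unit_vec m j) w)"

lemma rank_one_carrier [simp]: "rank_one a w \<in> M"
  by (simp add: rank_one_def)

lemma rank_one_apply [simp]: "a \<in> V \<Longrightarrow> w \<in> V \<Longrightarrow> x \<in> V \<Longrightarrow> rank_one a w *\<^sub>v x = h x w \<cdot>\<^sub>v a"
  by (intro eq_vecI)
    (auto simp: rank_one_def h_coordinates[of x w] scalar_prod_def sum_distrib_left lessThan_atLeast0 ac_simps)

lemma det_one_plus_rank_one:
  assumes a: "a \<in> V" and w: "w \<in> V"
  shows "det (1\<^sub>m m + rank_one a w) = 1 + h a w"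
proof -
  let ?A = "mat m 1 (\<lambda>(i, j). a $ i)" and ?B = "mat 1 m (\<lambda>(i, j). h (unit_vec m j) w)"
  have "rank_one a w = ?A * ?B"
    by (intro eq_matI) (auto simp: rank_one_def scalar_prod_def)
  moreover have "(?B * ?A) $$ (0,0) = h a w"
    using a by (auto simp: h_coordinates[OF a w] scalar_prod_def lessThan_atLeast0 ac_simps)
  ultimately show ?thesis
    using det_one_plus_column_times_row[of ?A m ?B] by simp
qed

definition isometry :: "complex mat \<Rightarrow> bool" where
  "isometry A \<longleftrightarrow> A \<in> M \<and> (\<forall>x\<in>V. \<forall>y\<in>V. h (A *\<^sub>v x) (A *\<^sub>v y) = h x y)"

lemma isometry_carrier [simp]: "isometry A \<Longrightarrow> A \<in> M"
  by (simp add: isometry_def)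

lemma isometry_h [simp]: "isometry A \<Longrightarrow> x \<in> V \<Longrightarrow> y \<in> V \<Longrightarrow> h (A *\<^sub>v x) (A *\<^sub>v y) = h x y"
  by (simp add: isometry_def)

lemma isometry_mult [simp]: "isometry A \<Longrightarrow> isometry B \<Longrightarrow> isometry (A * B)"
  unfolding isometry_def[of "A * B"] by (auto intro!: mult_carrier_mat[of _ m m])

lemma isometry_one [simp]: "isometry (1\<^sub>m m)"
  by (simp add: isometry_def del: isometry_h)

lemma isometry_injective: "isometry A \<Longrightarrow> x \<in> V \<Longrightarrow> A *\<^sub>v x = 0\<^sub>v m \<Longrightarrow> x = 0\<^sub>v m"
  using isometry_h[of A x] by (intro nondegD) (auto simp del: isometry_h)

lemma isometry_invertible: assumes "isometry A" shows "invertible_mat A"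
proof -
  obtain B where "B \<in> M" "A * B = 1\<^sub>m m" "B * A = 1\<^sub>m m"
    using injective_imp_surjective_mat[OF isometry_carrier[OF assms] isometry_injective[OF assms]]
    by blast
  then show ?thesis using carrier_matD[OF isometry_carrier[OF assms]]
    unfolding invertible_mat_def inverts_mat_def
    by (intro conjI exI[of _ B]) auto
qed

lemma carrier_unitary_group: "A \<in> carrier (unitary_group m h) \<longleftrightarrow> isometry A"
proof
  assume "isometry A"
  with isometry_invertible show "A \<in> carrier (unitary_group m h)" by (simp add: unitary_group_def)
next
  assume "A \<in> carrier (unitary_group m h)"
  then have "A \<in> M \<and> (\<forall>x\<in>V. \<forall>y\<in>V. h (A *\<^sub>v x) (A *\<^sub>v y) = h x y)"
    by (simp add: unitary_group_def)
  then show "isometry A" unfolding isometry_def .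
qed

lemma isometry_preserves_orth:
  assumes A: "isometry A" and e: "e \<in> V" "A *\<^sub>v e = a \<cdot>\<^sub>v e" "a \<noteq> 0" and x: "x \<in> V" "h x e = 0"
  shows "h (A *\<^sub>v x) e = 0"
proof -
  have "cnj a * h (A *\<^sub>v x) e = h (A *\<^sub>v x) (A *\<^sub>v e)" using A e(1) x(1) unfolding e(2) by simp
  also have "\<dots> = 0" using isometry_h[OF A x(1) e(1)] x(2) by simp
  finally show ?thesis using e(3) by simp
qed

lemma isometry_eigenvalue_norm:
  assumes A: "isometry A" and e: "e \<in> V" "A *\<^sub>v e = a \<cdot>\<^sub>v e" "h e e \<noteq> 0"
  shows "cmod a = 1"
proof -
  have "h e e = h (A *\<^sub>v e) (A *\<^sub>v e)" by (rule isometry_h[OF A e(1,1), symmetric])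
  also have "\<dots> = a * cnj a * h e e" using e(1) unfolding e(2) by simp
  finally have "a * cnj a = 1" using e(3) by simp
  then have "(cmod a)\<^sup>2 = 1" by (metis complex_norm_square of_real_eq_1_iff)
  then show ?thesis by (simp add: power2_eq_1_iff) (metis norm_ge_zero neg_0_le_iff_le not_one_le_zero)
qed

lemma isometry_eigenvectors_orth:
  assumes A: "isometry A" and x: "x \<in> V" "A *\<^sub>v x = a \<cdot>\<^sub>v x" and y: "y \<in> V" "A *\<^sub>v y = b \<cdot>\<^sub>v y"
    and "a * cnj b \<noteq> 1"
  shows "h x y = 0"
proof -
  have "h x y = h (A *\<^sub>v x) (A *\<^sub>v y)" by (rule isometry_h[OF A x(1) y(1), symmetric])
  also have "\<dots> = a * cnj b * h x y" using x(1) y(1) unfolding x(2) y(2) by simp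
  finally show ?thesis using assms(6) by simp
qed

text \<open>The inverse of \<open>A\<close> is its adjoint, so \<open>1 / cnj a\<close> is an eigenvalue along with \<open>a\<close>: the range of \<open>A - 1 / cnj a\<close> is
orthogonal to \<open>x\<close>, hence this map is not surjective.\<close>

lemma isometry_dual_eigenvalue:
  assumes A: "isometry A" and x: "x \<in> V" "x \<noteq> 0\<^sub>v m" "A *\<^sub>v x = a \<cdot>\<^sub>v x"
  obtains y where "y \<in> V" "y \<noteq> 0\<^sub>v m" "A *\<^sub>v y = (1 / cnj a) \<cdot>\<^sub>v y"
proof -
  have a0: "a \<noteq> 0"
  proof
    assume "a = 0"
    then have "A *\<^sub>v x = 0\<^sub>v m" using x by auto
    then show False using isometry_injective[OF A] x by auto
  qed
  let ?B = "A + (- (1 / cnj a)) \<cdot>\<^sub>m 1\<^sub>m m"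
  have AM: "A \<in> M" using A by simp
  have B: "?B \<in> M" using AM by simp
  have act: "?B *\<^sub>v y = A *\<^sub>v y + (- (1 / cnj a)) \<cdot>\<^sub>v y" if "y \<in> V" for y
    using that AM by (simp add: mv_mat_add mv_mat_smult)
  have orth: "h (?B *\<^sub>v y) x = 0" if y: "y \<in> V" for y
  proof -
    have "cnj a * h (A *\<^sub>v y) x = h (A *\<^sub>v y) (A *\<^sub>v x)" using AM y x(1) unfolding x(3) by simp
    also have "\<dots> = h y x" by (rule isometry_h[OF A y x(1)])
    finally show ?thesis unfolding act[OF y] using y x AM a0 by (simp add: field_simps)
  qed
  have "\<exists>y. y \<in> V \<and> y \<noteq> 0\<^sub>v m \<and> ?B *\<^sub>v y = 0\<^sub>v m"
  proof (rule ccontr)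
    assume n: "\<not> ?thesis"
    then obtain C where C: "C \<in> M" "?B * C = 1\<^sub>m m"
      using injective_imp_surjective_mat[OF B] by blast
    have "x = 0\<^sub>v m"
    proof (rule nondegD[OF x(1)])
      fix y assume y: "y \<in> V"
      have "?B *\<^sub>v (C *\<^sub>v y) = y" using C y B by (simp flip: mv_mult)
      then have "h y x = 0" using orth[of "C *\<^sub>v y"] C y by simp
      then show "h x y = 0" using h_orth_sym x y by simp
    qed
    then show False using x by simp
  qed
  then obtain y where y: "y \<in> V" "y \<noteq> 0\<^sub>v m" "?B *\<^sub>v y = 0\<^sub>v m" by blast
  have z: "A *\<^sub>v y + (- (1 / cnj a)) \<cdot>\<^sub>v y = 0\<^sub>v m" using y(3) act[OF y(1)] by simp
  have "A *\<^sub>v y = (1 / cnj a) \<cdot>\<^sub>v y"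
  proof (rule eq_vecI)
    fix i assume i: "i < dim_vec ((1 / cnj a) \<cdot>\<^sub>v y)"
    from z have "(A *\<^sub>v y + (- (1 / cnj a)) \<cdot>\<^sub>v y) $ i = (0\<^sub>v m) $ i" by simp
    then show "(A *\<^sub>v y) $ i = ((1 / cnj a) \<cdot>\<^sub>v y) $ i" using i y AM by simp
  qed (use y AM in auto)
  then show ?thesis using that y by blast
qed

text \<open>For a non-null \<open>w\<close> this fixes the orthogonal complement of \<open>w\<close> and multiplies \<open>w\<close> by \<open>l\<close>; \<open>l = -1\<close> is the reflection.\<close>

definition stretch :: "complex vec \<Rightarrow> complex \<Rightarrow> complex mat" where
  "stretch w l = 1\<^sub>m m + rank_one (((l - 1) / h w w) \<cdot>\<^sub>v w) w"

lemma stretch_carrier [simp]: "stretch w l \<in> M"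
  by (simp add: stretch_def)

lemma stretch_apply: "w \<in> V \<Longrightarrow> x \<in> V \<Longrightarrow> stretch w l *\<^sub>v x = x + ((l - 1) * h x w / h w w) \<cdot>\<^sub>v w"
  by (simp add: stretch_def mv_mat_add smult_smult_assoc mult.commute)

lemma stretch_orth [simp]: "w \<in> V \<Longrightarrow> x \<in> V \<Longrightarrow> h x w = 0 \<Longrightarrow> stretch w l *\<^sub>v x = x"
  by (simp add: stretch_apply)

lemma stretch_self: "w \<in> V \<Longrightarrow> h w w \<noteq> 0 \<Longrightarrow> stretch w l *\<^sub>v w = l \<cdot>\<^sub>v w"
  by (simp add: stretch_apply, intro eq_vecI) (auto simp: algebra_simps)

lemma det_stretch: "w \<in> V \<Longrightarrow> h w w \<noteq> 0 \<Longrightarrow> det (stretch w l) = l"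
  unfolding stretch_def by (subst det_one_plus_rank_one) auto

abbreviation reflection where "reflection w \<equiv> stretch w (- 1)"

lemma reflection_isometry [simp]:
  assumes w: "w \<in> V" "h w w \<noteq> 0"
  shows "isometry (reflection w)"
  unfolding isometry_def
proof (intro conjI ballI)
  fix x y assume xy: "x \<in> V" "y \<in> V"
  have r: "cnj (h w w) = h w w" using h_commute[OF w(1) w(1)] by simp
  have c: "cnj (h y w) = h w y" using h_commute[of y w] w xy by simp
  show "h (reflection w *\<^sub>v x) (reflection w *\<^sub>v y) = h x y"
    using w xy by (simp add: stretch_apply r c field_simps)
qed simp

lemma reflection_involution:
  assumes w: "w \<in> V" "h w w \<noteq> 0" and x: "x \<in> V"
  shows "reflection w *\<^sub>v (reflection w *\<^sub>v x) = x"
  using w x by (simp add: stretch_apply, intro eq_vecI) (auto simp: field_simps)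

text \<open>Equal norms and a real product make \<open>p + q\<close> orthogonal to \<open>p - q\<close>, so the reflection in \<open>p - q\<close> fixes one and negates
the other.\<close>

lemma reflection_swap:
  assumes p: "p \<in> V" and q: "q \<in> V" and eq: "h p p = h q q" and re: "Im (h p q) = 0"
    and nn: "h (p + (- 1) \<cdot>\<^sub>v q) (p + (- 1) \<cdot>\<^sub>v q) \<noteq> 0"
  shows "reflection (p + (- 1) \<cdot>\<^sub>v q) *\<^sub>v p = q" "reflection (p + (- 1) \<cdot>\<^sub>v q) *\<^sub>v q = p"
proof -
  let ?w = "p + (- 1) \<cdot>\<^sub>v q"
  have s: "h q p = h p q" using h_commute[OF p q] re by (simp add: complex_eq_iff)
  have w: "?w \<in> V" using p q by simp
  have ww: "h ?w ?w = 2 * h p ?w" using p q s eq by simp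
  have a: "reflection ?w *\<^sub>v p = p + (- 1) \<cdot>\<^sub>v ?w"
    using w p ww nn by (simp add: stretch_apply del: h_add_right h_smult_right h_add_left h_smult_left)
  also have "\<dots> = q" using p q by (intro eq_vecI) auto
  finally show 1: "reflection ?w *\<^sub>v p = q" .
  show "reflection ?w *\<^sub>v q = p" using reflection_involution[OF w nn p] 1 by simp
qed

end

section \<open>Eigenvectors and orthogonal systems\<close>

context hermitian_space
begin

lemma mv_zero [simp]: "A \<in> M \<Longrightarrow> A *\<^sub>v 0\<^sub>v m = 0\<^sub>v m"
  using mv_smult[of A "0\<^sub>v m" 0] by (simp del: mv_smult)

text \<open>The vector \<open>p(A) x\<close>, evaluated by Horner's scheme.\<close>

definition poly_act :: "complex mat \<Rightarrow> complex vec \<Rightarrow> complex poly \<Rightarrow> complex vec" where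
  "poly_act A x p = foldr (\<lambda>a v. a \<cdot>\<^sub>v x + A *\<^sub>v v) (coeffs p) (0\<^sub>v m)"

lemma poly_act_pCons: "A \<in> M \<Longrightarrow> x \<in> V \<Longrightarrow> poly_act A x (pCons a p) = a \<cdot>\<^sub>v x + A *\<^sub>v poly_act A x p"
  by (cases "a = 0 \<and> p = 0") (auto simp: poly_act_def cCons_def coeffs_pCons_eq_cCons)

lemma poly_act_0 [simp]: "poly_act A x 0 = 0\<^sub>v m"
  by (simp add: poly_act_def)

lemma poly_act_closed:
  assumes "A \<in> M" "x \<in> W" "W \<subseteq> V" "0\<^sub>v m \<in> W" "\<And>y z. y \<in> W \<Longrightarrow> z \<in> W \<Longrightarrow> y + z \<in> W"
    "\<And>a y. y \<in> W \<Longrightarrow> a \<cdot>\<^sub>v y \<in> W" "\<And>y. y \<in> W \<Longrightarrow> A *\<^sub>v y \<in> W"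
  shows "poly_act A x p \<in> W"
proof (induction p)
  case (pCons a p)
  then show ?case using assms poly_act_pCons[of A x a p] by auto
qed (use assms in auto)

lemma poly_act_V [simp]: "A \<in> M \<Longrightarrow> x \<in> V \<Longrightarrow> poly_act A x p \<in> V"
  by (rule poly_act_closed) auto

lemma poly_act_add:
  assumes "A \<in> M" "x \<in> V"
  shows "poly_act A x (p + q) = poly_act A x p + poly_act A x q"
proof (induction p q rule: poly_induct2)
  case (pCons a p b q)
  have "poly_act A x (pCons a p + pCons b q) = (a + b) \<cdot>\<^sub>v x + A *\<^sub>v (poly_act A x p + poly_act A x q)"
    using assms pCons by (simp add: poly_act_pCons)
  also have "\<dots> = poly_act A x (pCons a p) + poly_act A x (pCons b q)"
  proof -
    have "A *\<^sub>v poly_act A x p \<in> V" "A *\<^sub>v poly_act A x q \<in> V" using assms by auto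
    then show ?thesis using assms
      by (simp add: poly_act_pCons, intro eq_vecI) (auto simp: algebra_simps)
  qed
  finally show ?case .
qed auto

lemma poly_act_smult:
  assumes "A \<in> M" "x \<in> V"
  shows "poly_act A x (smult c p) = c \<cdot>\<^sub>v poly_act A x p"
proof (induction p)
  case (pCons a p)
  have "A *\<^sub>v poly_act A x p \<in> V" using assms by auto
  then show ?case using assms pCons
    by (simp add: poly_act_pCons, intro eq_vecI) (auto simp: algebra_simps)
qed auto

lemma poly_act_monom: "A \<in> M \<Longrightarrow> x \<in> V \<Longrightarrow> poly_act A x (monom c k) = c \<cdot>\<^sub>v poly_act A x (monom 1 k)"
  using poly_act_smult[of A x c "monom 1 k"] by (simp add: smult_monom)

lemma poly_act_index:
  assumes "A \<in> M" "x \<in> V" "i < m"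
  shows "poly_act A x (\<Sum>k<n. monom (c k) k) $ i = (\<Sum>k<n. poly_act A x (monom 1 k) $ i * c k)"
proof (induction n)
  case (Suc n)
  then show ?case using assms
    by (simp add: poly_act_add poly_act_monom[of A x "c n"] carrier_vecD[OF poly_act_V[OF assms(1,2)]])
qed (use assms in auto)

text \<open>An eigenvector of \<open>A\<close> on the quotient \<open>W / Z\<close>, without restricting matrices to subspaces: among the nonzero
polynomials \<open>p\<close> with \<open>p(A) x\<close> in \<open>Z\<close> take one of least degree, divide by a linear factor \<open>X - l\<close>, and apply the
quotient to \<open>x\<close>.  Such polynomials exist because \<open>m + 1\<close> vectors in dimension \<open>m\<close> are dependent.\<close>

lemma eigenvector_modulo_subspace:
  assumes A: "A \<in> M" and WV: "W \<subseteq> V"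
    and W: "\<And>y z. y \<in> W \<Longrightarrow> z \<in> W \<Longrightarrow> y + z \<in> W" "\<And>a y. y \<in> W \<Longrightarrow> a \<cdot>\<^sub>v y \<in> W"
           "\<And>y. y \<in> W \<Longrightarrow> A *\<^sub>v y \<in> W"
    and Z: "0\<^sub>v m \<in> Z" "\<And>a y. y \<in> Z \<Longrightarrow> a \<cdot>\<^sub>v y \<in> Z"
    and x: "x \<in> W" "x \<notin> Z"
  obtains y l where "y \<in> W" "y \<notin> Z" "A *\<^sub>v y + (- l) \<cdot>\<^sub>v y \<in> Z"
proof -
  have xV: "x \<in> V" using x WV by auto
  have W0: "0\<^sub>v m \<in> W" using W(2)[OF x(1), of 0] xV by simp
  let ?P = "\<lambda>p. p \<noteq> 0 \<and> poly_act A x p \<in> Z"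
  have ex: "\<exists>p. ?P p"
  proof -
    obtain c where c: "c \<in> carrier_vec (Suc m)" "c \<noteq> 0\<^sub>v (Suc m)"
      "\<And>i. i < m \<Longrightarrow> (\<Sum>j<Suc m. poly_act A x (monom 1 j) $ i * c $ j) = 0"
      using underdetermined_system[of m "Suc m" "\<lambda>i j. poly_act A x (monom 1 j) $ i"] by auto
    let ?p = "\<Sum>k<Suc m. monom (c $ k) k"
    have "poly_act A x ?p = 0\<^sub>v m"
    proof (rule eq_vecI)
      fix i assume "i < dim_vec (0\<^sub>v m)"
      then show "poly_act A x ?p $ i = 0\<^sub>v m $ i"
        using poly_act_index[OF A xV, of i "\<lambda>k. c $ k" "Suc m"] c(3)[of i] by simp
    qed (use carrier_vecD[OF poly_act_V[OF A xV]] in simp)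
    moreover have "?p \<noteq> 0"
    proof
      assume p0: "?p = 0"
      obtain j where j: "j < Suc m" "c $ j \<noteq> 0"
      proof (rule ccontr)
        assume "\<not> thesis"
        then have "\<And>j. j < Suc m \<Longrightarrow> c $ j = 0" using that by blast
        then have "c = 0\<^sub>v (Suc m)" using c(1) by (intro eq_vecI) auto
        then show False using c(2) by simp
      qed
      have "coeff ?p j = (\<Sum>k<Suc m. if k = j then c $ k else 0)"
        unfolding coeff_sum by (rule sum.cong) auto
      also have "\<dots> = c $ j" using j(1) by (subst sum.delta) auto
      finally show False using p0 j by (metis coeff_0)
    qed
    ultimately show ?thesis using Z(1) by auto
  qed
  define p where "p = (ARG_MIN degree p. ?P p)"
  have p: "?P p" unfolding p_def by (rule arg_min_natI[of ?P, OF someI_ex[OF ex]])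
  have min: "degree p \<le> degree q" if "?P q" for q
    unfolding p_def by (rule arg_min_nat_le[of ?P, OF that])
  \<comment> \<open>degree 0 would put a nonzero multiple of x, hence x itself, into Z\<close>
  have "degree p \<noteq> 0"
  proof
    assume "degree p = 0"
    then obtain a where a: "p = [:a:]" by (meson degree_eq_zeroE)
    then have "a \<cdot>\<^sub>v x \<in> Z" using p A xV by (simp add: poly_act_pCons)
    then have "(1 / a) \<cdot>\<^sub>v (a \<cdot>\<^sub>v x) \<in> Z" using Z by blast
    then show False using x a p by (simp add: smult_smult_assoc)
  qed
  then have "\<not> constant (poly p)" by (simp add: constant_degree)
  then obtain l where l: "poly p l = 0" using fundamental_theorem_of_algebra by blast
  then obtain q where q: "p = [:- l, 1:] * q" using poly_eq_0_iff_dvd by (metis dvdE)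
  then have q0: "q \<noteq> 0" using p by auto
  then have "degree p = Suc (degree q)" unfolding q by (subst degree_mult_eq) auto
  then have nz: "poly_act A x q \<notin> Z" using min[of q] q0 by auto
  have "p = pCons 0 q + smult (- l) q" unfolding q by simp
  then have "poly_act A x p = A *\<^sub>v poly_act A x q + (- l) \<cdot>\<^sub>v poly_act A x q"
    using A xV by (simp add: poly_act_add poly_act_smult poly_act_pCons del: smult_minus_left)
  then have "A *\<^sub>v poly_act A x q + (- l) \<cdot>\<^sub>v poly_act A x q \<in> Z" using p by simp
  moreover have "poly_act A x q \<in> W" by (rule poly_act_closed[OF A x(1) WV W0 W])
  ultimately show ?thesis using that nz by blast
qed

definition orthogonal :: "complex vec set \<Rightarrow> bool" where
  "orthogonal E \<longleftrightarrow> finite E \<and> E \<subseteq> V \<and> (\<forall>e\<in>E. h e e \<noteq> 0) \<and> (\<forall>e\<in>E. \<forall>d\<in>E. e \<noteq> d \<longrightarrow> h e d = 0)"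

definition orthonormal :: "complex vec set \<Rightarrow> bool" where
  "orthonormal E \<longleftrightarrow> orthogonal E \<and> (\<forall>e\<in>E. h e e = 1)"

definition perp :: "complex vec set \<Rightarrow> complex vec set" where
  "perp E = {x \<in> V. \<forall>e\<in>E. h x e = 0}"

lemma perpD: "x \<in> perp E \<Longrightarrow> x \<in> V" "x \<in> perp E \<Longrightarrow> e \<in> E \<Longrightarrow> h x e = 0"
  by (auto simp: perp_def)

lemma perp_add: "E \<subseteq> V \<Longrightarrow> x \<in> perp E \<Longrightarrow> y \<in> perp E \<Longrightarrow> x + y \<in> perp E"
  and perp_smult: "E \<subseteq> V \<Longrightarrow> x \<in> perp E \<Longrightarrow> a \<cdot>\<^sub>v x \<in> perp E"
  and perp_zero: "E \<subseteq> V \<Longrightarrow> 0\<^sub>v m \<in> perp E"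
  by (auto simp: perp_def subset_iff)

lemma orthogonal_card_lt:
  assumes E: "orthogonal E" and c: "card E < m"
  obtains x where "x \<in> perp E" "x \<noteq> 0\<^sub>v m"
proof -
  have "finite E" using E by (simp add: orthogonal_def)
  then obtain b where b: "bij_betw b {0..<card E} E"
    using ex_bij_betw_nat_finite by blast
  obtain x where x: "x \<in> V" "x \<noteq> 0\<^sub>v m"
    "\<And>i. i < card E \<Longrightarrow> (\<Sum>j<m. h (unit_vec m j) (b i) * x $ j) = 0"
    using underdetermined_system[OF c, of "\<lambda>i j. h (unit_vec m j) (b i)"] by blast
  have "h x e = 0" if "e \<in> E" for e
  proof -
    have "e \<in> b ` {0..<card E}" using b that by (simp add: bij_betw_def)
    then obtain i where i: "i < card E" "e = b i" by auto
    have "e \<in> V" using E that by (auto simp: orthogonal_def)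
    then show ?thesis using x(3)[OF i(1)] h_coordinates[OF x(1), of e] i(2) by (simp add: mult.commute)
  qed
  then show ?thesis using that x by (auto simp: perp_def)
qed

lemma orthogonal_card_eq:
  assumes E: "orthogonal E" and c: "card E = m" and x: "x \<in> perp E"
  shows "x = 0\<^sub>v m"
proof (rule ccontr)
  assume x0: "x \<noteq> 0\<^sub>v m"
  have fin: "finite E" and EV: "E \<subseteq> V" using E by (auto simp: orthogonal_def)
  obtain b where b: "bij_betw b {0..<m} E"
    using fin c ex_bij_betw_nat_finite by blast
  have bE: "b i \<in> E" if "i < m" for i using b that by (auto simp: bij_betw_def)
  then have bV: "b i \<in> V" if "i < m" for i using EV that by blast
  let ?K = "mat m m (\<lambda>(i, j). h (unit_vec m j) (b i))"
  have K: "?K \<in> M" by simp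
  have "?K *\<^sub>v x = 0\<^sub>v m"
  proof (rule eq_vecI)
    fix i assume "i < dim_vec (0\<^sub>v m)"
    then have i: "i < m" by simp
    have "(?K *\<^sub>v x) $ i = h x (b i)"
      using i bV[OF i] perpD(1)[OF x] by (simp add: h_coordinates[of x "b i"] scalar_prod_def lessThan_atLeast0 mult.commute)
    also have "\<dots> = 0" using perpD(2)[OF x] bE i by blast
    finally show "(?K *\<^sub>v x) $ i = 0\<^sub>v m $ i" using i by simp
  qed simp
  then have "det ?K = 0" using det_0_iff_vec_prod_zero[OF K] x0 perpD(1)[OF x] by blast
  then have "det (?K\<^sup>T) = 0" using det_transpose[OF K] by simp
  then obtain y where y: "y \<in> V" "y \<noteq> 0\<^sub>v m" "?K\<^sup>T *\<^sub>v y = 0\<^sub>v m"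
    using det_0_iff_vec_prod_zero[of "?K\<^sup>T" m] K by auto
  have col: "(\<Sum>i<m. h (unit_vec m j) (b i) * y $ i) = 0" if "j < m" for j
  proof -
    have "(?K\<^sup>T *\<^sub>v y) $ j = 0" using y(3) that by simp
    then show ?thesis using that y(1) by (simp add: scalar_prod_def lessThan_atLeast0)
  qed
  have "y $ k = 0" if k: "k < m" for k
  proof -
    have "0 = (\<Sum>j<m. b k $ j * (\<Sum>i<m. h (unit_vec m j) (b i) * y $ i))" using col by simp
    also have "\<dots> = (\<Sum>i<m. (\<Sum>j<m. b k $ j * h (unit_vec m j) (b i)) * y $ i)"
      unfolding sum_distrib_left sum_distrib_right by (subst sum.swap) (simp add: ac_simps)
    also have "\<dots> = (\<Sum>i<m. h (b k) (b i) * y $ i)"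
      by (rule sum.cong) (use h_coordinates[OF bV[OF k] bV] in auto)
    also have "\<dots> = (\<Sum>i<m. if i = k then h (b k) (b k) * y $ k else 0)"
    proof (rule sum.cong[OF refl])
      fix i assume "i \<in> {..<m}"
      then have i: "i < m" by simp
      have "h (b k) (b i) = 0" if "i \<noteq> k"
      proof -
        have "b i \<noteq> b k" using b i k that unfolding bij_betw_def inj_on_def by auto
        then show ?thesis using E bE[OF i] bE[OF k] unfolding orthogonal_def by auto
      qed
      then show "h (b k) (b i) * y $ i = (if i = k then h (b k) (b k) * y $ k else 0)" by auto
    qed
    also have "\<dots> = h (b k) (b k) * y $ k" using k by simp
    finally show ?thesis using E bE[OF k] by (auto simp: orthogonal_def)
  qed
  then show False using y(1,2) by (metis eq_vecI carrier_vecD index_zero_vec)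
qed

lemma orthogonal_card_le:
  assumes E: "orthogonal E" shows "card E \<le> m"
proof (rule ccontr)
  assume n: "\<not> ?thesis"
  then obtain F where F: "F \<subseteq> E" "card F = m" using obtain_subset_with_card_n[of m E] by auto
  then obtain e where e: "e \<in> E" "e \<notin> F" using n by (metis order_refl subsetI subset_antisym)
  have "orthogonal F" using E F by (auto simp: orthogonal_def finite_subset subset_iff)
  moreover have "e \<in> perp F" unfolding perp_def
  proof (intro CollectI conjI ballI)
    show "e \<in> V" using E e by (auto simp: orthogonal_def)
    fix d assume "d \<in> F"
    then have "d \<in> E" "e \<noteq> d" using F e by auto
    then show "h e d = 0" using E e unfolding orthogonal_def by blast
  qed
  ultimately have "e = 0\<^sub>v m" using orthogonal_card_eq F(2) by blast
  then show False using E e by (auto simp: orthogonal_def)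
qed

lemma remove_component:
  assumes e: "e \<in> V" "h e e = 1" and x: "x \<in> V"
  obtains y where "y \<in> V" "h y e = 0" "x = y + h x e \<cdot>\<^sub>v e" 
    "\<And>d. d \<in> V \<Longrightarrow> h e d = 0 \<Longrightarrow> h y d = h x d"
proof (rule that[of "x + (- h x e) \<cdot>\<^sub>v e"])
  show "x = x + (- h x e) \<cdot>\<^sub>v e + h x e \<cdot>\<^sub>v e" using e x by (intro eq_vecI) auto
qed (use e x in auto)

text \<open>Every vector is a vector orthogonal to \<open>E\<close> plus a combination of \<open>E\<close>; stated as an induction rule it replaces finite sums.\<close>

lemma orthonormal_induct:
  assumes E: "orthonormal E" and x: "x \<in> V"
    and base: "\<And>x. x \<in> perp E \<Longrightarrow> P x"
    and step: "\<And>x e a. x \<in> V \<Longrightarrow> e \<in> E \<Longrightarrow> P x \<Longrightarrow> P (x + a \<cdot>\<^sub>v e)"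
  shows "P x"
proof -
  have EV: "E \<subseteq> V" and fin: "finite E" using E by (auto simp: orthonormal_def orthogonal_def)
  have "F \<subseteq> E \<Longrightarrow> x \<in> perp (E - F) \<Longrightarrow> P x" if "finite F" for F x
    using that
  proof (induction F arbitrary: x)
    case (insert e F)
    have e: "e \<in> V" "h e e = 1" "e \<in> E" using insert.prems E EV by (auto simp: orthonormal_def)
    obtain y where y: "y \<in> V" "h y e = 0" "x = y + h x e \<cdot>\<^sub>v e" 
      "\<And>d. d \<in> V \<Longrightarrow> h e d = 0 \<Longrightarrow> h y d = h x d"
      using remove_component[OF e(1,2) perpD(1)[OF insert.prems(2)]] by blast
    have "h y d = 0" if "d \<in> E - F" for d
    proof (cases "d = e")
      case False
      then have "h e d = 0" using E e that unfolding orthonormal_def orthogonal_def by auto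
      then show ?thesis using y(4)[of d] that EV perpD(2)[OF insert.prems(2), of d] False by auto
    qed (use y in simp)
    then have "P y" using insert y(1) by (auto simp: perp_def)
    then show ?case using step[OF y(1) e(3)] y(3) by metis
  qed (use base in auto)
  from this[OF fin order_refl, of x] show ?thesis using x by (simp add: perp_def)
qed

end

section \<open>Chains of eigenvectors\<close>

context hermitian_space
begin

definition involution :: "complex mat \<Rightarrow> bool" where
  "involution A \<longleftrightarrow> isometry A \<and> (\<forall>x\<in>V. A *\<^sub>v (A *\<^sub>v x) = x)"

lemma involution_isometry [simp]: "involution A \<Longrightarrow> isometry A"
  and involution_twice [simp]: "involution A \<Longrightarrow> x \<in> V \<Longrightarrow> A *\<^sub>v (A *\<^sub>v x) = x"
  by (auto simp: involution_def simp del: isometry_h)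

lemma involution_one [simp]: "involution (1\<^sub>m m)"
  unfolding involution_def by simp

lemma involution_reflection: "w \<in> V \<Longrightarrow> h w w \<noteq> 0 \<Longrightarrow> involution (reflection w)"
  unfolding involution_def by (simp add: reflection_involution)

text \<open>An isometry commutes with every stretch along one of its own eigenvectors, because it also preserves the complement.\<close>

lemma stretch_commute:
  assumes A: "isometry A" and w: "w \<in> V" "A *\<^sub>v w = a \<cdot>\<^sub>v w" "h w w \<noteq> 0" and x: "x \<in> V"
  shows "A *\<^sub>v (stretch w l *\<^sub>v x) = stretch w l *\<^sub>v (A *\<^sub>v x)"
proof -
  have "cmod a = 1" by (rule isometry_eigenvalue_norm[OF A w])
  then have a: "a * cnj a = 1" by (simp add: complex_norm_square[symmetric])
  have "cnj a * h (A *\<^sub>v x) w = h (A *\<^sub>v x) (A *\<^sub>v w)" using A w(1) x unfolding w(2) by simp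
  also have "\<dots> = h x w" by (rule isometry_h[OF A x w(1)])
  finally have "h (A *\<^sub>v x) w = a * h x w" using a by (metis mult.assoc mult.left_neutral mult.commute)
  then show ?thesis using A w x
    by (simp add: stretch_apply smult_smult_assoc ac_simps)
qed

lemma involution_mult_reflection:
  assumes A: "involution A" and w: "w \<in> V" "A *\<^sub>v w = w" "h w w \<noteq> 0"
  shows "involution (A * reflection w)"
proof -
  have R: "isometry (reflection w)" using w by simp
  have "(A * reflection w) *\<^sub>v ((A * reflection w) *\<^sub>v x) = x" if x: "x \<in> V" for x
  proof -
    have c: "A *\<^sub>v (reflection w *\<^sub>v y) = reflection w *\<^sub>v (A *\<^sub>v y)" if "y \<in> V" for y
      using stretch_commute[of A w 1 y "- 1"] A w that by simp
    show ?thesis using A w x c[of "A *\<^sub>v (reflection w *\<^sub>v x)"]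
      by (simp add: c reflection_involution)
  qed
  then show ?thesis using A R unfolding involution_def[of "A * _"] by simp
qed

lemma involution_square: "involution A \<Longrightarrow> A * A = 1\<^sub>m m"
  by (rule mat_eq_by_action[of _ m]) auto

lemma det_involution:
  assumes A: "involution A" shows "(det A)\<^sup>2 = 1"
proof -
  have M: "A \<in> M" using A by simp
  have "A * A = 1\<^sub>m m" by (rule involution_square[OF A])
  then show ?thesis using det_mult[OF M M] by (simp add: power2_eq_square)
qed

abbreviation twice_act where
  "twice_act C A f x \<equiv> C *\<^sub>v (A *\<^sub>v (f *\<^sub>v (C *\<^sub>v (A *\<^sub>v (f *\<^sub>v x)))))"

text \<open>An intermediate stage of the construction of \<open>C\<close>.  The vectors of \<open>E\<close> are not yet used: \<open>A\<close> and \<open>C\<close> fix them.  On the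
complement of \<open>E\<close>, \<open>C\<close> already conjugates \<open>R = Af\<close> to its inverse, except on the line of the eigenvector \<open>u\<close>, whose
eigenvalue \<open>z\<close> still needs a partner with eigenvalue \<open>cnj z\<close>.\<close>

definition chain where
  "chain f A C u z E \<longleftrightarrow> isometry f \<and> involution A \<and> involution C \<and> orthonormal E \<and>
     (\<forall>e\<in>E. (\<exists>a. f *\<^sub>v e = a \<cdot>\<^sub>v e) \<and> A *\<^sub>v e = e \<and> C *\<^sub>v e = e) \<and>
     u \<in> perp E \<and> h u u = 1 \<and> C *\<^sub>v u = u \<and> A *\<^sub>v (f *\<^sub>v u) = z \<cdot>\<^sub>v u \<and>
     (\<forall>x\<in>perp E. h x u = 0 \<longrightarrow> twice_act C A f x = x)"

lemma orthonormalD: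
  assumes "orthonormal E"
  shows "finite E" "E \<subseteq> V" "e \<in> E \<Longrightarrow> e \<in> V" "e \<in> E \<Longrightarrow> h e e = 1"
    "e \<in> E \<Longrightarrow> d \<in> E \<Longrightarrow> e \<noteq> d \<Longrightarrow> h e d = 0"
  using assms unfolding orthonormal_def orthogonal_def by blast+

lemma orthonormal_subset: "orthonormal E \<Longrightarrow> F \<subseteq> E \<Longrightarrow> orthonormal F"
  unfolding orthonormal_def orthogonal_def by (meson finite_subset subsetD subset_trans)

lemma chain_orth:
  assumes c: "chain f A C u z E" and e: "e \<in> E" and x: "x \<in> V" "h x e = 0"
  shows "h (f *\<^sub>v x) e = 0" "h (A *\<^sub>v x) e = 0" "h (C *\<^sub>v x) e = 0"
proof -
  have iso: "isometry f" "isometry A" "isometry C" using c by (auto simp: chain_def)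
  have eV: "e \<in> V" "h e e = 1" using c e orthonormalD unfolding chain_def by blast+
  obtain a where a: "f *\<^sub>v e = a \<cdot>\<^sub>v e" using c e unfolding chain_def by blast
  have "cmod a = 1" by (rule isometry_eigenvalue_norm[OF iso(1) eV(1) a]) (use eV in simp)
  then have a0: "a \<noteq> 0" by auto
  have fx: "A *\<^sub>v e = 1 \<cdot>\<^sub>v e" "C *\<^sub>v e = 1 \<cdot>\<^sub>v e" using c e unfolding chain_def by auto
  show "h (f *\<^sub>v x) e = 0" by (rule isometry_preserves_orth[OF iso(1) eV(1) a a0 x])
  show "h (A *\<^sub>v x) e = 0" "h (C *\<^sub>v x) e = 0"
    using isometry_preserves_orth[OF iso(2) eV(1) fx(1) _ x]
      isometry_preserves_orth[OF iso(3) eV(1) fx(2) _ x] by auto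
qed

text \<open>Another square root of the same isometry: the sign of the eigenvalue at \<open>e\<close> can be changed freely.\<close>

lemma chain_flip:
  assumes c: "chain f A C u z E" and e: "e \<in> E"
  defines "g \<equiv> f * reflection e"
  shows "chain g A C u z E" "g * g = f * f" "\<And>d. d \<in> E \<Longrightarrow> d \<noteq> e \<Longrightarrow> g *\<^sub>v d = f *\<^sub>v d"
    "g *\<^sub>v e = (- 1) \<cdot>\<^sub>v (f *\<^sub>v e)"
proof -
  have iso: "isometry f" "isometry A" "isometry C" and E: "orthonormal E" 
    using c by (auto simp: chain_def)
  have eV: "e \<in> V" "h e e = 1" "h e e \<noteq> 0" using E e orthonormalD by auto
  obtain a where a: "f *\<^sub>v e = a \<cdot>\<^sub>v e" using c e unfolding chain_def by blast
  have fM: "f \<in> M" using iso by simp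
  have gV: "g *\<^sub>v x = f *\<^sub>v (reflection e *\<^sub>v x)" if "x \<in> V" for x
    using fM that by (simp add: g_def)
  have gx: "g *\<^sub>v x = f *\<^sub>v x" if "x \<in> V" "h x e = 0" for x
    using gV eV that by simp
  show ge: "g *\<^sub>v e = (- 1) \<cdot>\<^sub>v (f *\<^sub>v e)" using gV eV fM by (simp add: stretch_self)
  show gd: "g *\<^sub>v d = f *\<^sub>v d" if "d \<in> E" "d \<noteq> e" for d
    using gx orthonormalD[OF E] that e by auto
  have gi: "isometry g" unfolding g_def using iso eV by simp
  show "g * g = f * f"
  proof (rule mat_eq_by_action[of _ m])
    fix x assume x: "x \<in> V"
    have "g *\<^sub>v (g *\<^sub>v x) = f *\<^sub>v (f *\<^sub>v (reflection e *\<^sub>v (reflection e *\<^sub>v x)))"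
      using gV x fM stretch_commute[OF iso(1) eV(1) a eV(3), of "reflection e *\<^sub>v x" "- 1"] by simp
    then show "(g * g) *\<^sub>v x = (f * f) *\<^sub>v x" using x fM gi eV by (simp add: reflection_involution)
  qed (use fM gi in auto)
  show "chain g A C u z E"
    unfolding chain_def
  proof (intro conjI ballI impI)
    show "\<exists>a. g *\<^sub>v d = a \<cdot>\<^sub>v d" if d: "d \<in> E" for d
    proof (cases "d = e")
      case True
      then show ?thesis using ge a eV by (auto simp: smult_smult_assoc)
    next
      case False
      then show ?thesis using gd c d by (auto simp: chain_def)
    qed
    have "u \<in> V" "h u e = 0" using c e by (auto simp: chain_def perp_def)
    then show "A *\<^sub>v (g *\<^sub>v u) = z \<cdot>\<^sub>v u" using gx c by (auto simp: chain_def)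
    fix x assume x: "x \<in> perp E" "h x u = 0"
    have xe: "x \<in> V" "h x e = 0" using x e by (auto simp: perp_def)
    have "h (C *\<^sub>v (A *\<^sub>v (f *\<^sub>v x))) e = 0"
      using chain_orth[OF c e] xe iso by simp
    then show "twice_act C A g x = x"
      using gx xe iso c x by (simp add: chain_def)
  qed (use c gi in \<open>auto simp: chain_def\<close>)
qed

text \<open>The reflection that swaps \<open>p\<close> and \<open>q\<close> exists unless \<open>p = q\<close>, when \<open>B = A\<close> serves; its vector is not null because
the plane is positive definite.\<close>

lemma swap_in_plane:
  assumes on: "orthonormal {e, e'}" "e \<noteq> e'"
    and ab: "(al::real)\<^sup>2 + be\<^sup>2 = 1" 
    and p: "p = complex_of_real al \<cdot>\<^sub>v e + complex_of_real be \<cdot>\<^sub>v e'"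
    and q: "q = c \<cdot>\<^sub>v e + d \<cdot>\<^sub>v e'" and qq: "h q q = 1" and re: "Im (h p q) = 0"
    and A: "involution A" "A *\<^sub>v e = e" "A *\<^sub>v e' = e'"
  obtains B where "involution B" "B *\<^sub>v q = p"
    "\<And>x. x \<in> perp {e, e'} \<Longrightarrow> B *\<^sub>v x = A *\<^sub>v x"
    "\<And>c d. \<exists>c' d'. B *\<^sub>v (c \<cdot>\<^sub>v e + d \<cdot>\<^sub>v e') = c' \<cdot>\<^sub>v e + d' \<cdot>\<^sub>v e'"
proof -
  have e: "e \<in> V" "e' \<in> V" "h e e = 1" "h e' e' = 1" "h e e' = 0" "h e' e = 0"
    using orthonormalD[OF on(1)] on(2) by auto
  have pq: "p \<in> V" "q \<in> V" using p q e by auto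
  have AM: "A \<in> M" using A by simp
  have Apl: "A *\<^sub>v (c \<cdot>\<^sub>v e + d \<cdot>\<^sub>v e') = c \<cdot>\<^sub>v e + d \<cdot>\<^sub>v e'" for c d using A e AM by simp
  show ?thesis
  proof (cases "p = q")
    case True
    then show ?thesis using that[of A] A Apl p by auto
  next
    case False
    let ?w = "p + (- 1) \<cdot>\<^sub>v q"
    have w: "?w \<in> V" using pq by simp
    have we: "?w = (al - c) \<cdot>\<^sub>v e + (be - d) \<cdot>\<^sub>v e'" unfolding p q using e
      by (intro eq_vecI) (auto simp: algebra_simps)
    have Aw: "A *\<^sub>v ?w = ?w" unfolding we by (rule Apl)
    have ww: "h ?w ?w \<noteq> 0"
    proof
      assume "h ?w ?w = 0"
      then have "(al - c) * cnj (al - c) + (be - d) * cnj (be - d) = 0"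
        unfolding we using e by (simp add: mult.commute del: complex_cnj_diff)
      then have "complex_of_real ((cmod (al - c))\<^sup>2 + (cmod (be - d))\<^sup>2) = 0"
        by (simp only: complex_norm_square of_real_add)
      then have "(cmod (al - c))\<^sup>2 + (cmod (be - d))\<^sup>2 = 0" by (simp only: of_real_eq_0_iff)
      then have "al = c" "be = d" by (auto simp: add_nonneg_eq_0_iff)
      then show False using False p q by simp
    qed
    have pp: "h p p = h q q" unfolding qq unfolding p using e ab
      by (simp add: power2_eq_square flip: of_real_mult of_real_add)
    show ?thesis
    proof (rule that[of "A * reflection ?w"])
      show "involution (A * reflection ?w)" by (rule involution_mult_reflection[OF A(1) w Aw ww])
      have "A *\<^sub>v p = p" unfolding p by (rule Apl)
      then show "(A * reflection ?w) *\<^sub>v q = p"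
        using reflection_swap(2)[OF pq pp re ww] AM pq by simp
      show "(A * reflection ?w) *\<^sub>v x = A *\<^sub>v x" if "x \<in> perp {e, e'}" for x
      proof -
        have x: "x \<in> V" "h x e = 0" "h x e' = 0" using that by (auto simp: perp_def)
        then have "h x ?w = 0" unfolding we using e by simp
        then show ?thesis using AM x w by simp
      qed
      fix c1 d1
      let ?v = "c1 \<cdot>\<^sub>v e + d1 \<cdot>\<^sub>v e'"
      obtain k where k: "reflection ?w *\<^sub>v ?v = ?v + k \<cdot>\<^sub>v ?w"
        using stretch_apply[OF w, of ?v "-1"] e by auto
      have "?v + k \<cdot>\<^sub>v ?w = (c1 + k * (al - c)) \<cdot>\<^sub>v e + (d1 + k * (be - d)) \<cdot>\<^sub>v e'"
        unfolding we using e by (intro eq_vecI) (auto simp: algebra_simps)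
      then have "(A * reflection ?w) *\<^sub>v ?v = (c1 + k * (al - c)) \<cdot>\<^sub>v e + (d1 + k * (be - d)) \<cdot>\<^sub>v e'"
        using k Apl AM e by (simp del: mv_add mv_smult)
      then show "\<exists>c' d'. (A * reflection ?w) *\<^sub>v ?v = c' \<cdot>\<^sub>v e + d' \<cdot>\<^sub>v e'" by blast
    qed
  qed
qed

lemma mv_combination:
  "A \<in> M \<Longrightarrow> x \<in> V \<Longrightarrow> y \<in> V \<Longrightarrow> z \<in> V \<Longrightarrow>
    A *\<^sub>v (x + a \<cdot>\<^sub>v y + b \<cdot>\<^sub>v z) = A *\<^sub>v x + a \<cdot>\<^sub>v (A *\<^sub>v y) + b \<cdot>\<^sub>v (A *\<^sub>v z)"
  by (simp add: assoc_add_vec[of _ m])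

lemma chain_choose_sign:
  assumes c: "chain f A C u z E" and e: "e \<in> E" "f *\<^sub>v e = a \<cdot>\<^sub>v e" and s: "s = 1 \<or> s = - 1"
  obtains g where "chain g A C u z E" "g * g = f * f" "g *\<^sub>v e = (s * a) \<cdot>\<^sub>v e"
    "\<And>d. d \<in> E \<Longrightarrow> d \<noteq> e \<Longrightarrow> g *\<^sub>v d = f *\<^sub>v d"
proof (cases "s = 1")
  case True
  then show ?thesis using that[of f] c e by simp
next
  case False
  then have s: "s = - 1" using s by simp
  show ?thesis using that[of "f * reflection e"] chain_flip[OF c e(1)] e(2) s
    by (simp add: smult_smult_assoc)
qed

lemma chain_z: "chain f A C u z E \<Longrightarrow> z * cnj z = 1"
proof -
  assume c: "chain f A C u z E"
  have i: "isometry (A * f)" and u: "u \<in> V" "h u u \<noteq> 0" and e: "A *\<^sub>v (f *\<^sub>v u) = z \<cdot>\<^sub>v u"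
    and M: "A \<in> M" "f \<in> M"
    using c by (auto simp: chain_def perp_def)
  have "(A * f) *\<^sub>v u = z \<cdot>\<^sub>v u" using e M u by simp
  from isometry_eigenvalue_norm[OF i u(1) this u(2)]
  show "z * cnj z = 1" by (simp add: complex_norm_square[symmetric])
qed

text \<open>Two eigenvectors of \<open>R\<close> with conjugate eigenvalues are paired by adding to \<open>C\<close> the reflection that swaps them.  It
commutes with \<open>C\<close>, and nothing changes on the orthogonal complement of the two.\<close>

lemma link_eigenvectors:
  assumes f: "isometry f" and A: "involution A" and C: "involution C"
    and u: "u \<in> V" "h u u = 1" "C *\<^sub>v u = u" and p: "p \<in> V" "h p p = 1" "C *\<^sub>v p = p"
    and up: "h u p = 0" and z: "z * cnj z = 1"
    and Ru: "A *\<^sub>v (f *\<^sub>v u) = z \<cdot>\<^sub>v u" and Rp: "A *\<^sub>v (f *\<^sub>v p) = cnj z \<cdot>\<^sub>v p"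
    and E: "E \<subseteq> V" "u \<in> perp E" "p \<in> perp E"
    and rev: "\<And>y. y \<in> perp E \<Longrightarrow> h y u = 0 \<Longrightarrow> h y p = 0 \<Longrightarrow>
                twice_act C A f y = y"
  obtains D where "involution D" "\<And>x. x \<in> V \<Longrightarrow> h x u = 0 \<Longrightarrow> h x p = 0 \<Longrightarrow> D *\<^sub>v x = C *\<^sub>v x"
    "\<And>x. x \<in> perp E \<Longrightarrow> twice_act D A f x = x"
proof -
  have M: "f \<in> M" "A \<in> M" "C \<in> M" using f A C by auto
  have pu: "h p u = 0" using up u(1) p(1) h_orth_sym by simp
  let ?w = "u + (- 1) \<cdot>\<^sub>v p"
  have wV: "?w \<in> V" and ww: "h ?w ?w \<noteq> 0" using u p up pu by auto
  have Cw: "C *\<^sub>v ?w = ?w" using M u p by simp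
  define D where "D = C * reflection ?w"
  have D: "involution D" unfolding D_def by (rule involution_mult_reflection[OF C wV Cw ww])
  have DM: "D \<in> M" using D by simp
  have Dx: "D *\<^sub>v x = C *\<^sub>v x" if "x \<in> V" "h x u = 0" "h x p = 0" for x
    using that u p M wV by (simp add: D_def)
  have sw: "reflection ?w *\<^sub>v u = p" "reflection ?w *\<^sub>v p = u"
    using reflection_swap[of u p] u p up ww by auto
  have Du: "D *\<^sub>v u = p" and Dp: "D *\<^sub>v p = u" using M u p sw by (auto simp: D_def)
  let ?T = "\<lambda>x. twice_act D A f x"
  have zn: "z \<noteq> 0" "cnj z \<noteq> 0" using z by auto
  have iR: "isometry (A * f)" using A f by simp
  have presR: "h (A *\<^sub>v (f *\<^sub>v y)) u = 0" "h (A *\<^sub>v (f *\<^sub>v y)) p = 0"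
    if "y \<in> V" "h y u = 0" "h y p = 0" for y
    using isometry_preserves_orth[OF iR u(1) _ zn(1) that(1,2)]
      isometry_preserves_orth[OF iR p(1) _ zn(2) that(1,3)] Ru Rp M u p that by simp_all
  have presC: "h (C *\<^sub>v y) u = 0" "h (C *\<^sub>v y) p = 0"
    if "y \<in> V" "h y u = 0" "h y p = 0" for y
    using isometry_preserves_orth[OF involution_isometry[OF C] u(1), of 1 y]
      isometry_preserves_orth[OF involution_isometry[OF C] p(1), of 1 y] u p that by simp_all
  have "?T x = x" if x: "x \<in> perp E" for x
  proof -
    have xV: "x \<in> V" using x by (simp add: perp_def)
    define y where "y = x + (- h x u) \<cdot>\<^sub>v u + (- h x p) \<cdot>\<^sub>v p"
    have y: "y \<in> V" "h y u = 0" "h y p = 0" using xV u p up pu by (simp_all add: y_def)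
    have yE: "y \<in> perp E" unfolding y_def by (intro perp_add perp_smult E x)
    have s1: "D *\<^sub>v (A *\<^sub>v (f *\<^sub>v v)) = C *\<^sub>v (A *\<^sub>v (f *\<^sub>v v))"
      if "v \<in> V" "h v u = 0" "h v p = 0" for v
      using Dx presR[OF that] that M by simp
    have v: "C *\<^sub>v (A *\<^sub>v (f *\<^sub>v y)) \<in> V" using M y by simp
    have Ty: "?T y = y"
      using s1[OF y] s1[OF v] presC[OF _ presR[OF y]] M y(1) rev[OF yE y(2,3)] by simp
    have Tu: "?T u = u" using Ru Rp Du Dp DM M u(1) p(1) z by (simp add: smult_smult_assoc)
    have Tp: "?T p = p" using Ru Rp Du Dp DM M u(1) p(1) z by (simp add: smult_smult_assoc mult.commute)
    have "x = y + h x u \<cdot>\<^sub>v u + h x p \<cdot>\<^sub>v p"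
      unfolding y_def using xV u(1) p(1) by (intro eq_vecI) auto
    moreover have "?T (y + h x u \<cdot>\<^sub>v u + h x p \<cdot>\<^sub>v p) = ?T y + h x u \<cdot>\<^sub>v ?T u + h x p \<cdot>\<^sub>v ?T p"
      using DM M y(1) u(1) p(1) by (simp add: assoc_add_vec[of _ m])
    ultimately show ?thesis using Ty Tu Tp by simp
  qed
  then show ?thesis using that D Dx by blast
qed

text \<open>Put \<open>p = al e + be e'\<close>.  The balance condition says that \<open>p\<close> and \<open>z (f p)\<close> have a real product, so a reflection in
the plane of \<open>e\<close> and \<open>e'\<close> moves the second to the first; composed with \<open>A\<close> it makes \<open>p\<close> an eigenvector of \<open>R\<close> with
eigenvalue \<open>cnj z\<close>.  The orthogonal vector \<open>p'\<close> of the plane is then an eigenvector too and becomes the new loose end.\<close>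

lemma chain_step_balanced:
  assumes c: "chain f A C u z E" and e: "e \<in> E" "e' \<in> E" "e \<noteq> e'"
    and fe: "f *\<^sub>v e = a \<cdot>\<^sub>v e" "f *\<^sub>v e' = a' \<cdot>\<^sub>v e'"
    and ab: "(al::real)\<^sup>2 + be\<^sup>2 = 1" "al\<^sup>2 * Im (z * a) + be\<^sup>2 * Im (z * a') = 0"
  obtains A' C' u' z' where "chain f A' C' u' z' (E - {e, e'})"
proof -
  have f: "isometry f" and A: "involution A" and C: "involution C" and E: "orthonormal E"
    and AE: "\<And>d. d \<in> E \<Longrightarrow> A *\<^sub>v d = d" and CE: "\<And>d. d \<in> E \<Longrightarrow> C *\<^sub>v d = d"
    and uE: "u \<in> perp E" and uu: "h u u = 1" and Cu: "C *\<^sub>v u = u" and Ru: "A *\<^sub>v (f *\<^sub>v u) = z \<cdot>\<^sub>v u"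
    and rev: "\<And>x. x \<in> perp E \<Longrightarrow> h x u = 0 \<Longrightarrow> twice_act C A f x = x"
    using c unfolding chain_def by blast+
  have M: "f \<in> M" "A \<in> M" "C \<in> M" using f A C by auto
  have eV: "e \<in> V" "e' \<in> V" and on: "h e e = 1" "h e' e' = 1" "h e e' = 0" "h e' e = 0"
    using orthonormalD[OF E] e by auto
  have uV: "u \<in> V" "h u e = 0" "h u e' = 0" "h e u = 0" "h e' u = 0"
    using uE e eV h_orth_sym by (auto simp: perp_def)
  have zz: "z * cnj z = 1" by (rule chain_z[OF c])
  have norms: "a * cnj a = 1" "a' * cnj a' = 1"
    using isometry_eigenvalue_norm[OF f eV(1) fe(1)] isometry_eigenvalue_norm[OF f eV(2) fe(2)] on
    by (auto simp: complex_norm_square[symmetric])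
  define p where "p = complex_of_real al \<cdot>\<^sub>v e + complex_of_real be \<cdot>\<^sub>v e'"
  define p' where "p' = complex_of_real be \<cdot>\<^sub>v e + complex_of_real (- al) \<cdot>\<^sub>v e'"
  define q where "q = (z * a * al) \<cdot>\<^sub>v e + (z * a' * be) \<cdot>\<^sub>v e'"
  have pV: "p \<in> V" "p' \<in> V" "q \<in> V" using eV by (auto simp: p_def p'_def q_def)
  have ab': "complex_of_real al * al + complex_of_real be * be = 1"
    using ab(1) by (simp add: power2_eq_square flip: of_real_mult of_real_add)
  have pp: "h p p = 1" "h p' p' = 1" "h p p' = 0" "h p' p = 0"
    using ab' eV on by (simp_all add: p_def p'_def add.commute)
  have fp: "f *\<^sub>v p = (a * al) \<cdot>\<^sub>v e + (a' * be) \<cdot>\<^sub>v e'"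
    unfolding p_def using M eV by (simp add: fe smult_smult_assoc ac_simps)
  have qf: "q = z \<cdot>\<^sub>v (f *\<^sub>v p)"
    unfolding fp q_def using eV by (intro eq_vecI) (auto simp: algebra_simps)
  have "h q q = (z * cnj z) * h (f *\<^sub>v p) (f *\<^sub>v p)" unfolding qf using M pV by simp
  then have qq: "h q q = 1" using zz pp isometry_h[OF f pV(1) pV(1)] by simp
  have "h p q = cnj (z * a) * (al * al) + cnj (z * a') * (be * be)"
    unfolding p_def q_def using eV on by (simp add: ac_simps)
  then have "Im (h p q) = 0" using ab(2) by (simp add: power2_eq_square algebra_simps)
  moreover have "orthonormal {e, e'}" by (rule orthonormal_subset[OF E]) (use e in auto)
  ultimately obtain B where B: "involution B" "B *\<^sub>v q = p"
    "\<And>x. x \<in> perp {e, e'} \<Longrightarrow> B *\<^sub>v x = A *\<^sub>v x"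
    "\<And>c d. \<exists>c' d'. B *\<^sub>v (c \<cdot>\<^sub>v e + d \<cdot>\<^sub>v e') = c' \<cdot>\<^sub>v e + d' \<cdot>\<^sub>v e'"
    using swap_in_plane[OF _ e(3) ab(1) p_def q_def qq _ A AE[OF e(1)] AE[OF e(2)]] by blast
  have BM: "B \<in> M" using B by simp
  have Rp: "B *\<^sub>v (f *\<^sub>v p) = cnj z \<cdot>\<^sub>v p"
  proof -
    have "f *\<^sub>v p = cnj z \<cdot>\<^sub>v q" unfolding qf using zz M pV by (simp add: smult_smult_assoc mult.commute)
    then show ?thesis using B(2) BM pV by simp
  qed
  obtain z' where Rp': "B *\<^sub>v (f *\<^sub>v p') = z' \<cdot>\<^sub>v p'"
  proof -
    have "f *\<^sub>v p' = (a * be) \<cdot>\<^sub>v e + (a' * (- al)) \<cdot>\<^sub>v e'"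
      unfolding p'_def using M eV by (simp add: fe smult_smult_assoc ac_simps)
    then obtain g d where y: "B *\<^sub>v (f *\<^sub>v p') = g \<cdot>\<^sub>v e + d \<cdot>\<^sub>v e'" using B(4) by metis
    have "h (B *\<^sub>v (f *\<^sub>v p')) (B *\<^sub>v (f *\<^sub>v p)) = 0"
      using B(1) f pV pp by simp
    then have "z * h (g \<cdot>\<^sub>v e + d \<cdot>\<^sub>v e') p = 0" unfolding Rp y using pV eV by simp
    then have "h (g \<cdot>\<^sub>v e + d \<cdot>\<^sub>v e') p = 0" using zz by auto
    then have gd: "g * al + d * be = 0" unfolding p_def using eV on by (simp add: mult.commute)
    have "(g * be - d * al) * be = g * (al * al + be * be) - al * (g * al + d * be)"
      "(g * be - d * al) * (- al) = d * (al * al + be * be) - be * (g * al + d * be)"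
      by (simp_all add: algebra_simps)
    then have "(g * be - d * al) * be = g" "(g * be - d * al) * (- al) = d"
      using ab' gd by simp_all
    then have "g \<cdot>\<^sub>v e + d \<cdot>\<^sub>v e' = (g * be - d * al) \<cdot>\<^sub>v p'"
      unfolding p'_def using eV by (simp add: smult_add_distrib_vec smult_smult_assoc)
    then show ?thesis using that y by simp
  qed
  have up: "h u p = 0" "h p u = 0" "h u p' = 0" "h p' u = 0" using uV eV by (auto simp: p_def p'_def)
  have Cp: "C *\<^sub>v p = p" "C *\<^sub>v p' = p'" unfolding p_def p'_def using M eV CE e by simp_all
  have Bx: "B *\<^sub>v x = A *\<^sub>v x" if "x \<in> V" "h x e = 0" "h x e' = 0" for x
    using B(3)[of x] that by (simp add: perp_def)
  have R: "B *\<^sub>v (f *\<^sub>v x) = A *\<^sub>v (f *\<^sub>v x)" if "x \<in> V" "h x e = 0" "h x e' = 0" for x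
    using Bx[of "f *\<^sub>v x"] that M chain_orth[OF c] e by simp
  have Ru': "B *\<^sub>v (f *\<^sub>v u) = z \<cdot>\<^sub>v u" using R[OF uV(1,2,3)] Ru by simp
  have eE: "e = complex_of_real al \<cdot>\<^sub>v p + complex_of_real be \<cdot>\<^sub>v p'"
    "e' = complex_of_real be \<cdot>\<^sub>v p + complex_of_real (- al) \<cdot>\<^sub>v p'"
  proof -
    have "complex_of_real al \<cdot>\<^sub>v p + complex_of_real be \<cdot>\<^sub>v p' = (complex_of_real al * al + complex_of_real be * be) \<cdot>\<^sub>v e"
      "complex_of_real be \<cdot>\<^sub>v p + complex_of_real (- al) \<cdot>\<^sub>v p' = (complex_of_real al * al + complex_of_real be * be) \<cdot>\<^sub>v e'"
      unfolding p_def p'_def using eV by (intro eq_vecI; simp add: algebra_simps)+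
    then show "e = complex_of_real al \<cdot>\<^sub>v p + complex_of_real be \<cdot>\<^sub>v p'"
      "e' = complex_of_real be \<cdot>\<^sub>v p + complex_of_real (- al) \<cdot>\<^sub>v p'" unfolding ab' by simp_all
  qed
  \<comment> \<open>the new chain makes no claim on the line of its loose end p'\<close>
  let ?E = "insert p' (E - {e, e'})"
  have orthE: "h v d = 0" if "v = u \<or> v = p \<or> v = p'" "d \<in> E - {e, e'}" for v d
  proof -
    have "d \<in> V" "h e d = 0" "h e' d = 0" "h u d = 0"
      using that(2) orthonormalD[OF E] e uE by (auto simp: perp_def)
    then show ?thesis using that(1) eV by (auto simp: p_def p'_def)
  qed
  have E': "?E \<subseteq> V" "u \<in> perp ?E" "p \<in> perp ?E" "p' \<in> perp (E - {e, e'})"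
    using pV uV(1) up pp orthE orthonormalD(2)[OF E] by (auto simp: perp_def)
  have rev': "twice_act C B f y = y"
    if yE: "y \<in> perp ?E" and yu: "h y u = 0" and yp: "h y p = 0" for y
  proof -
    have y: "y \<in> V" "h y p' = 0" using yE by (auto simp: perp_def)
    have ye: "h y e = 0" "h y e' = 0" by (subst eE, use y yp pV in simp)+
    have "y \<in> perp E" using yE ye unfolding perp_def by auto
    moreover have v: "C *\<^sub>v (A *\<^sub>v (f *\<^sub>v y)) \<in> V" "h (C *\<^sub>v (A *\<^sub>v (f *\<^sub>v y))) e = 0"
      "h (C *\<^sub>v (A *\<^sub>v (f *\<^sub>v y))) e' = 0"
      using chain_orth[OF c] e y ye M by auto
    ultimately show ?thesis using R[OF y(1) ye] R[OF v] rev yu by simp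
  qed
  obtain D where D: "involution D" "\<And>x. x \<in> V \<Longrightarrow> h x u = 0 \<Longrightarrow> h x p = 0 \<Longrightarrow> D *\<^sub>v x = C *\<^sub>v x"
    "\<And>x. x \<in> perp ?E \<Longrightarrow> twice_act D B f x = x"
    by (rule link_eigenvectors[OF f B(1) C uV(1) uu Cu pV(1) pp(1) Cp(1) up(1) zz Ru' Rp E'(1-3) rev']) auto
  have "chain f B D p' z' (E - {e, e'})"
    unfolding chain_def
  proof (intro conjI ballI impI)
    show "orthonormal (E - {e, e'})" by (rule orthonormal_subset[OF E]) auto
    show "D *\<^sub>v p' = p'" using D(2)[of p'] pV up pp Cp by simp
    fix d assume d: "d \<in> E - {e, e'}"
    then have dE: "d \<in> E" "d \<in> V" "h d e = 0" "h d e' = 0" "h d u = 0"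
      using orthonormalD[OF E] e uE uV h_orth_sym[of d u] by (auto simp: perp_def)
    show "\<exists>a. f *\<^sub>v d = a \<cdot>\<^sub>v d" using c dE unfolding chain_def by blast
    show "B *\<^sub>v d = d" using Bx dE AE by simp
    have "h d p = 0" unfolding p_def using dE eV by simp
    then show "D *\<^sub>v d = d" using D(2) dE CE by simp
  next
    fix x assume "x \<in> perp (E - {e, e'})" "h x p' = 0"
    then show "twice_act D B f x = x"
      by (intro D(3)) (simp add: perp_def)
  qed (use f B D pp Rp' c E' in \<open>auto simp: chain_def\<close>)
  then show ?thesis using that by blast
qed

lemma chain_step:
  assumes c: "chain f A C u z E" and e: "e \<in> E" "e' \<in> E" "e \<noteq> e'"
  obtains g A' C' u' z' where "g * g = f * f" "chain g A' C' u' z' (E - {e, e'})"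
proof -
  obtain a a' where fe: "f *\<^sub>v e = a \<cdot>\<^sub>v e" "f *\<^sub>v e' = a' \<cdot>\<^sub>v e'"
    using c e unfolding chain_def by blast
  obtain s t al be :: real where st: "s = 1 \<or> s = - 1" "t = 1 \<or> t = - 1" "al\<^sup>2 + be\<^sup>2 = 1"
    "al\<^sup>2 * (s * Im (z * a)) + be\<^sup>2 * (t * Im (z * a')) = 0"
    using balance_with_signs by blast
  have s: "complex_of_real s = 1 \<or> complex_of_real s = - 1" "complex_of_real t = 1 \<or> complex_of_real t = - 1"
    using st by auto
  obtain g where g: "chain g A C u z E" "g * g = f * f" "g *\<^sub>v e = (s * a) \<cdot>\<^sub>v e" "g *\<^sub>v e' = f *\<^sub>v e'"
    using chain_choose_sign[OF c e(1) fe(1) s(1)] e by metis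
  obtain k where k: "chain k A C u z E" "k * k = g * g" "k *\<^sub>v e' = (t * a') \<cdot>\<^sub>v e'" "k *\<^sub>v e = g *\<^sub>v e"
    using chain_choose_sign[OF g(1) e(2) _ s(2), of a'] g(4) fe(2) e by metis
  have Im: "Im (z * (complex_of_real r * b)) = r * Im (z * b)" for r b by (simp add: algebra_simps)
  have "k *\<^sub>v e = (s * a) \<cdot>\<^sub>v e" using k g by simp
  then obtain A' C' u' z' where "chain k A' C' u' z' (E - {e, e'})"
    using chain_step_balanced[OF k(1) e _ k(3) st(3), of "s * a"] st(4) Im by metis
  then show ?thesis using that[of k] k g by simp
qed

text \<open>\<open>C\<close> conjugates \<open>Af\<close> to its inverse.  Then \<open>AfC\<close> is an involution and \<open>f = A (AfC) C\<close>.\<close>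

definition reversed_by where
  "reversed_by f A C \<longleftrightarrow> isometry f \<and> involution A \<and> involution C \<and>
     (\<forall>x\<in>V. twice_act C A f x = x)"

lemma det_of_double:
  assumes "isometry f" "involution A" "involution C" "(det f)\<^sup>2 = 1"
  shows "det (C * (A * (f * (C * (A * f))))) = 1"
proof -
  have M: "f \<in> M" "A \<in> M" "C \<in> M" using assms by auto
  have "det (C * (A * (f * (C * (A * f))))) = (det C)\<^sup>2 * (det A)\<^sup>2 * (det f)\<^sup>2"
    using M by (simp add: det_mult[of _ m] power2_eq_square)
  then show ?thesis using assms det_involution by simp
qed

text \<open>\<open>CRCR\<close> is the identity off \<open>u\<close> and multiplies \<open>u\<close> by \<open>z\<^sup>2\<close>, so \<open>z\<^sup>2\<close> is its determinant, which is 1.\<close>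

lemma chain_end_empty:
  assumes c: "chain f A C u z {}" and d: "(det f)\<^sup>2 = 1"
  shows "reversed_by f A C"
proof -
  have f: "isometry f" and A: "involution A" and C: "involution C" 
    and u: "u \<in> V" "h u u = 1" and Cu: "C *\<^sub>v u = u" and Ru: "A *\<^sub>v (f *\<^sub>v u) = z \<cdot>\<^sub>v u"
    and rev: "\<And>x. x \<in> V \<Longrightarrow> h x u = 0 \<Longrightarrow> twice_act C A f x = x"
    using c by (auto simp: chain_def perp_def)
  have M: "f \<in> M" "A \<in> M" "C \<in> M" using f A C by auto
  let ?T = "C * (A * (f * (C * (A * f))))"
  have TM: "?T \<in> M" using M by (intro mult_carrier_mat[of _ m m _ m])
  have Tx: "?T *\<^sub>v x = twice_act C A f x" if "x \<in> V" for x
    using that M by (simp add: mult_carrier_mat[of _ m m _ m])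
  have Tu: "?T *\<^sub>v u = (z * z) \<cdot>\<^sub>v u" using Tx u M Ru Cu by (simp add: smult_smult_assoc)
  have "?T = stretch u (z * z)"
  proof (rule mat_eq_by_action[OF TM stretch_carrier])
    fix x assume x: "x \<in> V"
    obtain y where y: "y \<in> V" "h y u = 0" "x = y + h x u \<cdot>\<^sub>v u"
      using remove_component[OF u x] by blast
    have "?T *\<^sub>v x = ?T *\<^sub>v y + h x u \<cdot>\<^sub>v (?T *\<^sub>v u)"
      using y(1) u TM by (subst y(3)) (simp del: mv_mult)
    also have "\<dots> = stretch u (z * z) *\<^sub>v y + h x u \<cdot>\<^sub>v (stretch u (z * z) *\<^sub>v u)"
      using y u Tx rev Tu by (simp add: stretch_self del: mv_mult)
    also have "\<dots> = stretch u (z * z) *\<^sub>v x" using y(1) u by (subst y(3)) simp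
    finally show "?T *\<^sub>v x = stretch u (z * z) *\<^sub>v x" .
  qed
  then have "z * z = 1" using det_of_double[OF f A C d] det_stretch[of u "z * z"] u by simp
  then have "?T *\<^sub>v x = x" if x: "x \<in> V" for x
    using \<open>?T = _\<close> u x by (simp add: stretch_apply)
  then show ?thesis unfolding reversed_by_def using f A C Tx by metis
qed

text \<open>Now \<open>CRCR\<close> has determinant \<open>z\<^sup>2 a\<^sup>2\<close>, where \<open>a\<close> is the eigenvalue of \<open>f\<close> at \<open>e\<close>.  So \<open>a\<close> is \<open>cnj z\<close> up to sign; after
a sign change \<open>u\<close> and \<open>e\<close> can be linked.\<close>

lemma chain_end_single:
  assumes c: "chain f A C u z {e}" and d: "(det f)\<^sup>2 = 1"
  obtains g C' where "g * g = f * f" "reversed_by g A C'"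
proof -
  have f: "isometry f" and A: "involution A" and C: "involution C"
    and u: "u \<in> V" "h u u = 1" and ue: "h u e = 0" and Cu: "C *\<^sub>v u = u" and Ru: "A *\<^sub>v (f *\<^sub>v u) = z \<cdot>\<^sub>v u"
    and on: "orthonormal {e}" and e1: "\<exists>a. f *\<^sub>v e = a \<cdot>\<^sub>v e" "A *\<^sub>v e = e" "C *\<^sub>v e = e"
    and rev: "\<And>x. x \<in> V \<Longrightarrow> h x e = 0 \<Longrightarrow> h x u = 0 \<Longrightarrow> twice_act C A f x = x"
    using c by (auto simp: chain_def perp_def)
  have e: "e \<in> V" "h e e = 1" using orthonormalD[OF on] by auto
  have eu: "h e u = 0" using ue u e h_orth_sym by simp
  obtain a where fe: "f *\<^sub>v e = a \<cdot>\<^sub>v e" using e1 by blast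
  have M: "f \<in> M" "A \<in> M" "C \<in> M" using f A C by auto
  let ?T = "C * (A * (f * (C * (A * f))))"
  have TM: "?T \<in> M" using M by (intro mult_carrier_mat[of _ m m _ m])
  have Tx: "?T *\<^sub>v x = twice_act C A f x" if "x \<in> V" for x
    using that M by (simp add: mult_carrier_mat[of _ m m _ m])
  have Tu: "?T *\<^sub>v u = (z * z) \<cdot>\<^sub>v u" using Tx u M Ru Cu by (simp add: smult_smult_assoc)
  have Te: "?T *\<^sub>v e = (a * a) \<cdot>\<^sub>v e" using Tx e M fe e1 by (simp add: smult_smult_assoc)
  let ?S = "stretch u (z * z) * stretch e (a * a)"
  have SM: "?S \<in> M" by (intro mult_carrier_mat[of _ m m]) auto
  have "?T = ?S"
  proof (rule mat_eq_by_action[OF TM SM])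
    fix x assume x: "x \<in> V"
    define y where "y = x + (- h x u) \<cdot>\<^sub>v u + (- h x e) \<cdot>\<^sub>v e"
    have y: "y \<in> V" "h y u = 0" "h y e = 0" using x u e ue eu by (simp_all add: y_def)
    have xy: "x = y + h x u \<cdot>\<^sub>v u + h x e \<cdot>\<^sub>v e" using x u e by (intro eq_vecI) (auto simp: y_def)
    have "?T *\<^sub>v x = ?T *\<^sub>v y + h x u \<cdot>\<^sub>v (?T *\<^sub>v u) + h x e \<cdot>\<^sub>v (?T *\<^sub>v e)"
      by (subst xy) (rule mv_combination[OF TM y(1) u(1) e(1)])
    also have "\<dots> = ?S *\<^sub>v y + h x u \<cdot>\<^sub>v (?S *\<^sub>v u) + h x e \<cdot>\<^sub>v (?S *\<^sub>v e)"
    proof -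
      have "?S *\<^sub>v y = y" "?S *\<^sub>v u = (z * z) \<cdot>\<^sub>v u" "?S *\<^sub>v e = (a * a) \<cdot>\<^sub>v e"
        using y u e ue eu by (simp_all add: stretch_self)
      moreover have "?T *\<^sub>v y = y" using Tx rev y by simp
      ultimately show ?thesis using Tu Te by (simp del: mv_mult)
    qed
    also have "\<dots> = ?S *\<^sub>v x"
      by (subst xy) (rule mv_combination[OF SM y(1) u(1) e(1), symmetric])
    finally show "?T *\<^sub>v x = ?S *\<^sub>v x" .
  qed
  then have "(z * z) * (a * a) = 1"
    using det_of_double[OF f A C d] det_stretch[of u "z * z"] det_stretch[of e "a * a"] u e
    by (simp add: det_mult[of _ m])
  then have "(z * a)\<^sup>2 = 1" by (simp add: power2_eq_square ac_simps)
  then have "z * a = 1 \<or> z * a = - 1" by (simp add: power2_eq_1_iff)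
  moreover have zz: "z * cnj z = 1" by (rule chain_z[OF c])
  ultimately have a: "a = 1 * cnj z \<or> a = - 1 * cnj z"
    by (metis mult.assoc mult.commute mult_1 mult_minus_left)
  then obtain s where s: "s = 1 \<or> s = - 1" "s * a = cnj z"
    using that[of 1] that[of "- 1"] by auto
  obtain g where g: "chain g A C u z {e}" "g * g = f * f" "g *\<^sub>v e = cnj z \<cdot>\<^sub>v e"
    using chain_choose_sign[OF c _ fe s(1)] s(2) by auto
  have gi: "isometry g" and Ru: "A *\<^sub>v (g *\<^sub>v u) = z \<cdot>\<^sub>v u" 
    and rev: "\<And>x. x \<in> V \<Longrightarrow> h x e = 0 \<Longrightarrow> h x u = 0 \<Longrightarrow> twice_act C A g x = x"
    using g(1) by (auto simp: chain_def perp_def)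
  have Re: "A *\<^sub>v (g *\<^sub>v e) = cnj z \<cdot>\<^sub>v e" using g(3) M e e1 by simp
  obtain D where D: "involution D" "\<And>x. x \<in> perp {} \<Longrightarrow> twice_act D A g x = x"
    by (rule link_eigenvectors[OF gi A C u Cu e e1(3) ue zz Ru Re, of "{}"])
       (use u e rev in \<open>auto simp: perp_def\<close>)
  then have "reversed_by g A D" unfolding reversed_by_def using gi A by (simp add: perp_def)
  then show ?thesis using that g(2) by blast
qed

lemma chain_complete:
  assumes "chain f A C u z E" "(det f)\<^sup>2 = 1"
  obtains g A' C' where "g * g = f * f" "reversed_by g A' C'"
  using assms
proof (induction "card E" arbitrary: f A C u z E thesis rule: less_induct)
  case less
  have fin: "finite E" using less.prems(2) orthonormalD by (auto simp: chain_def)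
  have fM: "f \<in> M" using less.prems(2) by (simp add: chain_def)
  consider "E = {}" | e where "E = {e}" | e e' where "e \<in> E" "e' \<in> E" "e \<noteq> e'" by blast
  then show ?case
  proof cases
    case 1
    then show ?thesis using less.prems chain_end_empty by blast
  next
    case 2
    then show ?thesis using less.prems chain_end_single by blast
  next
    case 3
    obtain g A' C' u' z' where g: "g * g = f * f" "chain g A' C' u' z' (E - {e, e'})"
      using chain_step[OF less.prems(2) 3] by blast
    have gM: "g \<in> M" using g(2) by (simp add: chain_def)
    have "(det g)\<^sup>2 = (det f)\<^sup>2"
      using det_mult[OF gM gM] det_mult[OF fM fM] g(1) by (simp add: power2_eq_square)
    then have d: "(det g)\<^sup>2 = 1" using less.prems by simp
    have "card (E - {e, e'}) < card E" using fin 3 by (intro psubset_card_mono) auto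
    from less.hyps[OF this _ g(2) d] less.prems(1) g(1) show ?thesis by metis
  qed
qed

lemma eq_smult_of_diff_zero:
  assumes x: "x \<in> V" and y: "y \<in> V" and z: "x + (- c) \<cdot>\<^sub>v y = 0\<^sub>v m"
  shows "x = c \<cdot>\<^sub>v y"
proof (rule eq_vecI)
  fix i assume i: "i < dim_vec (c \<cdot>\<^sub>v y)"
  have "(x + (- c) \<cdot>\<^sub>v y) $ i = 0\<^sub>v m $ i" by (simp only: z)
  then show "x $ i = (c \<cdot>\<^sub>v y) $ i" using i x y by simp
qed (use x y in auto)

lemma orthogonal_insert:
  assumes "orthogonal E" "x \<in> perp E" "h x x \<noteq> 0"
  shows "orthogonal (insert x E)" "x \<notin> E"
proof -
  show "x \<notin> E" using assms by (auto simp: perp_def)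
  have "h e x = 0" if "e \<in> E" for e
    using assms that h_orth_sym[of x e] by (auto simp: perp_def orthogonal_def)
  then show "orthogonal (insert x E)" using assms unfolding orthogonal_def perp_def by auto
qed

lemma card_complete:
  assumes "orthogonal E" "\<And>x. x \<in> perp E \<Longrightarrow> x = 0\<^sub>v m"
  shows "card E = m"
  using assms orthogonal_card_lt orthogonal_card_le by (metis le_neq_implies_less)

lemma orthonormal_insert:
  assumes "orthonormal E" "x \<in> perp E" "h x x = 1"
  shows "orthonormal (insert x E)" "x \<notin> E"
  using orthogonal_insert[of E x] assms by (auto simp: orthonormal_def)

lemma orthonormal_orthogonal: "orthonormal E \<Longrightarrow> orthogonal E"
  by (simp add: orthonormal_def)

lemma normalize:
  assumes "x \<in> V" "Re (h x x) > 0"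
  obtains t where "t > 0" "h (complex_of_real t \<cdot>\<^sub>v x) (complex_of_real t \<cdot>\<^sub>v x) = 1"
proof -
  obtain r where r: "h x x = complex_of_real r" using h_self_real[OF assms(1)] by blast
  then have "r > 0" using assms(2) by simp
  then have "complex_of_real (1 / sqrt r) * (complex_of_real (1 / sqrt r) * complex_of_real r) = 1"
    by (simp flip: of_real_mult)
  then show ?thesis using that[of "1 / sqrt r"] assms(1) \<open>r > 0\<close> r by simp
qed

lemma perp_invariant:
  assumes f: "isometry f" and E: "orthonormal E" and fE: "\<And>e. e \<in> E \<Longrightarrow> \<exists>a. f *\<^sub>v e = a \<cdot>\<^sub>v e"
    and x: "x \<in> perp E"
  shows "f *\<^sub>v x \<in> perp E"
  unfolding perp_def
proof (intro CollectI conjI ballI)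
  show "f *\<^sub>v x \<in> V" using f x by (simp add: perp_def)
  fix e assume e: "e \<in> E"
  obtain a where a: "f *\<^sub>v e = a \<cdot>\<^sub>v e" using fE e by blast
  have eV: "e \<in> V" "h e e \<noteq> 0" using orthonormalD[OF E] e by auto
  have "a \<noteq> 0" using isometry_eigenvalue_norm[OF f eV(1) a eV(2)] by auto
  then show "h (f *\<^sub>v x) e = 0"
    using isometry_preserves_orth[OF f eV(1) a] x e by (simp add: perp_def)
qed

text \<open>A chain starts as soon as \<open>C\<close> reverses \<open>R\<close> on the span of an orthogonal set \<open>S\<close> that, together with \<open>E\<close>, has codimension
one: \<open>R\<close> preserves the remaining line, which gives \<open>u\<close>.  The spans are handled by duality: a vector orthogonal to \<open>S\<close>,
\<open>E\<close> and \<open>u\<close> is zero.\<close>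

lemma chain_from_reversed_complement:
  assumes f: "isometry f" and A: "involution A" and C: "involution C"
    and E: "orthonormal E" and fE: "\<And>e. e \<in> E \<Longrightarrow> \<exists>a. f *\<^sub>v e = a \<cdot>\<^sub>v e"
    and AE: "\<And>e. e \<in> E \<Longrightarrow> A *\<^sub>v e = e"
    and S: "orthogonal S" "S \<subseteq> perp E" "card S + card E < m" "m \<le> card S + card E + 1"
    and pos: "\<And>x. x \<in> perp (S \<union> E) \<Longrightarrow> x \<noteq> 0\<^sub>v m \<Longrightarrow> Re (h x x) > 0"
    and RS: "\<And>x. x \<in> perp S \<Longrightarrow> A *\<^sub>v (f *\<^sub>v x) \<in> perp S" and CS: "\<And>x. x \<in> perp S \<Longrightarrow> C *\<^sub>v x = x"
    and rev: "\<And>s. s \<in> S \<Longrightarrow> twice_act C A f s = s"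
  obtains u z where "chain f A C u z E"
proof -
  have M: "f \<in> M" "A \<in> M" "C \<in> M" using f A C by auto
  have EV: "E \<subseteq> V" "finite E" using orthonormalD[OF E] by auto
  have SV: "S \<subseteq> V" "finite S" using S(1) by (auto simp: orthogonal_def)
  have SE: "h s e = 0" "h e s = 0" if "s \<in> S" "e \<in> E" for s e
    using that S(2) EV SV h_orth_sym[of s e] by (auto simp: perp_def)
  have disj: "S \<inter> E = {}" using S(1) SE(1) by (auto simp: orthogonal_def)
  have U: "orthogonal (S \<union> E)"
    using S(1) orthonormal_orthogonal[OF E] SE unfolding orthogonal_def by auto
  have cardU: "card (S \<union> E) = card S + card E" by (rule card_Un_disjoint[OF SV(2) EV(2) disj])
  then obtain x where x: "x \<in> perp (S \<union> E)" "x \<noteq> 0\<^sub>v m" using orthogonal_card_lt[OF U] S(3) by auto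
  have xV: "x \<in> V" using x by (simp add: perp_def)
  obtain t where t: "h (complex_of_real t \<cdot>\<^sub>v x) (complex_of_real t \<cdot>\<^sub>v x) = 1"
    using normalize[OF xV pos[OF x]] by blast
  define u where "u = complex_of_real t \<cdot>\<^sub>v x"
  have u: "u \<in> perp (S \<union> E)" "h u u = 1" "h u u \<noteq> 0"
    unfolding u_def using x(1) t EV SV by (auto intro: perp_smult)
  have uV: "u \<in> V" "u \<in> perp S" "u \<in> perp E" using u by (auto simp: perp_def)
  note ins = orthogonal_insert[OF U u(1,3)]
  have card: "card (insert u (S \<union> E)) = m" using ins(2) cardU EV SV S(3,4) by simp
  have complete: "y = 0\<^sub>v m" if "y \<in> V" "h y u = 0" "y \<in> perp S" "y \<in> perp E" for y
    by (rule orthogonal_card_eq[OF ins(1) card]) (use that in \<open>auto simp: perp_def\<close>)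
  have fEA: "\<exists>a. (A * f) *\<^sub>v e = a \<cdot>\<^sub>v e" if "e \<in> E" for e
    using fE[OF that] AE[OF that] M that EV by (metis mv_mult mv_smult subsetD)
  have iR: "isometry (A * f)" using A f by simp
  have RE: "A *\<^sub>v (f *\<^sub>v y) \<in> perp E" if "y \<in> perp E" for y
    using perp_invariant[OF iR E fEA that] M perpD(1)[OF that] by simp
  define z where "z = h (A *\<^sub>v (f *\<^sub>v u)) u"
  have RuV: "A *\<^sub>v (f *\<^sub>v u) \<in> V" using M uV by simp
  have "A *\<^sub>v (f *\<^sub>v u) + (- z) \<cdot>\<^sub>v u = 0\<^sub>v m"
  proof (rule complete)
    show "h (A *\<^sub>v (f *\<^sub>v u) + (- z) \<cdot>\<^sub>v u) u = 0" using RuV uV u by (simp add: z_def)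
  qed (use RuV uV RS RE perp_add perp_smult EV SV in auto)
  then have Ru: "A *\<^sub>v (f *\<^sub>v u) = z \<cdot>\<^sub>v u" by (rule eq_smult_of_diff_zero[OF RuV uV(1)])
  have CE: "C *\<^sub>v e = e" if "e \<in> E" for e
    by (rule CS) (use that SE EV in \<open>auto simp: perp_def\<close>)
  have Cu: "C *\<^sub>v u = u" by (rule CS[OF uV(2)])
  have CPE: "C *\<^sub>v y \<in> perp E" if "y \<in> perp E" for y
    by (rule perp_invariant[OF involution_isometry[OF C] E _ that]) (use CE in \<open>metis one_smult_vec\<close>)
  let ?T = "\<lambda>x. twice_act C A f x"
  have Tiso: "h (?T y) (?T w) = h y w" if "y \<in> V" "w \<in> V" for y w using f A C M that by simp
  have zz: "z * cnj z = 1"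
    using Tiso[OF uV(1,1)] isometry_h[OF iR uV(1,1)] Ru M uV u by (simp add: mult.commute)
  have "chain f A C u z E"
    unfolding chain_def
  proof (intro conjI ballI impI)
    fix y assume y: "y \<in> perp E" "h y u = 0"
    have yV: "y \<in> V" using y by (simp add: perp_def)
    have TV: "?T y \<in> V" using M yV by simp
    have TyE: "?T y \<in> perp E" using y by (intro CPE RE)
    have Tu: "?T u = (z * z) \<cdot>\<^sub>v u" using Ru Cu M uV by (simp add: smult_smult_assoc)
    have "cnj (z * z) * h (?T y) u = h (?T y) (?T u)" unfolding Tu using TV uV by simp
    also have "\<dots> = 0" using Tiso[OF yV uV(1)] y by simp
    finally have Tyu: "h (?T y) u = 0" using zz by auto
    have TyS: "h (?T y) s = h y s" if "s \<in> S" for s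
      using Tiso[OF yV, of s] rev[OF that] SV that by auto
    have "?T y + (- 1) \<cdot>\<^sub>v y = 0\<^sub>v m"
    proof (rule complete)
      show "?T y + (- 1) \<cdot>\<^sub>v y \<in> perp S"
        unfolding perp_def using TV yV TyS SV(1) by (auto simp: subset_iff)
    qed (use TV yV uV Tyu y TyE perp_add[OF EV(1)] perp_smult[OF EV(1)] in auto)
    then show "?T y = y" using eq_smult_of_diff_zero[OF TV yV, of 1] by simp
  qed (use f A C E fE AE CE Cu Ru u uV in auto)
  then show ?thesis using that by blast
qed

end

section \<open>Lorentzian forms\<close>

text \<open>Signature \<open>(m - 1, 1)\<close> in a form that needs no basis: there is a negative vector, and two orthogonal vectors that are both negative or null are collinear.\<close>

locale lorentz_space = hermitian_space +
  assumes three_le: "3 \<le> m"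
    and ex_negative: "\<exists>b\<in>V. Re (h b b) < 0"
    and nonpositive_collinear: "\<And>x y. x \<in> V \<Longrightarrow> y \<in> V \<Longrightarrow> Re (h x x) \<le> 0 \<Longrightarrow> Re (h y y) \<le> 0
          \<Longrightarrow> h x y = 0 \<Longrightarrow> x \<noteq> 0\<^sub>v m \<Longrightarrow> \<exists>c. y = c \<cdot>\<^sub>v x"

context hermitian_space
begin

lemma h_mult_mat_vec:
  assumes A: "A \<in> M" and x: "x \<in> V" and w: "w \<in> V"
  shows "h (A *\<^sub>v x) w = (\<Sum>j<m. x $ j * h (col A j) w)"
proof -
  have c: "col A j \<in> V" if "j < m" for j using A that by auto
  have "h (A *\<^sub>v x) w = (\<Sum>i<m. (\<Sum>j<m. A $$ (i, j) * x $ j) * h (unit_vec m i) w)"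
    using A x w by (subst h_coordinates) (auto simp: scalar_prod_def lessThan_atLeast0)
  also have "\<dots> = (\<Sum>j<m. x $ j * (\<Sum>i<m. A $$ (i, j) * h (unit_vec m i) w))"
    unfolding sum_distrib_left sum_distrib_right by (subst sum.swap) (simp add: ac_simps)
  also have "\<dots> = (\<Sum>j<m. x $ j * h (col A j) w)"
  proof (rule sum.cong[OF refl])
    fix j assume "j \<in> {..<m}"
    then have j: "j < m" by simp
    have "h (col A j) w = (\<Sum>i<m. col A j $ i * h (unit_vec m i) w)" by (rule h_coordinates[OF c[OF j] w])
    then show "x $ j * (\<Sum>i<m. A $$ (i, j) * h (unit_vec m i) w) = x $ j * h (col A j) w"
      using A j by simp
  qed
  finally show ?thesis .
qed

text \<open>The columns of \<open>P\<close> other than the negative one \<open>b\<close> span a positive definite complement of \<open>b\<close>.  If \<open>x\<close> and \<open>y\<close> are orthogonal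
and not positive, some combination of them is orthogonal to \<open>b\<close> and not positive, hence zero.\<close>

lemma lorentz_space_if_signature:
  assumes sig: "has_signature m h n 1" and m: "m = n + 1" and n: "2 \<le> n"
  shows "lorentz_space m h"
proof -
  obtain P where P: "P \<in> M" "invertible_mat P"
    and orth: "\<And>i j. i < m \<Longrightarrow> j < m \<Longrightarrow> i \<noteq> j \<Longrightarrow> h (col P i) (col P j) = 0"
    and pos: "card {i. i < m \<and> Re (h (col P i) (col P i)) > 0} = n"
    and neg: "card {i. i < m \<and> Re (h (col P i) (col P i)) < 0} = 1"
    using sig unfolding has_signature_def by blast
  let ?pos = "{i. i < m \<and> Re (h (col P i) (col P i)) > 0}"
  let ?neg = "{i. i < m \<and> Re (h (col P i) (col P i)) < 0}"
  obtain k where k: "?neg = {k}" using neg card_1_singletonE by blast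
  have km: "k < m" "Re (h (col P k) (col P k)) < 0" using k by auto
  have "card (?pos \<union> ?neg) = m"
    using pos neg m by (subst card_Un_disjoint) auto
  moreover have "?pos \<union> ?neg \<subseteq> {..<m}" by auto
  ultimately have "?pos \<union> ?neg = {..<m}" by (intro card_subset_eq) auto
  then have posi: "Re (h (col P i) (col P i)) > 0" if "i < m" "i \<noteq> k" for i using that k by blast
  have colV: "col P i \<in> V" if "i < m" for i using P that by auto
  obtain B where B: "B \<in> M" "P * B = 1\<^sub>m m"
  proof -
    obtain B where B: "P * B = 1\<^sub>m (dim_row P)" "B * P = 1\<^sub>m (dim_row B)"
      using P(2) unfolding invertible_mat_def inverts_mat_def by blast
    have "B \<in> M" using B P(1) by (metis carrier_matD(2) carrier_matI carrier_matD(1) index_mult_mat(3) index_one_mat(3) index_mult_mat(2))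
    then show ?thesis using that B P(1) by simp
  qed
  define b where "b = col P k"
  have bV: "b \<in> V" "Re (h b b) < 0" using km colV by (auto simp: b_def)
  have posdef: "Re (h x x) > 0" if x: "x \<in> V" "h x b = 0" "x \<noteq> 0\<^sub>v m" for x
  proof -
    define c where "c = B *\<^sub>v x"
    have cV: "c \<in> V" using B x by (simp add: c_def)
    have xc: "x = P *\<^sub>v c" using mv_mult[OF P(1) B(1) x(1)] B(2) x(1) by (simp add: c_def)
    have hx: "h x (col P i) = c $ i * h (col P i) (col P i)" if i: "i < m" for i
    proof -
      have "h x (col P i) = (\<Sum>j<m. c $ j * h (col P j) (col P i))"
        unfolding xc by (rule h_mult_mat_vec[OF P(1) cV colV[OF i]])
      also have "\<dots> = (\<Sum>j<m. if j = i then c $ i * h (col P i) (col P i) else 0)"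
        by (rule sum.cong) (use orth i in auto)
      finally show ?thesis using i by simp
    qed
    have ck: "c $ k = 0" using hx[OF km(1)] x(2) km by (auto simp: b_def)
    have summand: "h (col P j) x * c $ j = complex_of_real ((cmod (c $ j))\<^sup>2 * Re (h (col P j) (col P j)))" if j: "j < m" for j
    proof -
      have "h (col P j) x = cnj (h x (col P j))" by (rule h_commute[OF x(1) colV[OF j]])
      also have "\<dots> = cnj (c $ j) * h (col P j) (col P j)"
        unfolding hx[OF j] using h_commute[OF colV[OF j] colV[OF j]] by simp
      finally have "h (col P j) x * c $ j = (c $ j * cnj (c $ j)) * h (col P j) (col P j)" by simp
      also have "h (col P j) (col P j) = complex_of_real (Re (h (col P j) (col P j)))"
        by (rule h_self_real[OF colV[OF j]])
      finally show ?thesis by (simp only: complex_norm_square[symmetric] of_real_mult)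
    qed
    have "h x x = (\<Sum>j<m. c $ j * h (col P j) x)" using h_mult_mat_vec[OF P(1) cV x(1)] xc by simp
    also have "\<dots> = (\<Sum>j<m. complex_of_real ((cmod (c $ j))\<^sup>2 * Re (h (col P j) (col P j))))"
      by (rule sum.cong) (use summand in \<open>auto simp: mult.commute\<close>)
    finally have q: "Re (h x x) = (\<Sum>j<m. (cmod (c $ j))\<^sup>2 * Re (h (col P j) (col P j)))"
      by (simp only: of_real_sum[symmetric] Re_complex_of_real)
    obtain j where j: "j < m" "c $ j \<noteq> 0"
    proof (rule ccontr)
      assume "\<not> thesis"
      then have "c = 0\<^sub>v m" using that cV by (intro eq_vecI) auto
      then show False using x(3) xc P by simp
    qed
    have jk: "j \<noteq> k" using ck j by auto
    have "0 < (cmod (c $ j))\<^sup>2 * Re (h (col P j) (col P j))" using j posi jk by simp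
    moreover have "0 \<le> (cmod (c $ i))\<^sup>2 * Re (h (col P i) (col P i))" if "i < m" for i
      by (cases "i = k") (use ck posi[OF that] in \<open>auto intro: less_imp_le\<close>)
    ultimately show ?thesis unfolding q using j(1) by (intro sum_pos2[of _ j]) auto
  qed
  show ?thesis
  proof
    show "3 \<le> m" using m n by simp
    show "\<exists>b\<in>V. Re (h b b) < 0" using bV by blast
    fix x y assume x: "x \<in> V" and y: "y \<in> V" and qx: "Re (h x x) \<le> 0" and qy: "Re (h y y) \<le> 0"
      and xy: "h x y = 0" and x0: "x \<noteq> 0\<^sub>v m"
    have xb: "h x b \<noteq> 0" using posdef[OF x _ x0] qx by force
    have yx: "h y x = 0" using xy x y h_orth_sym by blast
    define s where "s = h y b / h x b"
    let ?t = "y + (- s) \<cdot>\<^sub>v x"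
    have tV: "?t \<in> V" using x y by simp
    have tb: "h ?t b = 0" using x y bV xb by (simp add: s_def)
    have "h ?t ?t = h y y + (s * cnj s) * h x x" using x y xy yx by (simp add: algebra_simps)
    moreover obtain r where r: "h x x = complex_of_real r" using h_self_real[OF x] by blast
    ultimately have "h ?t ?t = h y y + complex_of_real ((cmod s)\<^sup>2 * r)"
      by (simp only: r complex_norm_square[symmetric] of_real_mult)
    then have "Re (h ?t ?t) = Re (h y y) + (cmod s)\<^sup>2 * r" by simp
    moreover have "(cmod s)\<^sup>2 * r \<le> 0" using qx r by (simp add: mult_nonneg_nonpos)
    ultimately have "\<not> Re (h ?t ?t) > 0" using qy by linarith
    then have "?t = 0\<^sub>v m" using posdef[OF tV tb] by blast
    then have "y = s \<cdot>\<^sub>v x" by (rule eq_smult_of_diff_zero[OF y x])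
    then show "\<exists>c. y = c \<cdot>\<^sub>v x" by blast
  qed
qed

end

context lorentz_space
begin

lemma positive_if_orth_negative:
  assumes "b \<in> V" "Re (h b b) < 0" "y \<in> V" "h y b = 0" "y \<noteq> 0\<^sub>v m"
  shows "Re (h y y) > 0"
proof (rule ccontr)
  assume "\<not> ?thesis"
  moreover have "b \<noteq> 0\<^sub>v m" using assms by auto
  moreover have "h b y = 0" using assms h_orth_sym by blast
  ultimately obtain c where c: "y = c \<cdot>\<^sub>v b" using nonpositive_collinear[of b y] assms by auto
  then have "c = 0" using assms by auto
  then show False using assms c by simp
qed

lemma null_not_orth:
  assumes "p \<in> V" "q \<in> V" "p \<noteq> 0\<^sub>v m" "h p p = 0" "Re (h q q) \<le> 0" "\<And>c. q \<noteq> c \<cdot>\<^sub>v p"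
  shows "h p q \<noteq> 0"
  using nonpositive_collinear[of p q] assms by auto

text \<open>\<open>A\<close> is chosen to carry \<open>f u0\<close> to \<open>u0\<close> or to \<open>- u0\<close>, and \<open>C\<close> is the identity.\<close>

lemma head_negative_vector:
  assumes f: "isometry f" and E: "orthonormal E" and fE: "\<And>e. e \<in> E \<Longrightarrow> \<exists>a. f *\<^sub>v e = a \<cdot>\<^sub>v e"
    and card: "card E + 2 = m"
    and u0: "u0 \<in> perp E" "Re (h u0 u0) < 0" "Im (h (f *\<^sub>v u0) u0) = 0"
  obtains A u z where "chain f A (1\<^sub>m m) u z E"
proof -
  have fM: "f \<in> M" using f by simp
  have u0V: "u0 \<in> V" using u0 by (simp add: perp_def)
  have uu: "h u0 u0 \<noteq> 0" using u0 by auto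
  let ?q = "f *\<^sub>v u0"
  have qV: "?q \<in> V" using fM u0V by simp
  have qE: "?q \<in> perp E" by (rule perp_invariant[OF f E fE u0(1)])
  have qq: "h u0 u0 = h ?q ?q" using isometry_h[OF f u0V u0V] by simp
  have hq: "h u0 ?q = h ?q u0" using h_commute[OF qV u0V] u0(3) by (simp add: complex_eq_iff)
  \<comment> \<open>the squared norms of u0 - q and u0 + q add up to 4 * h u0 u0, so one of them is not null\<close>
  obtain s where s: "s = 1 \<or> s = - 1" 
    and ww: "h (u0 + (- 1) \<cdot>\<^sub>v (s \<cdot>\<^sub>v ?q)) (u0 + (- 1) \<cdot>\<^sub>v (s \<cdot>\<^sub>v ?q)) \<noteq> 0"
  proof (cases "h (u0 + (- 1) \<cdot>\<^sub>v (1 \<cdot>\<^sub>v ?q)) (u0 + (- 1) \<cdot>\<^sub>v (1 \<cdot>\<^sub>v ?q)) = 0")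
    case True
    then have "h u0 u0 = h ?q u0" using u0V qV qq hq by simp
    then have "h (u0 + (- 1) \<cdot>\<^sub>v ((- 1) \<cdot>\<^sub>v ?q)) (u0 + (- 1) \<cdot>\<^sub>v ((- 1) \<cdot>\<^sub>v ?q)) = 4 * h u0 u0"
      using u0V qV qq[symmetric] hq by simp
    then show ?thesis using that[of "- 1"] uu by simp
  next
    case False
    then show ?thesis using that[of 1] by blast
  qed
  let ?w = "u0 + (- 1) \<cdot>\<^sub>v (s \<cdot>\<^sub>v ?q)"
  have EV: "E \<subseteq> V" using orthonormalD[OF E] by simp
  have wE: "?w \<in> perp E" by (intro perp_add perp_smult EV u0 qE)
  have wV: "?w \<in> V" using wE by (simp add: perp_def)
  define A where "A = reflection ?w"
  have A: "involution A" unfolding A_def by (rule involution_reflection[OF wV ww])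
  have AM: "A \<in> M" using A by simp
  have "A *\<^sub>v (s \<cdot>\<^sub>v ?q) = u0"
    unfolding A_def
  proof (rule reflection_swap(2)[OF u0V _ _ _ ww])
    show "h u0 u0 = h (s \<cdot>\<^sub>v ?q) (s \<cdot>\<^sub>v ?q)" using s qV qq by auto
    show "Im (h u0 (s \<cdot>\<^sub>v ?q)) = 0" using s qV u0V hq u0(3) by auto
  qed (use qV in simp)
  then have "s \<cdot>\<^sub>v (s \<cdot>\<^sub>v (A *\<^sub>v ?q)) = s \<cdot>\<^sub>v u0" using AM qV by simp
  then have Ru0: "A *\<^sub>v ?q = s \<cdot>\<^sub>v u0" using s by (auto simp: smult_smult_assoc)
  have AE: "A *\<^sub>v e = e" if e: "e \<in> E" for e
  proof -
    have "e \<in> V" "h e ?w = 0" using e EV perpD[OF wE] h_orth_sym by blast+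
    then show ?thesis unfolding A_def using wV by simp
  qed
  have iR: "isometry (A * f)" using A f by simp
  have sn: "s \<noteq> 0" using s by auto
  obtain u z where "chain f A (1\<^sub>m m) u z E"
  proof (rule chain_from_reversed_complement[OF f A involution_one E fE AE])
    show "orthogonal {u0}" using u0V uu by (auto simp: orthogonal_def)
    show "Re (h x x) > 0" if "x \<in> perp ({u0} \<union> E)" "x \<noteq> 0\<^sub>v m" for x
      using positive_if_orth_negative[OF u0V u0(2)] that by (simp add: perp_def)
    show "A *\<^sub>v (f *\<^sub>v x) \<in> perp {u0}" if "x \<in> perp {u0}" for x
      using isometry_preserves_orth[OF iR u0V _ sn, of x] Ru0 that AM fM u0V by (simp add: perp_def)
    show "twice_act (1\<^sub>m m) A f x = x" if "x \<in> {u0}" for x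
      using that AM fM u0V s Ru0 by (auto simp: smult_smult_assoc)
  qed (use u0 card in \<open>auto simp: perpD(1)\<close>)
  then show ?thesis using that by blast
qed

text \<open>\<open>A\<close> swaps \<open>p\<close> and \<open>f p / 2\<close>, so that \<open>R p = 2 p\<close>.  The dual eigenvalue 1/2 has an eigenvector \<open>q\<close>, null like \<open>p\<close> and
scaled to \<open>h p q = 1\<close>, and the reflection \<open>C\<close> that swaps \<open>p\<close> and \<open>q\<close> inverts \<open>R\<close> on their plane.\<close>

lemma head_null_vector:
  assumes f: "isometry f" and E: "orthonormal E" and fE: "\<And>e. e \<in> E \<Longrightarrow> \<exists>a. f *\<^sub>v e = a \<cdot>\<^sub>v e"
    and card: "card E + 3 = m"
    and p: "p \<in> perp E" "p \<noteq> 0\<^sub>v m" "h p p = 0" "Im (h (f *\<^sub>v p) p) = 0" "h (f *\<^sub>v p) p \<noteq> 0"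
  obtains A C u z where "chain f A C u z E"
proof -
  have fM: "f \<in> M" using f by simp
  have EV: "E \<subseteq> V" and fin: "finite E" using orthonormalD[OF E] by auto
  have pV: "p \<in> V" using p by (simp add: perp_def)
  let ?q = "(1/2) \<cdot>\<^sub>v (f *\<^sub>v p)"
  have fpV: "f *\<^sub>v p \<in> V" using fM pV by simp
  have fpE: "f *\<^sub>v p \<in> perp E" by (rule perp_invariant[OF f E fE p(1)])
  have hq: "h p (f *\<^sub>v p) = h (f *\<^sub>v p) p" using h_commute[OF fpV pV] p(4) by (simp add: complex_eq_iff)
  have ff: "h (f *\<^sub>v p) (f *\<^sub>v p) = 0" using isometry_h[OF f pV pV] p by simp
  let ?w = "p + (- 1) \<cdot>\<^sub>v ?q"
  have wE: "?w \<in> perp E" by (intro perp_add perp_smult EV p fpE)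
  have wV: "?w \<in> V" using wE by (simp add: perp_def)
  have ww: "h ?w ?w \<noteq> 0" using pV fpV hq ff p by simp
  define A where "A = reflection ?w"
  have A: "involution A" unfolding A_def by (rule involution_reflection[OF wV ww])
  have AM: "A \<in> M" using A by simp
  have "A *\<^sub>v ?q = p"
    unfolding A_def by (rule reflection_swap(2)[OF pV _ _ _ ww]) (use pV fpV hq ff p in auto)
  then have "2 \<cdot>\<^sub>v ((1/2) \<cdot>\<^sub>v (A *\<^sub>v (f *\<^sub>v p))) = 2 \<cdot>\<^sub>v p" using AM fpV by simp
  then have Rp: "A *\<^sub>v (f *\<^sub>v p) = 2 \<cdot>\<^sub>v p" by (simp add: smult_smult_assoc)
  have AE: "A *\<^sub>v e = e" if e: "e \<in> E" for e
  proof -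
    have "e \<in> V" "h e ?w = 0" using e EV perpD[OF wE] h_orth_sym by blast+
    then show ?thesis unfolding A_def using wV by simp
  qed
  let ?R = "A * f"
  have iR: "isometry ?R" using A f by simp
  have Re: "\<exists>a. ?R *\<^sub>v e = a \<cdot>\<^sub>v e \<and> cmod a = 1" if e: "e \<in> E" for e
  proof -
    obtain a where a: "f *\<^sub>v e = a \<cdot>\<^sub>v e" using fE e by blast
    have eV: "e \<in> V" "h e e \<noteq> 0" using orthonormalD[OF E] e by auto
    have "cmod a = 1" by (rule isometry_eigenvalue_norm[OF f eV(1) a eV(2)])
    then show ?thesis using a eV AE[OF e] AM fM by auto
  qed
  have RM: "?R \<in> M" using iR by simp
  have Rp': "?R *\<^sub>v p = 2 \<cdot>\<^sub>v p" using AM fM pV Rp by simp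
  obtain r where r: "r \<in> V" "r \<noteq> 0\<^sub>v m" "?R *\<^sub>v r = (1/2) \<cdot>\<^sub>v r"
    using isometry_dual_eigenvalue[OF iR pV p(2) Rp'] by auto
  have rr: "h r r = 0" by (rule isometry_eigenvectors_orth[OF iR r(1,3) r(1,3)]) simp
  have "r \<noteq> k \<cdot>\<^sub>v p" for k
  proof
    assume k: "r = k \<cdot>\<^sub>v p"
    have "2 \<cdot>\<^sub>v r = ?R *\<^sub>v r" unfolding k using RM pV Rp' by (simp add: smult_smult_assoc mult.commute del: mv_mult)
    then have e: "2 \<cdot>\<^sub>v r = (1/2) \<cdot>\<^sub>v r" using r by simp
    have "r = 0\<^sub>v m"
    proof (rule eq_vecI)
      fix i assume i: "i < dim_vec (0\<^sub>v m)"
      have "(2 \<cdot>\<^sub>v r) $ i = ((1/2) \<cdot>\<^sub>v r) $ i" using e by simp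
      then show "r $ i = 0\<^sub>v m $ i" using i r(1) by simp
    qed (use r in simp)
    then show False using r by simp
  qed
  then have pr: "h p r \<noteq> 0" using null_not_orth[OF pV r(1) p(2,3)] rr by simp
  define q where "q = (1 / cnj (h p r)) \<cdot>\<^sub>v r"
  have q: "q \<in> V" "h q q = 0" "h p q = 1" using r pV pr rr by (auto simp: q_def)
  have qp: "h q p = 1" using h_commute[OF pV q(1)] q by simp
  have Rq: "?R *\<^sub>v q = (1/2) \<cdot>\<^sub>v q" unfolding q_def using RM r by (simp add: smult_smult_assoc mult.commute del: mv_mult)
  have qE: "q \<in> perp E"
    unfolding perp_def
  proof (intro CollectI conjI ballI q)
    fix e assume e: "e \<in> E"
    obtain a where a: "?R *\<^sub>v e = a \<cdot>\<^sub>v e" "cmod a = 1" using Re e by blast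
    have eV: "e \<in> V" using EV e by auto
    have "1 / 2 * cnj a \<noteq> 1"
    proof
      assume "1 / 2 * cnj a = 1"
      then have "cmod (1 / 2 * cnj a) = 1" by simp
      then show False using a(2) by (simp add: norm_mult)
    qed
    then show "h q e = 0" by (rule isometry_eigenvectors_orth[OF iR q(1) Rq eV a(1)])
  qed
  let ?s = "p + 1 \<cdot>\<^sub>v q" and ?d = "p + (- 1) \<cdot>\<^sub>v q"
  have sd: "?s \<in> perp E" "?d \<in> perp E" by (intro perp_add perp_smult EV p qE)+
  have sdV: "?s \<in> V" "?d \<in> V" using sd by (auto simp: perp_def)
  have ss: "h ?s ?s = 2" and dd: "h ?d ?d = - 2" and sdo: "h ?d ?s = 0" using pV q qp p by auto
  have orth_pq: "h y p = 0 \<and> h y q = 0" if "y \<in> V" "h y ?s = 0" "h y ?d = 0" for y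
    using that pV q by auto
  define C where "C = reflection ?d"
  have C: "involution C" unfolding C_def by (rule involution_reflection[OF sdV(2)]) (use dd in simp)
  have CM: "C \<in> M" using C by simp
  have Cpq: "C *\<^sub>v p = q" "C *\<^sub>v q = p"
    unfolding C_def using reflection_swap[OF pV q(1)] p q dd by auto
  have Cx: "C *\<^sub>v x = x" if "x \<in> V" "h x p = 0" "h x q = 0" for x
    unfolding C_def using that sdV pV q by simp
  have Rq': "A *\<^sub>v (f *\<^sub>v q) = (1/2) \<cdot>\<^sub>v q" using Rq AM fM q by simp
  have sd_ne: "?s \<noteq> ?d" using ss dd by auto
  obtain u z where "chain f A C u z E"
  proof (rule chain_from_reversed_complement[OF f A C E fE AE, of "{?s, ?d}"])
    have sdo': "h ?s ?d = 0" using sdo h_orth_sym sdV by blast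
    show "orthogonal {?s, ?d}" unfolding orthogonal_def using sdV ss dd sdo sdo' by auto
    show "card {?s, ?d} + card E < m" "m \<le> card {?s, ?d} + card E + 1" using card sd_ne by auto
    show "{?s, ?d} \<subseteq> perp E" using sd by blast
  next
    fix x assume x: "x \<in> perp ({?s, ?d} \<union> E)" "x \<noteq> 0\<^sub>v m"
    have xV: "x \<in> V" "h x p = 0" "h x q = 0" using x orth_pq by (auto simp: perp_def)
    have "x \<noteq> k \<cdot>\<^sub>v p" for k
    proof
      assume k: "x = k \<cdot>\<^sub>v p"
      then have "k = 0" using xV pV q by auto
      then show False using x(2) k pV by simp
    qed
    then show "Re (h x x) > 0"
      using null_not_orth[OF pV xV(1) p(2,3)] h_orth_sym[OF xV(1) pV] xV by fastforce
  next
    fix x assume "x \<in> perp {?s, ?d}"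
    then have x: "x \<in> V" "h x p = 0" "h x q = 0" using orth_pq by (auto simp: perp_def)
    have RxV: "?R *\<^sub>v x \<in> V" by (rule mv_carrier[OF RM x(1)])
    have "h (?R *\<^sub>v x) p = 0" "h (?R *\<^sub>v x) q = 0"
      using isometry_preserves_orth[OF iR pV Rp' _ x(1,2)] isometry_preserves_orth[OF iR q(1) Rq _ x(1,3)] by auto
    then have "?R *\<^sub>v x \<in> perp {?s, ?d}" using RxV pV q(1) by (auto simp: perp_def simp del: mv_mult)
    then show "A *\<^sub>v (f *\<^sub>v x) \<in> perp {?s, ?d}" using AM fM x(1) by simp
    show "C *\<^sub>v x = x" by (rule Cx[OF x])
  next
    fix x assume x: "x \<in> {?s, ?d}"
    have "twice_act C A f (p + k \<cdot>\<^sub>v q) = p + k \<cdot>\<^sub>v q" for k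
      using AM fM CM pV q(1) Rp Rq' Cpq by (simp add: smult_smult_assoc)
    then show "twice_act C A f x = x" using x by blast
  qed
  then show ?thesis using that by blast
qed

end

section \<open>Square roots of isometries\<close>

context hermitian_space
begin

lemma cnj_comm_ring_hom: "comm_ring_hom cnj"
  by unfold_locales auto

text \<open>Take determinants in \<open>g\<^sup>T K (cnj g) = K\<close>, where \<open>K\<close> is the Gram matrix of the standard basis.\<close>

lemma isometry_det:
  assumes g: "isometry g" shows "cmod (det g) = 1"
proof -
  have gM: "g \<in> M" using g by simp
  define K where "K = mat m m (\<lambda>(i, j). h (unit_vec m i) (unit_vec m j))"
  let ?c = "map_mat cnj g"
  have KM: "K \<in> M" and cM: "?c \<in> M" and tM: "g\<^sup>T \<in> M" using gM by (auto simp: K_def)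
  have right: "h x w = (\<Sum>j<m. cnj (w $ j) * h x (unit_vec m j))" if "x \<in> V" "w \<in> V" for x w
  proof -
    have "h x w = cnj (h w x)" by (rule h_commute[OF that(2,1)])
    also have "\<dots> = (\<Sum>j<m. cnj (w $ j) * cnj (h (unit_vec m j) x))"
      using that by (simp add: h_coordinates[of w x])
    also have "\<dots> = (\<Sum>j<m. cnj (w $ j) * h x (unit_vec m j))"
      using h_commute[OF _ that(1)] by (intro sum.cong) auto
    finally show ?thesis .
  qed
  have "g\<^sup>T * (K * ?c) = K"
  proof (rule eq_matI)
    fix i j assume "i < dim_row K" "j < dim_col K"
    then have i: "i < m" and j: "j < m" by (auto simp: K_def)
    have col: "col g i \<in> V" "col g j \<in> V" using gM i j by auto
    have gu: "g *\<^sub>v unit_vec m k = col g k" if "k < m" for k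
      using gM that by (intro eq_vecI) auto
    have "(g\<^sup>T * (K * ?c)) $$ (i, j) = (\<Sum>k<m. g $$ (k, i) * (\<Sum>l<m. K $$ (k, l) * cnj (g $$ (l, j))))"
      using gM KM i j by (simp add: scalar_prod_def lessThan_atLeast0)
    also have "\<dots> = (\<Sum>k<m. col g i $ k * h (unit_vec m k) (col g j))"
    proof (rule sum.cong[OF refl])
      fix k assume "k \<in> {..<m}"
      then have k: "k < m" by simp
      have "h (unit_vec m k) (col g j) = (\<Sum>l<m. K $$ (k, l) * cnj (g $$ (l, j)))"
        using right[of "unit_vec m k" "col g j"] col gM j k by (simp add: K_def mult.commute)
      then show "g $$ (k, i) * (\<Sum>l<m. K $$ (k, l) * cnj (g $$ (l, j))) = col g i $ k * h (unit_vec m k) (col g j)"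
        using gM i k by simp
    qed
    also have "\<dots> = h (col g i) (col g j)" using h_coordinates[OF col] by simp
    also have "\<dots> = h (unit_vec m i) (unit_vec m j)"
      using isometry_h[OF g, of "unit_vec m i" "unit_vec m j"] gu i j by simp
    finally show "(g\<^sup>T * (K * ?c)) $$ (i, j) = K $$ (i, j)" using i j by (simp add: K_def)
  qed (use gM KM in auto)
  then have "det K = det (g\<^sup>T) * (det K * det ?c)"
    using det_mult[OF tM mult_carrier_mat[OF KM cM]] det_mult[OF KM cM] by simp
  moreover have "det (g\<^sup>T) = det g" by (rule det_transpose[OF gM])
  moreover have "det ?c = cnj (det g)" by (rule comm_ring_hom.hom_det[OF cnj_comm_ring_hom])
  moreover have "det K \<noteq> 0"
  proof
    assume "det K = 0"
    then have "det (K\<^sup>T) = 0" using det_transpose[OF KM] by simp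
    then obtain x where x: "x \<in> V" "x \<noteq> 0\<^sub>v m" "K\<^sup>T *\<^sub>v x = 0\<^sub>v m"
      using det_0_iff_vec_prod_zero[of "K\<^sup>T" m] KM by auto
    have e: "h x (unit_vec m j) = 0" if "j < m" for j
    proof -
      have "(K\<^sup>T *\<^sub>v x) $ j = h x (unit_vec m j)"
        using that KM x(1) by (simp add: h_coordinates[of x] K_def scalar_prod_def lessThan_atLeast0 mult.commute)
      then show ?thesis using x(3) that by simp
    qed
    have "x = 0\<^sub>v m"
    proof (rule nondegD[OF x(1)])
      fix y assume y: "y \<in> V"
      show "h x y = 0" unfolding right[OF x(1) y] using e by simp
    qed
    then show False using x by simp
  qed
  ultimately have "det g * cnj (det g) = 1" by (simp add: field_simps)
  then have "(cmod (det g))\<^sup>2 = 1" by (metis complex_norm_square of_real_eq_1_iff)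
  then show ?thesis by (simp add: power2_eq_1_iff) (metis norm_ge_zero neg_0_le_iff_le not_one_le_zero)
qed

lemma extend_by_eigenvectors:
  assumes S: "S \<in> M" and E: "orthonormal E"
  obtains f where "f \<in> M" "\<And>x. x \<in> perp E \<Longrightarrow> f *\<^sub>v x = S *\<^sub>v x" "\<And>e. e \<in> E \<Longrightarrow> f *\<^sub>v e = a e \<cdot>\<^sub>v e"
proof -
  have "finite E" using E orthonormalD by blast
  then have "orthonormal E \<Longrightarrow> \<exists>f\<in>M. (\<forall>x\<in>perp E. f *\<^sub>v x = S *\<^sub>v x) \<and> (\<forall>e\<in>E. f *\<^sub>v e = a e \<cdot>\<^sub>v e)"
  proof (induction E)
    case empty
    then show ?case using S by auto
  next
    case (insert e F)
    have F: "orthonormal F" by (rule orthonormal_subset[OF insert.prems]) auto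
    then obtain f where f: "f \<in> M" "\<And>x. x \<in> perp F \<Longrightarrow> f *\<^sub>v x = S *\<^sub>v x" "\<And>e. e \<in> F \<Longrightarrow> f *\<^sub>v e = a e \<cdot>\<^sub>v e"
      using insert.IH by blast
    have eV: "e \<in> V" "h e e = 1" using orthonormalD[OF insert.prems] by auto
    let ?b = "a e \<cdot>\<^sub>v e + (- 1) \<cdot>\<^sub>v (f *\<^sub>v e)"
    have feV: "f *\<^sub>v e \<in> V" using f eV by simp
    have bV: "?b \<in> V" using f eV by simp
    let ?g = "f + rank_one ?b e"
    have gM: "?g \<in> M" using f by simp
    have g: "?g *\<^sub>v x = f *\<^sub>v x + h x e \<cdot>\<^sub>v ?b" if "x \<in> V" for x
      using that f eV bV by (simp add: mv_mat_add)
    have "?g *\<^sub>v x = S *\<^sub>v x" if "x \<in> perp (insert e F)" for x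
    proof -
      have "x \<in> perp F" "x \<in> V" "h x e = 0" using that by (auto simp: perp_def)
      then show ?thesis using g f(2)[of x] bV S by simp
    qed
    moreover have "?g *\<^sub>v d = a d \<cdot>\<^sub>v d" if "d \<in> insert e F" for d
    proof (cases "d = e")
      case True
      have "f *\<^sub>v e + (a e \<cdot>\<^sub>v e + (- 1) \<cdot>\<^sub>v (f *\<^sub>v e)) = a e \<cdot>\<^sub>v e"
        using carrier_vecD[OF feV] carrier_vecD[OF eV(1)] by (intro eq_vecI) (auto simp del: dim_mult_mat_vec)
      then show ?thesis using g[OF eV(1)] eV True by simp
    next
      case False
      then have "d \<in> F" "d \<in> V" "h d e = 0" using that orthonormalD[OF insert.prems] by auto
      then show ?thesis using g f(3)[of d] bV by simp
    qed
    ultimately show ?case using gM by blast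
  qed
  then show ?thesis using that E by blast
qed

text \<open>A root on the complement of \<open>E\<close> (given by a matrix \<open>S\<close> that need not be an isometry elsewhere) and roots of the
eigenvalues on \<open>E\<close> combine to a root on the whole space.\<close>

lemma square_root_isometry:
  assumes g: "isometry g" and E: "orthonormal E" and c: "cmod c = 1"
    and a: "\<And>e. e \<in> E \<Longrightarrow> g *\<^sub>v e = mu e \<cdot>\<^sub>v e" "\<And>e. e \<in> E \<Longrightarrow> (a e)\<^sup>2 = c * mu e"
    and S: "S \<in> M" "\<And>x. x \<in> perp E \<Longrightarrow> S *\<^sub>v x \<in> perp E"
      "\<And>x. x \<in> perp E \<Longrightarrow> S *\<^sub>v (S *\<^sub>v x) = c \<cdot>\<^sub>v (g *\<^sub>v x)"
      "\<And>x y. x \<in> perp E \<Longrightarrow> y \<in> perp E \<Longrightarrow> h (S *\<^sub>v x) (S *\<^sub>v y) = h x y"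
  obtains f where "isometry f" "f * f = c \<cdot>\<^sub>m g" "\<And>x. x \<in> perp E \<Longrightarrow> f *\<^sub>v x = S *\<^sub>v x"
    "\<And>e. e \<in> E \<Longrightarrow> f *\<^sub>v e = a e \<cdot>\<^sub>v e"
proof -
  obtain f where f: "f \<in> M" "\<And>x. x \<in> perp E \<Longrightarrow> f *\<^sub>v x = S *\<^sub>v x" "\<And>e. e \<in> E \<Longrightarrow> f *\<^sub>v e = a e \<cdot>\<^sub>v e"
    using extend_by_eigenvectors[OF S(1) E] by blast
  have gM: "g \<in> M" using g by simp
  have eV: "e \<in> V" "h e e = 1" if "e \<in> E" for e using orthonormalD[OF E] that by auto
  have an: "a e * cnj (a e) = 1" if e: "e \<in> E" for e
  proof -
    have "cmod (mu e) = 1" by (rule isometry_eigenvalue_norm[OF g eV(1)[OF e] a(1)[OF e]]) (use eV e in simp)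
    then have "cmod ((a e)\<^sup>2) = 1" using a(2)[OF e] c by (simp add: norm_mult)
    then have "(cmod (a e))\<^sup>2 = 1" by (simp add: norm_power)
    then show ?thesis by (simp add: complex_norm_square[symmetric])
  qed
  have iso: "h (f *\<^sub>v x) (f *\<^sub>v y) = h x y" if x: "x \<in> V" and y: "y \<in> V" for x y
  proof -
    have base: "h (f *\<^sub>v x) (f *\<^sub>v y) = h x y" if x: "x \<in> perp E" and "y \<in> V" for x y
    proof (rule orthonormal_induct[OF E \<open>y \<in> V\<close>])
      fix y assume y: "y \<in> perp E"
      show "h (f *\<^sub>v x) (f *\<^sub>v y) = h x y" using f(2) x y S(4) by simp
    next
      fix y e b assume y: "y \<in> V" "e \<in> E" and IH: "h (f *\<^sub>v x) (f *\<^sub>v y) = h x y"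
      have "h (f *\<^sub>v x) e = 0" "h x e = 0" using f(2)[OF x] S(2)[OF x] x y by (auto simp: perp_def)
      moreover have "x \<in> V" using x by (rule perpD)
      ultimately show "h (f *\<^sub>v x) (f *\<^sub>v (y + b \<cdot>\<^sub>v e)) = h x (y + b \<cdot>\<^sub>v e)"
        using x y eV f S(1) IH by simp
    qed
    have evec: "h (f *\<^sub>v e) (f *\<^sub>v y) = h e y" if e: "e \<in> E" and "y \<in> V" for e y
    proof (rule orthonormal_induct[OF E \<open>y \<in> V\<close>])
      fix y assume y: "y \<in> perp E"
      then show "h (f *\<^sub>v e) (f *\<^sub>v y) = h e y"
        using base[OF y eV(1)[OF e]] h_commute[of "f *\<^sub>v e" "f *\<^sub>v y"] h_commute[of e y] f(1) eV(1)[OF e]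
        by (metis complex_cnj_cnj h_commute mv_carrier perpD(1))
    next
      fix y d b assume y: "y \<in> V" "d \<in> E" and IH: "h (f *\<^sub>v e) (f *\<^sub>v y) = h e y"
      have "h (f *\<^sub>v e) (f *\<^sub>v d) = h e d"
      proof (cases "d = e")
        case True
        then show ?thesis using f(3) e eV an[OF e] by (simp add: mult.commute)
      next
        case False
        then have "h e d = 0" using orthonormalD(5)[OF E e y(2)] by auto
        then show ?thesis using f(3) e y eV by simp
      qed
      then show "h (f *\<^sub>v e) (f *\<^sub>v (y + b \<cdot>\<^sub>v d)) = h e (y + b \<cdot>\<^sub>v d)"
        using y f(1) eV e IH by simp
    qed
    show ?thesis
    proof (rule orthonormal_induct[OF E x])
      fix x assume "x \<in> perp E"
      then show "h (f *\<^sub>v x) (f *\<^sub>v y) = h x y" using base y by blast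
    next
      fix x e b assume x: "x \<in> V" "e \<in> E" and IH: "h (f *\<^sub>v x) (f *\<^sub>v y) = h x y"
      then show "h (f *\<^sub>v (x + b \<cdot>\<^sub>v e)) (f *\<^sub>v y) = h (x + b \<cdot>\<^sub>v e) y"
        using evec[OF x(2) y] x eV f(1) y by simp
    qed
  qed
  have fi: "isometry f" unfolding isometry_def using f(1) iso by blast
  have "f * f = c \<cdot>\<^sub>m g"
  proof (rule mat_eq_by_action[of _ m])
    fix x assume x: "x \<in> V"
    have "f *\<^sub>v (f *\<^sub>v x) = c \<cdot>\<^sub>v (g *\<^sub>v x)"
    proof (rule orthonormal_induct[OF E x])
      fix x assume "x \<in> perp E"
      then show "f *\<^sub>v (f *\<^sub>v x) = c \<cdot>\<^sub>v (g *\<^sub>v x)" using f(2) S by simp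
    next
      fix x e b assume x: "x \<in> V" "e \<in> E" and IH: "f *\<^sub>v (f *\<^sub>v x) = c \<cdot>\<^sub>v (g *\<^sub>v x)"
      have "f *\<^sub>v (f *\<^sub>v e) = c \<cdot>\<^sub>v (g *\<^sub>v e)"
        using f(1,3) x a[OF x(2)] eV by (simp add: smult_smult_assoc power2_eq_square)
      moreover have "g *\<^sub>v x \<in> V" "g *\<^sub>v e \<in> V" using gM x eV by auto
      ultimately show "f *\<^sub>v (f *\<^sub>v (x + b \<cdot>\<^sub>v e)) = c \<cdot>\<^sub>v (g *\<^sub>v (x + b \<cdot>\<^sub>v e))"
        using IH f(1) gM x eV
        by (simp add: smult_add_distrib_vec[of _ m] smult_smult_assoc mult.commute)
    qed
    then show "(f * f) *\<^sub>v x = (c \<cdot>\<^sub>m g) *\<^sub>v x" using f(1) gM x by (simp add: mv_mat_smult)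
  qed (use f gM in auto)
  then show ?thesis using that fi f by blast
qed

text \<open>Up to a unit scalar, \<open>g\<close> is the square of a product of three involutions; see \<open>triple_involution_square\<close>.\<close>

definition triple_square where
  "triple_square g \<longleftrightarrow> (\<exists>c f A C. cmod c = 1 \<and> f * f = c \<cdot>\<^sub>m g \<and> reversed_by f A C)"

lemma triple_square_from_chain:
  assumes "chain f A C u z E" "f * f = c \<cdot>\<^sub>m g" "cmod c = 1" "g \<in> M" "c ^ m = 1 / det g" "det g \<noteq> 0"
  shows "triple_square g"
proof -
  have fM: "f \<in> M" using assms(1) by (simp add: chain_def)
  have "(det f)\<^sup>2 = det (c \<cdot>\<^sub>m g)" using det_mult[OF fM fM] assms(2) by (simp add: power2_eq_square)
  also have "\<dots> = 1" using assms by (simp add: det_smult)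
  finally obtain f' A' C' where "f' * f' = f * f" "reversed_by f' A' C'"
    using chain_complete[OF assms(1)] by blast
  then show ?thesis unfolding triple_square_def using assms by metis
qed

text \<open>The normalization of \<open>c\<close> makes the determinant of \<open>cg\<close> equal to 1; the sign condition steers the construction of the head.\<close>

lemma good_scalar:
  assumes g: "isometry g" and m: "3 \<le> m" and "al \<noteq> 0"
  obtains c where "cmod c = 1" "c ^ m = 1 / det g" "Re (c * al) > 0" "det g \<noteq> 0"
proof -
  have "det g \<noteq> 0" "cmod (1 / det g) = 1" using isometry_det[OF g] by (auto simp: norm_divide)
  then show ?thesis using root_in_half_plane[OF _ m assms(3), of "1 / det g"] that by blast
qed

end

section \<open>Elliptic and loxodromic isometries\<close>

context lorentz_space
begin

lemma maximal_positive_eigenvectors: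
  assumes g: "isometry g"
  obtains E where "orthonormal E" "\<And>e. e \<in> E \<Longrightarrow> \<exists>a. g *\<^sub>v e = a \<cdot>\<^sub>v e"
    "\<And>x l. x \<in> perp E \<Longrightarrow> g *\<^sub>v x = l \<cdot>\<^sub>v x \<Longrightarrow> Re (h x x) \<le> 0"
proof -
  let ?P = "\<lambda>E. orthonormal E \<and> (\<forall>e\<in>E. \<exists>a. g *\<^sub>v e = a \<cdot>\<^sub>v e)"
  have "?P {}" by (simp add: orthonormal_def orthogonal_def)
  moreover have "\<forall>E. ?P E \<longrightarrow> card E < Suc m"
    using orthogonal_card_le orthonormal_orthogonal by (simp add: less_Suc_eq_le)
  ultimately obtain E where E: "?P E" and max: "\<And>F. ?P F \<Longrightarrow> card F \<le> card E"
    using ex_has_greatest_nat[of ?P "{}" card "Suc m"] by blast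
  have "Re (h x x) \<le> 0" if x: "x \<in> perp E" "g *\<^sub>v x = l \<cdot>\<^sub>v x" for x l
  proof (rule ccontr)
    assume "\<not> ?thesis"
    then have pos: "Re (h x x) > 0" by simp
    have xV: "x \<in> V" using x by (simp add: perp_def)
    obtain t where t: "h (complex_of_real t \<cdot>\<^sub>v x) (complex_of_real t \<cdot>\<^sub>v x) = 1"
      using normalize[OF xV pos] by blast
    let ?e = "complex_of_real t \<cdot>\<^sub>v x"
    have EV: "E \<subseteq> V" "finite E" using E orthonormalD by auto
    have e: "?e \<in> perp E" using perp_smult EV x by blast
    have "g *\<^sub>v ?e = l \<cdot>\<^sub>v ?e" using g xV x(2) by (simp add: smult_smult_assoc mult.commute)
    moreover note ins = orthonormal_insert[of E ?e, OF _ e t]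
    ultimately have "?P (insert ?e E)" using E by blast
    then have "card (insert ?e E) \<le> card E" by (rule max)
    then show False using ins E EV by simp
  qed
  then show ?thesis using that E by blast
qed

text \<open>Subtracting its component along a positive vector only makes a negative vector more negative.\<close>

lemma perp_contains_negative:
  assumes E: "orthonormal E"
  obtains b where "b \<in> perp E" "Re (h b b) < 0"
proof -
  have "finite E" using orthonormalD[OF E] by simp
  then have "orthonormal E \<Longrightarrow> \<exists>b\<in>perp E. Re (h b b) < 0"
  proof (induction E)
    case empty
    then show ?case using ex_negative by (auto simp: perp_def)
  next
    case (insert e F)
    have "orthonormal F" by (rule orthonormal_subset[OF insert.prems]) auto
    then obtain b where b: "b \<in> perp F" "Re (h b b) < 0" using insert.IH by blast
    have eV: "e \<in> V" "h e e = 1" using orthonormalD[OF insert.prems] by auto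
    have bV: "b \<in> V" using b by (simp add: perp_def)
    let ?c = "b + (- h b e) \<cdot>\<^sub>v e"
    have "?c \<in> perp (insert e F)"
      unfolding perp_def
    proof (intro CollectI conjI ballI)
      fix d assume d: "d \<in> insert e F"
      show "h ?c d = 0"
      proof (cases "d = e")
        case False
        then have "d \<in> V" "h e d = 0" "h b d = 0"
          using d orthonormalD[OF insert.prems] b by (auto simp: perp_def)
        then show ?thesis using eV bV by simp
      qed (use eV bV in simp)
    qed (use bV eV in simp)
    moreover have "Re (h ?c ?c) < 0"
    proof -
      have "h ?c ?c = h b b - h b e * cnj (h b e)"
        using eV bV h_commute[OF bV eV(1)] by (simp add: algebra_simps)
      then have "Re (h ?c ?c) = Re (h b b) - (cmod (h b e))\<^sup>2"
        by (simp only: complex_norm_square[symmetric] minus_complex.simps Re_complex_of_real)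
      then show ?thesis using b(2) by (smt (verit) zero_le_power2)
    qed
    ultimately show ?case by blast
  qed
  then show ?thesis using that E by blast
qed

end

text \<open>A maximal orthonormal system of positive eigenvectors; what is left has none.\<close>

locale eigenframe = lorentz_space +
  fixes g :: "complex mat" and E :: "complex vec set" and mu :: "complex vec \<Rightarrow> complex"
  assumes g: "isometry g" and E: "orthonormal E"
    and eig: "\<And>e. e \<in> E \<Longrightarrow> g *\<^sub>v e = mu e \<cdot>\<^sub>v e"
    and maximal: "\<And>x l. x \<in> perp E \<Longrightarrow> g *\<^sub>v x = l \<cdot>\<^sub>v x \<Longrightarrow> Re (h x x) \<le> 0"
begin

lemma gM [simp]: "g \<in> M" using g by simp

lemma E_facts: "E \<subseteq> V" "finite E" "e \<in> E \<Longrightarrow> e \<in> V" "e \<in> E \<Longrightarrow> h e e = 1" "orthogonal E"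
  using orthonormalD[OF E] orthonormal_orthogonal[OF E] by auto

lemma mu_norm: "e \<in> E \<Longrightarrow> cmod (mu e) = 1"
  using isometry_eigenvalue_norm[OF g E_facts(3) eig] E_facts(4) by simp

lemma g_perp: "x \<in> perp E \<Longrightarrow> g *\<^sub>v x \<in> perp E"
  by (rule perp_invariant[OF g E]) (use eig in blast)

text \<open>A nonzero invariant subspace contains an eigenvector, which is not positive by maximality.\<close>

lemma invariant_positive_trivial:
  assumes S: "S \<subseteq> perp E" "\<And>y z. y \<in> S \<Longrightarrow> z \<in> S \<Longrightarrow> y + z \<in> S" "\<And>a y. y \<in> S \<Longrightarrow> a \<cdot>\<^sub>v y \<in> S"
           "\<And>y. y \<in> S \<Longrightarrow> g *\<^sub>v y \<in> S"
    and pos: "\<And>x. x \<in> S \<Longrightarrow> x \<noteq> 0\<^sub>v m \<Longrightarrow> Re (h x x) > 0"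
    and x: "x \<in> S"
  shows "x = 0\<^sub>v m"
proof (rule ccontr)
  assume "x \<noteq> 0\<^sub>v m"
  then have xn: "x \<notin> {0\<^sub>v m}" by simp
  have SV: "S \<subseteq> V" using S(1) by (auto simp: perp_def)
  obtain y l where y: "y \<in> S" "y \<notin> {0\<^sub>v m}" "g *\<^sub>v y + (- l) \<cdot>\<^sub>v y \<in> {0\<^sub>v m}"
    by (rule eigenvector_modulo_subspace[of g S "{0\<^sub>v m}" x, OF gM SV S(2-4) _ _ x xn]) auto
  have yV: "y \<in> V" using y SV by auto
  have "g *\<^sub>v y = l \<cdot>\<^sub>v y" by (rule eq_smult_of_diff_zero) (use y yV in auto)
  then have "Re (h y y) \<le> 0" using maximal y S(1) by blast
  then show False using pos y by force
qed

lemma dimension_if_complete: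
  assumes "orthogonal (insert x E)" "x \<notin> E" "\<And>y. y \<in> perp (insert x E) \<Longrightarrow> y = 0\<^sub>v m"
  shows "card E + 1 = m"
  using card_complete[OF assms(1,3)] assms(2) E_facts by simp

lemma chain_from_root:
  assumes c: "cmod c = 1" "c ^ m = 1 / det g" "det g \<noteq> 0"
    and f: "f * f = c \<cdot>\<^sub>m g" and ch: "chain f A C u z F"
  shows "triple_square g"
  by (rule triple_square_from_chain[OF ch f c(1) gM c(2,3)])

text \<open>\<open>W\<close> is the line of \<open>v\<close>.  A vector \<open>u0 = v + t e\<close> works for \<open>head_negative_vector\<close> if \<open>t\<^sup>2 Im a = - h v v * Im om\<close>, where
\<open>om\<close> and \<open>a\<close> are the eigenvalues of \<open>f\<close> at \<open>v\<close> and \<open>e\<close>; it is negative if \<open>Im om < Im a\<close>.  With both roots in the upper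
half plane this means \<open>Re (c * mu e) < Re (c * l)\<close>, which some \<open>c\<close> satisfies unless \<open>mu e = l\<close>.  If that holds for all
\<open>e\<close>, then \<open>g\<close> is a scalar.\<close>

lemma triple_square_elliptic:
  assumes v: "v \<in> perp E" "Re (h v v) < 0" "g *\<^sub>v v = l \<cdot>\<^sub>v v"
  shows "triple_square g"
proof -
  have vV: "v \<in> V" and vv: "h v v \<noteq> 0" using v by (auto simp: perp_def)
  have ln: "cmod l = 1" by (rule isometry_eigenvalue_norm[OF g vV v(3) vv])
  then have l0: "l \<noteq> 0" by auto
  note ins = orthogonal_insert[OF E_facts(5) v(1) vv]
  have complete: "y = 0\<^sub>v m" if y: "y \<in> perp E" "h y v = 0" for y
  proof (rule invariant_positive_trivial[of "{x \<in> perp E. h x v = 0}"])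
    show "g *\<^sub>v y \<in> {x \<in> perp E. h x v = 0}" if "y \<in> {x \<in> perp E. h x v = 0}" for y
      using g_perp isometry_preserves_orth[OF g vV v(3) l0] that by (auto simp: perp_def)
    show "Re (h x x) > 0" if "x \<in> {x \<in> perp E. h x v = 0}" "x \<noteq> 0\<^sub>v m" for x
      using positive_if_orth_negative[OF vV v(2)] that by (auto simp: perp_def)
  qed (use y vV perp_add perp_smult E_facts in \<open>auto simp: perpD(1)\<close>)
  have card: "card E + 1 = m"
    by (rule dimension_if_complete[OF ins]) (use complete in \<open>auto simp: perp_def\<close>)
  have perpE: "\<exists>k. x = k \<cdot>\<^sub>v v" if x: "x \<in> perp E" for x
  proof -
    have xV: "x \<in> V" using x by (simp add: perp_def)
    have "x + (- (h x v / h v v)) \<cdot>\<^sub>v v = 0\<^sub>v m"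
    proof (rule complete)
      show "x + (- (h x v / h v v)) \<cdot>\<^sub>v v \<in> perp E" by (intro perp_add perp_smult E_facts(1) x v(1))
    qed (use xV vV vv in simp)
    then show ?thesis using eq_smult_of_diff_zero[OF xV vV] by blast
  qed
  show ?thesis
  proof (cases "\<forall>e\<in>E. mu e = l")
    case True
    have gl: "g *\<^sub>v x = l \<cdot>\<^sub>v x" if "x \<in> V" for x
    proof (rule orthonormal_induct[OF E that])
      fix x assume "x \<in> perp E"
      then obtain k where "x = k \<cdot>\<^sub>v v" using perpE by blast
      then show "g *\<^sub>v x = l \<cdot>\<^sub>v x" using vV v(3) by (simp add: smult_smult_assoc mult.commute)
    next
      fix x e a assume "x \<in> V" "e \<in> E" "g *\<^sub>v x = l \<cdot>\<^sub>v x"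
      then show "g *\<^sub>v (x + a \<cdot>\<^sub>v e) = l \<cdot>\<^sub>v (x + a \<cdot>\<^sub>v e)"
        using E_facts(3) eig True by (simp add: smult_smult_assoc mult.commute smult_add_distrib_vec[of _ m])
    qed
    have "1\<^sub>m m * 1\<^sub>m m = (1 / l) \<cdot>\<^sub>m g"
    proof (rule mat_eq_by_action[of _ m])
      fix x assume "x \<in> V"
      then show "(1\<^sub>m m * 1\<^sub>m m) *\<^sub>v x = ((1 / l) \<cdot>\<^sub>m g) *\<^sub>v x"
        using gl l0 by (simp add: mv_mat_smult smult_smult_assoc)
    qed auto
    moreover have "reversed_by (1\<^sub>m m) (1\<^sub>m m) (1\<^sub>m m)" by (simp add: reversed_by_def)
    moreover have "cmod (1 / l) = 1" using ln by (simp add: norm_divide)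
    ultimately show ?thesis unfolding triple_square_def by blast
  next
    case False
    then obtain e where e: "e \<in> E" "mu e \<noteq> l" by blast
    have eV: "e \<in> V" "h e e = 1" using E_facts e by auto
    obtain c where c: "cmod c = 1" "c ^ m = 1 / det g" "Re (c * (l - mu e)) > 0" "det g \<noteq> 0"
      using good_scalar[OF g three_le, of "l - mu e"] e by auto
    have "\<exists>r. r\<^sup>2 = z \<and> Im r \<ge> 0" for z :: complex
    proof (cases "Im (csqrt z) \<ge> 0")
      case True
      then show ?thesis using power2_csqrt by blast
    next
      case False
      then have "(- csqrt z)\<^sup>2 = z \<and> Im (- csqrt z) \<ge> 0" by (simp del: csqrt.simps)
      then show ?thesis by blast
    qed
    then obtain r :: "complex \<Rightarrow> complex" where r: "(r z)\<^sup>2 = z" "Im (r z) \<ge> 0" for z by metis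
    let ?om = "r (c * l)" and ?a = "r (c * mu e)"
    have imr: "2 * (Im (r z))\<^sup>2 = 1 - Re z" if "cmod z = 1" for z
    proof -
      have "(cmod (r z))\<^sup>2 = 1" using r(1)[of z] that by (metis norm_power)
      moreover have "Re z = (Re (r z))\<^sup>2 - (Im (r z))\<^sup>2" using r(1)[of z] by (metis Re_power2)
      ultimately show ?thesis by (simp add: cmod_power2)
    qed
    have n: "cmod (c * l) = 1" "cmod (c * mu e) = 1" using c(1) ln mu_norm e by (auto simp: norm_mult)
    have "(Im ?om)\<^sup>2 < (Im ?a)\<^sup>2" using imr[OF n(1)] imr[OF n(2)] c(3) by (simp add: right_diff_distrib)
    then have lt: "Im ?om < Im ?a" using r(2) by (meson power2_less_imp_less)
    have omn: "?om * cnj ?om = 1"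
    proof -
      have "(cmod ?om)\<^sup>2 = 1" using r(1)[of "c * l"] n(1) by (metis norm_power)
      then show ?thesis by (metis complex_norm_square of_real_1)
    qed
    have lc: "c \<cdot>\<^sub>v (g *\<^sub>v x) = (?om * ?om) \<cdot>\<^sub>v x" if x: "x \<in> perp E" for x
    proof -
      obtain k where "x = k \<cdot>\<^sub>v v" using perpE[OF x] by blast
      then show ?thesis using vV v(3) r(1)[of "c * l"]
        by (simp add: smult_smult_assoc ac_simps power2_eq_square)
    qed
    let ?S = "?om \<cdot>\<^sub>m 1\<^sub>m m"
    have S: "?S *\<^sub>v x = ?om \<cdot>\<^sub>v x" if "x \<in> V" for x using that by (simp add: mv_mat_smult)
    obtain f where f: "isometry f" "f * f = c \<cdot>\<^sub>m g" "\<And>x. x \<in> perp E \<Longrightarrow> f *\<^sub>v x = ?S *\<^sub>v x"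
      "\<And>e. e \<in> E \<Longrightarrow> f *\<^sub>v e = r (c * mu e) \<cdot>\<^sub>v e"
    proof (rule square_root_isometry[OF g E c(1) eig, of "\<lambda>e. r (c * mu e)" ?S])
      fix x assume x: "x \<in> perp E"
      then show "?S *\<^sub>v x \<in> perp E" using S perp_smult E_facts by (simp add: perpD(1))
      show "?S *\<^sub>v (?S *\<^sub>v x) = c \<cdot>\<^sub>v (g *\<^sub>v x)"
        using S x lc by (simp add: perpD(1) smult_smult_assoc)
      fix y assume y: "y \<in> perp E"
      have "h (?om \<cdot>\<^sub>v x) (?om \<cdot>\<^sub>v y) = (?om * cnj ?om) * h x y"
        using x y by (simp add: perpD(1))
      then show "h (?S *\<^sub>v x) (?S *\<^sub>v y) = h x y" using S x y omn by (simp add: perpD(1))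
    qed (use r in auto)
    define t where "t = sqrt (- Re (h v v) * Im ?om / Im ?a)"
    have ia: "Im ?a > 0" using lt r(2)[of "c * l"] by linarith
    have nonneg: "0 \<le> - Re (h v v) * Im ?om / Im ?a"
      by (intro divide_nonneg_pos mult_nonneg_nonneg) (use v(2) r(2)[of "c * l"] ia in auto)
    have t2: "t * t = - Re (h v v) * Im ?om / Im ?a" using real_sqrt_pow2[OF nonneg] unfolding t_def power2_eq_square .
    have ttIm: "t * t * Im ?a = - Re (h v v) * Im ?om" using t2 ia by simp
    define u0 where "u0 = v + complex_of_real t \<cdot>\<^sub>v e"
    have ve: "h v e = 0" "h e v = 0" using v e eV h_orth_sym[of v e] vV by (auto simp: perp_def)
    have u0V: "u0 \<in> V" using vV eV by (simp add: u0_def)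
    have fu: "f *\<^sub>v u0 = ?om \<cdot>\<^sub>v v + (complex_of_real t * ?a) \<cdot>\<^sub>v e"
      unfolding u0_def using f(1) vV eV f(3)[OF v(1)] S[OF vV] f(4)[OF e(1)] by (simp add: smult_smult_assoc)
    have qv: "Im (h v v) = 0" using h_self_real[OF vV] by (metis Im_complex_of_real)
    let ?E = "E - {e}"
    have E': "orthonormal ?E" by (rule orthonormal_subset[OF E]) auto
    have card': "card ?E + 2 = m" using card e(1) E_facts(2) three_le by simp
    have u0E: "u0 \<in> perp ?E"
      unfolding perp_def
    proof (intro CollectI conjI ballI u0V)
      fix d assume d: "d \<in> ?E"
      then have "d \<in> V" "h v d = 0" "h e d = 0" using E_facts v orthonormalD(5)[OF E e(1), of d] by (auto simp: perp_def)
      then show "h u0 d = 0" unfolding u0_def using vV eV by simp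
    qed
    have uu: "Re (h u0 u0) < 0"
    proof -
      have "h u0 u0 = h v v + complex_of_real (t * t)"
        unfolding u0_def using vV eV ve by simp
      then have "Re (h u0 u0) = Re (h v v) + t * t" by simp
      moreover have "- Re (h v v) * Im ?om / Im ?a < - Re (h v v)"
        by (subst pos_divide_less_eq[OF ia], rule mult_strict_left_mono[OF lt]) (use v(2) in simp)
      ultimately show ?thesis using t2 by linarith
    qed
    have "h (f *\<^sub>v u0) u0 = ?om * h v v + complex_of_real (t * t) * ?a"
      unfolding fu unfolding u0_def using vV eV ve by (simp add: ac_simps)
    then have im: "Im (h (f *\<^sub>v u0) u0) = 0" using ttIm qv by (simp add: mult.commute)
    obtain A u z where ch: "chain f A (1\<^sub>m m) u z ?E"
      by (rule head_negative_vector[OF f(1) E' _ card' u0E uu im]) (use f(4) in auto)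
    show ?thesis by (rule chain_from_root[OF c(1,2,4) f(2) ch])
  qed
qed

text \<open>\<open>W\<close> is spanned by null eigenvectors \<open>v\<close> and \<open>q\<close>, and \<open>f\<close> has the eigenvalues \<open>rho\<close> and \<open>1 / cnj rho\<close> there.  The negative
vectors \<open>(-1 + \<i> tau) v + q\<close> include one with the property required in \<open>head_negative_vector\<close> unless \<open>rho\<close> is purely
imaginary, which the choice of \<open>c\<close> excludes.\<close>

lemma triple_square_loxodromic:
  assumes v: "v \<in> perp E" "v \<noteq> 0\<^sub>v m" "h v v = 0" "g *\<^sub>v v = l \<cdot>\<^sub>v v" "cmod l \<noteq> 1"
  shows "triple_square g"
proof -
  have vV: "v \<in> V" using v by (simp add: perp_def)
  have l0: "l \<noteq> 0"
  proof
    assume "l = 0"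
    then have "g *\<^sub>v v = 0\<^sub>v m" using v(4) vV by simp
    then show False using isometry_injective[OF g vV] v(2) by simp
  qed
  have llc: "l * cnj l \<noteq> 1"
  proof
    assume "l * cnj l = 1"
    then have "(cmod l)\<^sup>2 = 1" by (metis complex_norm_square of_real_eq_1_iff)
    then show False using v(5) by (simp add: power2_eq_1_iff) (metis norm_ge_zero neg_0_le_iff_le not_one_le_zero)
  qed
  obtain r where r: "r \<in> V" "r \<noteq> 0\<^sub>v m" "g *\<^sub>v r = (1 / cnj l) \<cdot>\<^sub>v r"
    using isometry_dual_eigenvalue[OF g vV v(2,4)] by blast
  have rr: "h r r = 0"
  proof (rule isometry_eigenvectors_orth[OF g r(1,3) r(1,3)])
    show "1 / cnj l * cnj (1 / cnj l) \<noteq> 1" using llc l0 by (simp add: field_simps)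
  qed
  have rE: "r \<in> perp E"
    unfolding perp_def
  proof (intro CollectI conjI ballI r)
    fix e assume e: "e \<in> E"
    have "1 / cnj l * cnj (mu e) \<noteq> 1"
    proof
      assume "1 / cnj l * cnj (mu e) = 1"
      then have "cnj (mu e) = cnj l" using l0 by (simp add: field_simps)
      then show False using v(5) mu_norm[OF e] by simp
    qed
    then show "h r e = 0" by (rule isometry_eigenvectors_orth[OF g r(1,3) E_facts(3)[OF e] eig[OF e]])
  qed
  have "r \<noteq> k \<cdot>\<^sub>v v" for k
  proof
    assume k: "r = k \<cdot>\<^sub>v v"
    have "l \<cdot>\<^sub>v r = (1 / cnj l) \<cdot>\<^sub>v r" using r(3) k vV v(4) by (simp add: smult_smult_assoc mult.commute)
    then have "l * r $ i = (1 / cnj l) * r $ i" if "i < m" for i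
      using that r(1) by (metis carrier_vecD index_smult_vec(1))
    then have "r $ i = 0" if "i < m" for i using that llc l0 by (auto simp: field_simps)
    then have "r = 0\<^sub>v m" using r(1) by (intro eq_vecI) auto
    then show False using r by simp
  qed
  then have vr: "h v r \<noteq> 0" using null_not_orth[OF vV r(1) v(2,3)] rr by simp
  define q where "q = (1 / cnj (h v r)) \<cdot>\<^sub>v r"
  have q: "q \<in> V" "h q q = 0" "h v q = 1" using r vV vr rr by (auto simp: q_def)
  have qv: "h q v = 1" using h_commute[OF vV q(1)] q by simp
  have qE: "q \<in> perp E" unfolding q_def using perp_smult rE E_facts by blast
  have gq: "g *\<^sub>v q = (1 / cnj l) \<cdot>\<^sub>v q" unfolding q_def using r by (simp add: smult_smult_assoc mult.commute)
  have complete: "y = 0\<^sub>v m" if y: "y \<in> perp E" "h y v = 0" "h y q = 0" for y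
  proof (rule invariant_positive_trivial[of "{x \<in> perp E. h x v = 0 \<and> h x q = 0}"])
    show "g *\<^sub>v y \<in> {x \<in> perp E. h x v = 0 \<and> h x q = 0}" if "y \<in> {x \<in> perp E. h x v = 0 \<and> h x q = 0}" for y
      using g_perp isometry_preserves_orth[OF g vV v(4) l0] isometry_preserves_orth[OF g q(1) gq] l0 that
      by (auto simp: perp_def)
    show "Re (h x x) > 0" if "x \<in> {x \<in> perp E. h x v = 0 \<and> h x q = 0}" "x \<noteq> 0\<^sub>v m" for x
      using positive_if_orth_negative[of "v + (- 1) \<cdot>\<^sub>v q" x] that vV q v(3) qv by (auto simp: perp_def)
  qed (use y vV q perp_add perp_smult E_facts in \<open>auto simp: perpD(1)\<close>)
  have perpE: "x = h x q \<cdot>\<^sub>v v + h x v \<cdot>\<^sub>v q" if x: "x \<in> perp E" for x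
  proof -
    have xV: "x \<in> V" using x by (simp add: perp_def)
    have "x + (- 1) \<cdot>\<^sub>v (h x q \<cdot>\<^sub>v v + h x v \<cdot>\<^sub>v q) = 0\<^sub>v m"
    proof (rule complete)
      show "x + (- 1) \<cdot>\<^sub>v (h x q \<cdot>\<^sub>v v + h x v \<cdot>\<^sub>v q) \<in> perp E"
        by (intro perp_add perp_smult E_facts(1) x v(1) qE)
    qed (use xV vV q v(3) qv in auto)
    then have "x = 1 \<cdot>\<^sub>v (h x q \<cdot>\<^sub>v v + h x v \<cdot>\<^sub>v q)"
      using eq_smult_of_diff_zero[of x "h x q \<cdot>\<^sub>v v + h x v \<cdot>\<^sub>v q" 1] xV vV q(1) by simp
    then show ?thesis using vV q(1) by simp
  qed
  have card: "card E + 2 = m"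
  proof -
    let ?s = "v + 1 \<cdot>\<^sub>v q" and ?d = "v + (- 1) \<cdot>\<^sub>v q"
    have sd: "?s \<in> perp E" "?d \<in> perp E" by (intro perp_add perp_smult E_facts(1) v(1) qE)+
    have ss: "h ?s ?s \<noteq> 0" and dd: "h ?d ?d \<noteq> 0" and sdo: "h ?d ?s = 0" using vV q qv v(3) by auto
    note E1 = orthogonal_insert[OF E_facts(5) sd(1) ss]
    have dE1: "?d \<in> perp (insert ?s E)" using sd(2) sdo unfolding perp_def by blast
    note E2 = orthogonal_insert[OF E1(1) dE1 dd]
    have "card (insert ?d (insert ?s E)) = m"
    proof (rule card_complete[OF E2(1)])
      fix x assume x: "x \<in> perp (insert ?d (insert ?s E))"
      then have xE: "x \<in> V" "x \<in> perp E" and "h x ?s = 0" "h x ?d = 0" by (auto simp: perp_def)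
      then show "x = 0\<^sub>v m" using vV q(1) by (intro complete) auto
    qed
    then show ?thesis using E1(2) E2(2) E_facts(2) by simp
  qed
  obtain c where c: "cmod c = 1" "c ^ m = 1 / det g" "Re (c * l) > 0" "det g \<noteq> 0"
    using good_scalar[OF g three_le l0] by blast
  have cc: "c * cnj c = 1" using c(1) by (simp add: complex_norm_square[symmetric])
  define rho where "rho = csqrt (c * l)"
  have rho2: "rho * rho = c * l" unfolding rho_def by (metis power2_csqrt power2_eq_square)
  have rho0: "rho \<noteq> 0" using rho2 c l0 by auto
  have rrc: "rho * cnj rho \<noteq> 1"
  proof
    assume a: "rho * cnj rho = 1"
    have "(c * l) * cnj (c * l) = (rho * cnj rho) * (rho * cnj rho)" unfolding rho2[symmetric] by simp
    also have "\<dots> = 1" unfolding a by simp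
    finally have "(c * cnj c) * (l * cnj l) = 1" by (simp add: ac_simps)
    then show False using cc llc by simp
  qed
  let ?S = "rho \<cdot>\<^sub>m rank_one v q + (1 / cnj rho) \<cdot>\<^sub>m rank_one q v"
  have S: "?S *\<^sub>v x = (rho * h x q) \<cdot>\<^sub>v v + (h x v / cnj rho) \<cdot>\<^sub>v q" if "x \<in> V" for x
    using that vV q(1) by (simp add: mv_mat_add mv_mat_smult smult_smult_assoc)
  have SM: "?S \<in> M" by simp
  have rho2': "(1 / cnj rho) * (1 / cnj rho) = c / cnj l"
  proof -
    have "(1 / cnj rho) * (1 / cnj rho) = 1 / cnj (rho * rho)" by simp
    also have "\<dots> = 1 / cnj c / cnj l" unfolding rho2 by simp
    also have "1 / cnj c = c" using cc by (metis nonzero_eq_divide_eq mult_zero_right zero_neq_one)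
    finally show ?thesis .
  qed
  obtain f where f: "isometry f" "f * f = c \<cdot>\<^sub>m g" "\<And>x. x \<in> perp E \<Longrightarrow> f *\<^sub>v x = ?S *\<^sub>v x"
    "\<And>e. e \<in> E \<Longrightarrow> f *\<^sub>v e = csqrt (c * mu e) \<cdot>\<^sub>v e"
  proof (rule square_root_isometry[OF g E c(1) eig, of "\<lambda>e. csqrt (c * mu e)" ?S])
    fix x assume x: "x \<in> perp E"
    have xV: "x \<in> V" using x by (simp add: perp_def)
    show "?S *\<^sub>v x \<in> perp E" unfolding S[OF xV] by (intro perp_add perp_smult E_facts(1) v(1) qE)
    have SV: "?S *\<^sub>v x \<in> V" unfolding S[OF xV] using vV q(1) by simp
    have "?S *\<^sub>v (?S *\<^sub>v x) = (rho * h (?S *\<^sub>v x) q) \<cdot>\<^sub>v v + (h (?S *\<^sub>v x) v / cnj rho) \<cdot>\<^sub>v q"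
      by (rule S[OF SV])
    also have "\<dots> = (rho * rho * h x q) \<cdot>\<^sub>v v + ((1 / cnj rho) * (1 / cnj rho) * h x v) \<cdot>\<^sub>v q"
      unfolding S[OF xV] using vV q v(3) qv by (simp add: mult.assoc)
    also have "\<dots> = c \<cdot>\<^sub>v (g *\<^sub>v (h x q \<cdot>\<^sub>v v + h x v \<cdot>\<^sub>v q))"
      unfolding rho2 rho2' using vV q(1) v(4) gq
      by (simp add: smult_smult_assoc smult_add_distrib_vec[of _ m] ac_simps)
    finally show "?S *\<^sub>v (?S *\<^sub>v x) = c \<cdot>\<^sub>v (g *\<^sub>v x)" using perpE[OF x] by simp
    fix y assume y: "y \<in> perp E"
    have yV: "y \<in> V" using y by (simp add: perp_def)
    have "h (?S *\<^sub>v x) (?S *\<^sub>v y) = h x q * cnj (h y v) + h x v * cnj (h y q)"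
      unfolding S[OF xV] S[OF yV] using vV q v(3) qv rho0 by simp
    also have "\<dots> = h (h x q \<cdot>\<^sub>v v + h x v \<cdot>\<^sub>v q) (h y q \<cdot>\<^sub>v v + h y v \<cdot>\<^sub>v q)"
      using vV q v(3) qv by simp
    finally show "h (?S *\<^sub>v x) (?S *\<^sub>v y) = h x y" using perpE[OF x] perpE[OF y] by simp
  qed (use power2_csqrt in auto)
  have Rrho: "Re rho \<noteq> 0"
  proof
    assume "Re rho = 0"
    then have "Re (rho * rho) \<le> 0" by simp
    then show False using rho2 c(3) by simp
  qed
  define R2 where "R2 = Re rho * Re rho + Im rho * Im rho"
  have R2: "R2 > 0" "R2 \<noteq> 1"
  proof -
    show "R2 > 0" unfolding R2_def using Rrho by (metis add_pos_nonneg not_real_square_gt_zero zero_le_square)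
    show "R2 \<noteq> 1"
    proof
      assume "R2 = 1"
      then have "rho * cnj rho = 1" unfolding R2_def by (simp add: complex_eq_iff)
      then show False using rrc by simp
    qed
  qed
  \<comment> \<open>the zero of the imaginary part of h (f u0) u0, which is linear in tau\<close>
  define tau where "tau = Im rho * (R2 + 1) / (Re rho * (R2 - 1))"
  have tau: "tau * (Re rho * (R2 - 1)) = Im rho * (R2 + 1)" unfolding tau_def using Rrho R2 by simp
  define p where "p = Complex (- 1) tau"
  define u0 where "u0 = p \<cdot>\<^sub>v v + q"
  have u0V: "u0 \<in> V" using vV q by (simp add: u0_def)
  have u0E: "u0 \<in> perp E" unfolding u0_def by (intro perp_add perp_smult E_facts(1) v(1) qE)
  have uu: "Re (h u0 u0) < 0" unfolding u0_def using vV q v(3) qv by (simp add: p_def)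
  have fu: "f *\<^sub>v u0 = (rho * p) \<cdot>\<^sub>v v + (1 / cnj rho) \<cdot>\<^sub>v q"
    unfolding f(3)[OF u0E] S[OF u0V] unfolding u0_def using vV q v(3) qv by simp
  have "h (f *\<^sub>v u0) u0 = rho * p + cnj p / cnj rho"
    unfolding fu unfolding u0_def using vV q v(3) qv by simp
  also have "cnj p / cnj rho = cnj p * rho / complex_of_real R2"
  proof -
    have "complex_of_real R2 = rho * cnj rho" unfolding R2_def by (simp add: complex_eq_iff)
    then show ?thesis using rho0 by simp
  qed
  finally have "Im (h (f *\<^sub>v u0) u0) = (- Im rho + tau * Re rho) + (- Im rho - tau * Re rho) / R2"
    by (simp add: p_def algebra_simps)
  also have "\<dots> = (tau * (Re rho * (R2 - 1)) - Im rho * (R2 + 1)) / R2"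
    using R2 by (simp add: field_simps)
  also have "\<dots> = 0" using tau by simp
  finally have im: "Im (h (f *\<^sub>v u0) u0) = 0" .
  obtain A u z where ch: "chain f A (1\<^sub>m m) u z E"
    by (rule head_negative_vector[OF f(1) E _ card u0E uu im]) (use f(4) in auto)
  show ?thesis by (rule chain_from_root[OF c(1,2,4) f(2) ch])
qed

end

section \<open>Parabolic isometries\<close>

text \<open>The remaining case: an eigenvector \<open>v\<close> in \<open>W\<close> that is null, with an eigenvalue on the unit circle.\<close>

locale parabolic_eigenframe = eigenframe +
  fixes v :: "complex vec" and l :: complex
  assumes v: "v \<in> perp E" "v \<noteq> 0\<^sub>v m" "h v v = 0" "g *\<^sub>v v = l \<cdot>\<^sub>v v" and l: "cmod l = 1"
begin

lemma vV [simp]: "v \<in> V" using v by (simp add: perp_def)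

lemma dim_v [simp]: "dim_vec v = m" using vV by (rule carrier_vecD)

lemma l0: "l \<noteq> 0" using l by auto

lemma l_unit: "l * cnj l = 1" using l by (simp add: complex_norm_square[symmetric])

lemmas perp_combination = perp_add[OF E_facts(1)] perp_smult[OF E_facts(1)]

text \<open>By definition \<open>g = l (1 + N)\<close>; on the complement of \<open>E\<close> the matrix \<open>N\<close> will turn out to be nilpotent.\<close>

definition N :: "complex mat" where "N = (1 / l) \<cdot>\<^sub>m g + (- 1) \<cdot>\<^sub>m 1\<^sub>m m"

lemma NM [simp]: "N \<in> M" by (simp add: N_def)

lemma N_apply: "x \<in> V \<Longrightarrow> N *\<^sub>v x = (1 / l) \<cdot>\<^sub>v (g *\<^sub>v x) + (- 1) \<cdot>\<^sub>v x"
  by (simp add: N_def mv_mat_add mv_mat_smult)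

lemma g_eq: assumes "x \<in> V" shows "g *\<^sub>v x = l \<cdot>\<^sub>v (x + N *\<^sub>v x)"
proof -
  obtain y where y: "y \<in> V" "g *\<^sub>v x = y" using assms mv_carrier[OF gM] by blast
  show ?thesis unfolding N_apply[OF assms] y(2) using assms l0 y(1)
    by (intro eq_vecI) (auto simp: algebra_simps)
qed

lemma N_from_g:
  assumes "x \<in> V" "y \<in> V" "g *\<^sub>v x = l \<cdot>\<^sub>v x + b \<cdot>\<^sub>v y"
  shows "N *\<^sub>v x = (b / l) \<cdot>\<^sub>v y"
  unfolding N_apply[OF assms(1)] assms(3) using assms l0
  by (intro eq_vecI) (auto simp: algebra_simps)

lemma N_v [simp]: "N *\<^sub>v v = 0\<^sub>v m"
  using N_from_g[of v v 0] v by simp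

lemma N_perp: "x \<in> perp E \<Longrightarrow> N *\<^sub>v x \<in> perp E"
  using perp_combination g_perp by (simp add: N_apply perpD(1))

text \<open>\<open>1 + N\<close> is an isometry.\<close>

lemma N_skew:
  assumes x: "x \<in> V" and y: "y \<in> V"
  shows "h (N *\<^sub>v x) y + h x (N *\<^sub>v y) + h (N *\<^sub>v x) (N *\<^sub>v y) = 0"
proof -
  have "h x y = h (g *\<^sub>v x) (g *\<^sub>v y)" by (rule isometry_h[OF g x y, symmetric])
  also have "\<dots> = (l * cnj l) * (h x y + h x (N *\<^sub>v y) + (h (N *\<^sub>v x) y + h (N *\<^sub>v x) (N *\<^sub>v y)))"
    unfolding g_eq[OF x] g_eq[OF y] using x y by (simp add: algebra_simps)
  finally show ?thesis using l_unit by (simp add: add.assoc add.left_commute)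
qed

lemma N_orth_v: "x \<in> V \<Longrightarrow> h (N *\<^sub>v x) v = 0"
  using N_skew[of x v] by simp

lemma negative_not_orth:
  assumes "x \<in> V" "Re (h x x) < 0" shows "h x v \<noteq> 0"
  using positive_if_orth_negative[OF assms vV] h_orth_sym[of x v] assms v by auto

lemma collinear_or_positive:
  assumes "x \<in> V" "h x v = 0" shows "(\<exists>k. x = k \<cdot>\<^sub>v v) \<or> Re (h x x) > 0"
  using null_not_orth[OF vV assms(1) v(2,3)] h_orth_sym[of x v] assms by force

text \<open>For \<open>N ^ 3 = 0\<close> the binomial series of the square root of \<open>1 + N\<close> stops after three terms.  That it is again an isometry
follows by applying \<open>N_skew\<close> to the pairs \<open>(N ^ i x, N ^ j x')\<close>.\<close>

lemma unipotent_root: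
  assumes nil: "\<And>x. x \<in> perp E \<Longrightarrow> N *\<^sub>v (N *\<^sub>v (N *\<^sub>v x)) = 0\<^sub>v m"
    and c: "cmod c = 1" and om: "om * om = c * l"
  obtains f where "isometry f" "f * f = c \<cdot>\<^sub>m g"
    "\<And>x. x \<in> perp E \<Longrightarrow> f *\<^sub>v x = om \<cdot>\<^sub>v (x + (1/2) \<cdot>\<^sub>v (N *\<^sub>v x) + (- 1/8) \<cdot>\<^sub>v (N *\<^sub>v (N *\<^sub>v x)))"
    "\<And>e. e \<in> E \<Longrightarrow> \<exists>a. f *\<^sub>v e = a \<cdot>\<^sub>v e"
proof -
  let ?S = "om \<cdot>\<^sub>m (1\<^sub>m m + (1/2) \<cdot>\<^sub>m N + (- 1/8) \<cdot>\<^sub>m (N * N))"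
  have NN: "N * N \<in> M" by (rule mult_carrier_mat[OF NM NM])
  have SM: "?S \<in> M" using NN by simp
  have S: "?S *\<^sub>v x = om \<cdot>\<^sub>v (x + (1/2) \<cdot>\<^sub>v (N *\<^sub>v x) + (- 1/8) \<cdot>\<^sub>v (N *\<^sub>v (N *\<^sub>v x)))" if "x \<in> V" for x
    using that NN by (simp add: mv_mat_add mv_mat_smult)
  have "(cmod om)\<^sup>2 = 1" using om c l by (metis norm_mult mult_1 power2_eq_square)
  then have omn: "om * cnj om = 1" by (metis complex_norm_square of_real_1)
  obtain f where f: "isometry f" "f * f = c \<cdot>\<^sub>m g" "\<And>x. x \<in> perp E \<Longrightarrow> f *\<^sub>v x = ?S *\<^sub>v x"
    "\<And>e. e \<in> E \<Longrightarrow> f *\<^sub>v e = csqrt (c * mu e) \<cdot>\<^sub>v e"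
  proof (rule square_root_isometry[OF g E c eig, of "\<lambda>e. csqrt (c * mu e)" ?S])
    fix x assume x: "x \<in> perp E"
    have xV: "x \<in> V" using x by (simp add: perp_def)
    show "?S *\<^sub>v x \<in> perp E" unfolding S[OF xV] using x by (intro perp_combination N_perp)
    define y where "y = N *\<^sub>v x"
    define w where "w = N *\<^sub>v y"
    have V: "y \<in> V" "w \<in> V" using xV by (auto simp: y_def w_def)
    have Nw: "N *\<^sub>v w = 0\<^sub>v m" using nil[OF x] by (simp add: w_def y_def)
    have Sx: "?S *\<^sub>v x = om \<cdot>\<^sub>v (x + (1/2) \<cdot>\<^sub>v y + (- 1/8) \<cdot>\<^sub>v w)" using S[OF xV] by (simp add: y_def w_def)
    have Sy: "?S *\<^sub>v y = om \<cdot>\<^sub>v (y + (1/2) \<cdot>\<^sub>v w)" using S[OF V(1)] Nw V by (simp flip: w_def)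
    have Sw: "?S *\<^sub>v w = om \<cdot>\<^sub>v w" using S[OF V(2)] Nw V by simp
    have "?S *\<^sub>v (?S *\<^sub>v x) = om \<cdot>\<^sub>v (?S *\<^sub>v x + (1/2) \<cdot>\<^sub>v (?S *\<^sub>v y) + (- 1/8) \<cdot>\<^sub>v (?S *\<^sub>v w))"
      by (subst Sx) (simp only: mv_smult[OF SM] mv_combination[OF SM xV V] add_carrier_vec smult_carrier_vec xV V)
    also have "\<dots> = (om * om) \<cdot>\<^sub>v (x + y)"
      unfolding Sx Sy Sw using xV V by (intro eq_vecI) (auto simp: algebra_simps)
    also have "\<dots> = c \<cdot>\<^sub>v (g *\<^sub>v x)" unfolding om g_eq[OF xV] using xV V by (simp add: y_def smult_smult_assoc)
    finally show "?S *\<^sub>v (?S *\<^sub>v x) = c \<cdot>\<^sub>v (g *\<^sub>v x)" .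
    fix x' assume x': "x' \<in> perp E"
    have xV': "x' \<in> V" using x' by (simp add: perp_def)
    define y' where "y' = N *\<^sub>v x'"
    define w' where "w' = N *\<^sub>v y'"
    have V': "y' \<in> V" "w' \<in> V" using xV' by (auto simp: y'_def w'_def)
    have Nw': "N *\<^sub>v w' = 0\<^sub>v m" using nil[OF x'] by (simp add: w'_def y'_def)
    have Sx': "?S *\<^sub>v x' = om \<cdot>\<^sub>v (x' + (1/2) \<cdot>\<^sub>v y' + (- 1/8) \<cdot>\<^sub>v w')" using S[OF xV'] by (simp add: y'_def w'_def)
    \<comment> \<open>relations among the products of N ^ i x and N ^ j x', from the highest powers downwards\<close>
  have r22: "h w w' = 0" using N_skew[OF V(2) V'(1)] V' V Nw by (simp flip: w'_def)
    have r21: "h w y' = 0" using N_skew[OF V(2) xV'] V' V xV' Nw by (simp flip: y'_def) 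
    have r12: "h y w' = 0" using N_skew[OF xV V'(2)] V' V xV Nw' by (simp flip: y_def)
    have r20: "h w x' + h y y' = 0" using N_skew[OF V(1) xV'] r21 by (simp flip: y'_def w_def)
    have r02: "h x w' + h y y' = 0" using N_skew[OF xV V'(1)] r12 by (simp add: add.commute flip: y_def w'_def)
    have r00: "h y x' + h x y' + h y y' = 0" using N_skew[OF xV xV'] by (simp flip: y_def y'_def)
    have "h (?S *\<^sub>v x) (?S *\<^sub>v x') = (om * cnj om) * (h x x' + (h y x' + h x y' + h y y') / 2
        - (h w x' + h y y') / 8 - (h x w' + h y y') / 8)"
      unfolding Sx Sx' using xV xV' V V' r22 r21 r12 by (simp add: field_simps)
    then show "h (?S *\<^sub>v x) (?S *\<^sub>v x') = h x x'" unfolding omn r20 r02 r00 by simp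
  qed (use power2_csqrt SM in auto)
  show ?thesis
  proof (rule that[OF f(1,2)])
    fix x assume x: "x \<in> perp E"
    then show "f *\<^sub>v x = om \<cdot>\<^sub>v (x + (1/2) \<cdot>\<^sub>v (N *\<^sub>v x) + (- 1/8) \<cdot>\<^sub>v (N *\<^sub>v (N *\<^sub>v x)))"
      using f(3)[OF x] S[OF perpD(1)[OF x]] by simp
  qed (use f(4) in blast)
qed

lemma coordinate:
  assumes "x0 \<in> perp E" "h x0 v \<noteq> 0" "x \<in> perp E"
  obtains k y where "y \<in> perp E" "h y v = 0" "x = y + k \<cdot>\<^sub>v x0"
proof (rule that)
  let ?k = "h x v / h x0 v"
  have V: "x \<in> V" "x0 \<in> V" using assms by (auto simp: perp_def)
  show "x + (- ?k) \<cdot>\<^sub>v x0 \<in> perp E" using assms by (intro perp_combination)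
  show "h (x + (- ?k) \<cdot>\<^sub>v x0) v = 0" using V assms by simp
  show "x = x + (- ?k) \<cdot>\<^sub>v x0 + ?k \<cdot>\<^sub>v x0" using V by (intro eq_vecI) auto
qed

text \<open>An orthogonal basis \<open>x0\<close>, \<open>y0\<close> of the span of \<open>v\<close> and a negative vector, used only to count dimensions.\<close>

lemma hyperbolic_partner:
  assumes x0: "x0 \<in> V" "Re (h x0 x0) < 0"
  defines "y0 \<equiv> v + (- (h v x0 / h x0 x0)) \<cdot>\<^sub>v x0"
  shows "y0 \<in> V" "h y0 x0 = 0" "h y0 y0 \<noteq> 0" "\<And>x. x \<in> V \<Longrightarrow> h x x0 = 0 \<Longrightarrow> h x y0 = 0 \<Longrightarrow> h x v = 0"
proof -
  have n: "h x0 x0 \<noteq> 0" using x0 by auto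
  show y0V: "y0 \<in> V" using x0 by (simp add: y0_def)
  show o: "h y0 x0 = 0" using x0 n by (simp add: y0_def)
  have "h x0 v \<noteq> 0" using negative_not_orth x0 by blast
  then have "h v x0 \<noteq> 0" using h_orth_sym x0 by simp
  moreover have "h y0 y0 = - (h v x0 / h x0 x0) * h x0 v"
  proof -
    have "h x0 y0 = 0" using o h_orth_sym y0V x0 by blast
    then have "h y0 y0 = h v y0" using x0 y0V by (subst (1) y0_def) simp
    also have "\<dots> = - cnj (h v x0 / h x0 x0) * h v x0" unfolding y0_def using x0 v by simp
    also have "\<dots> = - (h v x0 / h x0 x0) * h x0 v"
      using h_commute[OF vV x0(1)] h_commute[OF x0(1) x0(1)] by simp
    finally show ?thesis .
  qed
  ultimately show "h y0 y0 \<noteq> 0" using n \<open>h x0 v \<noteq> 0\<close> by simp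
  fix x assume x: "x \<in> V" "h x x0 = 0" "h x y0 = 0"
  then show "h x v = 0" using x0 by (simp add: y0_def)
qed

text \<open>\<open>W\<close> is spanned by \<open>v\<close> and a negative vector \<open>x0\<close>, and \<open>N x0 = b v\<close>, where \<open>b * h v x0 = \<i> s\<close> with a nonzero real \<open>s\<close>.
For \<open>u0 = x0 + k v\<close> of norm \<open>- eta\<close> the product \<open>h (f u0) u0\<close> is \<open>om (- eta + \<i> s / 2)\<close>.  It is real for a positive \<open>eta\<close>
exactly if \<open>s\<close>, \<open>Re om\<close> and \<open>Im om\<close> have a positive product, that is, if \<open>s * Im (c * l) > 0\<close>.\<close>

lemma triple_square_two_step:
  assumes col: "\<And>x. x \<in> perp E \<Longrightarrow> h x v = 0 \<Longrightarrow> \<exists>k. x = k \<cdot>\<^sub>v v"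
  shows "triple_square g"
proof -
  obtain x0 where x0: "x0 \<in> perp E" "Re (h x0 x0) < 0" using perp_contains_negative[OF E] by blast
  have xV: "x0 \<in> V" using x0 by (simp add: perp_def)
  have xx: "h x0 x0 \<noteq> 0" using x0 by auto
  have chi: "h x0 v \<noteq> 0" "h v x0 \<noteq> 0" using negative_not_orth[OF xV x0(2)] h_orth_sym xV by auto
  obtain b where b: "N *\<^sub>v x0 = b \<cdot>\<^sub>v v" using col[OF N_perp[OF x0(1)] N_orth_v[OF xV]] by blast
  have NN: "N *\<^sub>v (N *\<^sub>v x) = 0\<^sub>v m" if x: "x \<in> perp E" for x
  proof -
    obtain k y where y: "y \<in> perp E" "h y v = 0" "x = y + k \<cdot>\<^sub>v x0" using coordinate[OF x0(1) chi(1) x] by blast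
    obtain d where d: "y = d \<cdot>\<^sub>v v" using col y by blast
    show ?thesis unfolding y(3) d using xV b by simp
  qed
  have card: "card E + 2 = m"
  proof -
    let ?y0 = "v + (- (h v x0 / h x0 x0)) \<cdot>\<^sub>v x0"
    note part = hyperbolic_partner[OF xV x0(2)]
    note E1 = orthogonal_insert[OF E_facts(5) x0(1) xx]
    have y0E: "?y0 \<in> perp E" by (intro perp_combination v(1) x0(1))
    have y0E1: "?y0 \<in> perp (insert x0 E)" using y0E part(2) unfolding perp_def by blast
    note E2 = orthogonal_insert[OF E1(1) y0E1 part(3)]
    have "card (insert ?y0 (insert x0 E)) = m"
    proof (rule card_complete[OF E2(1)])
      fix x assume x: "x \<in> perp (insert ?y0 (insert x0 E))"
      then have x': "x \<in> V" "x \<in> perp E" "h x x0 = 0" "h x ?y0 = 0" by (auto simp: perp_def)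
      then obtain k where "x = k \<cdot>\<^sub>v v" using part(4) col by blast
      then show "x = 0\<^sub>v m" using x'(3) chi xV by simp
    qed
    then show ?thesis using E1(2) E2(2) E_facts(2) by simp
  qed
  define s where "s = Im (b * h v x0)"
  have bs: "b * h v x0 = \<i> * complex_of_real s"
  proof -
    have "h (N *\<^sub>v x0) x0 + cnj (h (N *\<^sub>v x0) x0) = 0"
      using N_skew[OF xV xV] h_commute[OF vV xV] xV v b by simp
    then have "Re (b * h v x0) = 0" unfolding b using xV by (simp add: complex_eq_iff)
    then show ?thesis by (simp add: s_def complex_eq_iff)
  qed
  have s0: "s \<noteq> 0"
  proof
    assume "s = 0"
    then have b0: "b = 0" using bs chi by simp
    \<comment> \<open>large enough for x0 + (r / h v x0) v to be positive\<close>
    define r where "r = 1 - Re (h x0 x0)"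
    let ?u = "x0 + (r / h v x0) \<cdot>\<^sub>v v"
    have uV: "?u \<in> V" using xV by simp
    have "?u \<in> perp E" by (intro perp_combination v(1) x0(1))
    moreover have "g *\<^sub>v ?u = l \<cdot>\<^sub>v ?u" using g_eq[OF uV] xV b b0 by simp
    ultimately have "Re (h ?u ?u) \<le> 0" by (rule maximal)
    moreover have "h ?u ?u = h x0 x0 + (r / h v x0) * h v x0 + cnj ((r / h v x0) * h v x0)"
      using xV v h_commute[OF vV xV] by (simp add: algebra_simps)
    then have "Re (h ?u ?u) = Re (h x0 x0) + 2 * r" using chi by simp
    ultimately show False using x0(2) by (simp add: r_def)
  qed
  have nil: "N *\<^sub>v (N *\<^sub>v (N *\<^sub>v x)) = 0\<^sub>v m" if "x \<in> perp E" for x using NN[OF that] by simp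
  have "- \<i> * complex_of_real s * l \<noteq> 0" using s0 l0 by simp
  then obtain c where c: "cmod c = 1" "c ^ m = 1 / det g" "Re (c * (- \<i> * complex_of_real s * l)) > 0" "det g \<noteq> 0"
    using good_scalar[OF g three_le] by blast
  have "Re (c * (- \<i> * complex_of_real s * l)) = s * Im (c * l)" by (simp add: algebra_simps)
  then have sc: "s * Im (c * l) > 0" using c(3) by simp
  define om where "om = csqrt (c * l)"
  have om2: "om * om = c * l" unfolding om_def by (metis power2_csqrt power2_eq_square)
  then have "Im (c * l) = 2 * (Re om * Im om)" by (metis Im_power2 mult.assoc power2_eq_square)
  then have "s * Im (c * l) = 2 * (s * (Re om * Im om))" by simp
  then have pos: "s * (Re om * Im om) > 0" using sc by linarith
  then have im0: "Im om \<noteq> 0" by auto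
  obtain f where f: "isometry f" "f * f = c \<cdot>\<^sub>m g"
    "\<And>x. x \<in> perp E \<Longrightarrow> f *\<^sub>v x = om \<cdot>\<^sub>v (x + (1/2) \<cdot>\<^sub>v (N *\<^sub>v x) + (- 1/8) \<cdot>\<^sub>v (N *\<^sub>v (N *\<^sub>v x)))"
    "\<And>e. e \<in> E \<Longrightarrow> \<exists>a. f *\<^sub>v e = a \<cdot>\<^sub>v e"
    using unipotent_root[OF nil c(1) om2] by blast
  \<comment> \<open>the value at which the imaginary part of om * (- eta + \<i> * s / 2) vanishes\<close>
  define eta where "eta = s * Re om / (2 * Im om)"
  have eta: "eta > 0"
  proof -
    have e: "eta * (2 * (Im om * Im om)) = s * (Re om * Im om)" using im0 by (simp add: eta_def)
    have "0 < eta * (2 * (Im om * Im om))" unfolding e by (rule pos)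
    moreover have "0 < 2 * (Im om * Im om)" using im0 by (metis mult_pos_pos not_real_square_gt_zero zero_less_numeral)
    ultimately show ?thesis by (rule zero_less_mult_pos2)
  qed
  have eta2: "eta * Im om = s / 2 * Re om" using im0 by (simp add: eta_def)
  define r where "r = (- eta - Re (h x0 x0)) / 2"
  define k where "k = complex_of_real r / h v x0"
  define u0 where "u0 = x0 + k \<cdot>\<^sub>v v"
  have u0V: "u0 \<in> V" using xV by (simp add: u0_def)
  have u0E: "u0 \<in> perp E" unfolding u0_def by (intro perp_combination v(1) x0(1))
  have "h u0 u0 = h x0 x0 + k * h v x0 + cnj (k * h v x0)"
    unfolding u0_def using xV v h_commute[OF vV xV] by (simp add: algebra_simps)
  also have "\<dots> = complex_of_real (Re (h x0 x0)) + complex_of_real (2 * r)"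
    unfolding k_def using chi h_self_real[OF xV] by simp
  also have "\<dots> = complex_of_real (Re (h x0 x0) + 2 * r)" by simp
  also have "Re (h x0 x0) + 2 * r = - eta" by (simp add: r_def field_simps)
  finally have huu: "h u0 u0 = complex_of_real (- eta)" .
  then have uu: "Re (h u0 u0) < 0" using eta by simp
  have Nu: "N *\<^sub>v u0 = b \<cdot>\<^sub>v v" unfolding u0_def using xV b by simp
  have hNu: "h (N *\<^sub>v u0) u0 = \<i> * complex_of_real s" unfolding Nu bs[symmetric] unfolding u0_def using xV v by simp
  have "f *\<^sub>v u0 = om \<cdot>\<^sub>v (u0 + (1/2) \<cdot>\<^sub>v (N *\<^sub>v u0))" using f(3)[OF u0E] NN[OF u0E] u0V by simp
  then have "h (f *\<^sub>v u0) u0 = om * (complex_of_real (- eta) + (1/2) * (\<i> * complex_of_real s))"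
    using u0V by (simp add: hNu huu)
  then have im: "Im (h (f *\<^sub>v u0) u0) = 0" using eta2 by (simp add: mult.commute)
  obtain A u z where ch: "chain f A (1\<^sub>m m) u z E"
    by (rule head_negative_vector[OF f(1) E _ card u0E uu im]) (use f(4) in auto)
  show ?thesis by (rule chain_from_root[OF c(1,2,4) f(2) ch])
qed

end

context parabolic_eigenframe
begin

text \<open>Otherwise a multiple of \<open>v\<close> could be added to \<open>y\<close> to obtain an eigenvector, and it would be positive like \<open>y\<close>.\<close>

lemma quotient_eigenvector:
  assumes y: "y \<in> perp E" "h y v = 0" "\<And>k. y \<noteq> k \<cdot>\<^sub>v v" and gy: "g *\<^sub>v y = a \<cdot>\<^sub>v y + b \<cdot>\<^sub>v v"
  shows "a = l" "b \<noteq> 0"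
proof -
  have yV: "y \<in> V" using y by (simp add: perp_def)
  have pos: "Re (h y y) > 0" using collinear_or_positive[OF yV y(2)] y(3) by blast
  have vy: "h v y = 0" using y(2) yV h_orth_sym by simp
  have no: "\<not> g *\<^sub>v (y + k \<cdot>\<^sub>v v) = a \<cdot>\<^sub>v (y + k \<cdot>\<^sub>v v)" for k
  proof
    assume "g *\<^sub>v (y + k \<cdot>\<^sub>v v) = a \<cdot>\<^sub>v (y + k \<cdot>\<^sub>v v)"
    moreover have "y + k \<cdot>\<^sub>v v \<in> perp E" by (intro perp_combination y v)
    ultimately have "Re (h (y + k \<cdot>\<^sub>v v) (y + k \<cdot>\<^sub>v v)) \<le> 0" using maximal by blast
    then show False using pos yV y(2) vy v by simp
  qed
  have gk: "g *\<^sub>v (y + k \<cdot>\<^sub>v v) = a \<cdot>\<^sub>v y + (b + k * l) \<cdot>\<^sub>v v" for k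
    using gy yV v(4) by (simp add: smult_smult_assoc assoc_add_vec[of _ m] add_smult_distrib_vec)
  show al: "a = l"
  proof (rule ccontr)
    assume n: "a \<noteq> l"
    let ?k = "b / (a - l)"
    have "b + ?k * l = a * ?k" using n by (simp add: field_simps)
    then have "g *\<^sub>v (y + ?k \<cdot>\<^sub>v v) = a \<cdot>\<^sub>v (y + ?k \<cdot>\<^sub>v v)"
      unfolding gk using yV by (simp add: smult_add_distrib_vec[of _ m] smult_smult_assoc)
    then show False using no by blast
  qed
  show "b \<noteq> 0"
  proof
    assume "b = 0"
    then show False using no[of 0] gk[of 0] yV by simp
  qed
qed

text \<open>Now \<open>W\<close> is spanned by \<open>v\<close>, a positive \<open>w\<close> with \<open>N w = v\<close>, and a negative \<open>x0\<close> orthogonal to \<open>w\<close>: anything more would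
give a positive eigenvector.  In \<open>p = x0 + ka w + ta v\<close> the coefficient \<open>ta\<close> makes \<open>p\<close> null, and \<open>ka\<close> moves the
imaginary part of \<open>h (N p) p\<close> freely while its real part is \<open>- C / 2\<close> and \<open>h (N (N p)) p = - C\<close> for a constant
\<open>C > 0\<close>.  Hence \<open>h (f p) p\<close> can be made real and nonzero as soon as \<open>om\<close> is not purely imaginary.\<close>

lemma triple_square_three_step:
  assumes ncol: "y1 \<in> perp E" "h y1 v = 0" "\<And>k. y1 \<noteq> k \<cdot>\<^sub>v v"
  shows "triple_square g"
proof -
  let ?W = "{x \<in> perp E. h x v = 0}"
  have WV: "?W \<subseteq> V" by (auto simp: perp_def)
  have W: "\<And>y z. y \<in> ?W \<Longrightarrow> z \<in> ?W \<Longrightarrow> y + z \<in> ?W" "\<And>a y. y \<in> ?W \<Longrightarrow> a \<cdot>\<^sub>v y \<in> ?W"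
    using perp_combination by (auto simp: perpD(1))
  have Wg: "\<And>y. y \<in> ?W \<Longrightarrow> g *\<^sub>v y \<in> ?W"
    using g_perp isometry_preserves_orth[OF g vV v(4) l0] by (auto simp: perpD(1))
  let ?Z = "{k \<cdot>\<^sub>v v | k. True}"
  have Z0: "0\<^sub>v m \<in> ?Z" using smult_zero_vec[OF vV] by (metis (mono_tags, lifting) mem_Collect_eq)
  have Z1: "\<And>a y. y \<in> ?Z \<Longrightarrow> a \<cdot>\<^sub>v y \<in> ?Z" by (auto simp: smult_smult_assoc)
  obtain y a where y: "y \<in> ?W" "y \<notin> ?Z" "g *\<^sub>v y + (- a) \<cdot>\<^sub>v y \<in> ?Z"
    by (rule eigenvector_modulo_subspace[of g ?W ?Z y1, OF gM WV W Wg Z0 Z1]) (use ncol in auto)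
  then obtain b where "g *\<^sub>v y + (- a) \<cdot>\<^sub>v y = b \<cdot>\<^sub>v v" by blast
  have yV: "y \<in> V" "h y v = 0" "y \<in> perp E" "\<And>k. y \<noteq> k \<cdot>\<^sub>v v" using y by (auto simp: perp_def)
  have split: "g *\<^sub>v x = a \<cdot>\<^sub>v x + z" if "g *\<^sub>v x + (- a) \<cdot>\<^sub>v x = z" "x \<in> V" for x z a
  proof -
    have "g *\<^sub>v x \<in> V" using that(2) by simp
    then obtain w where w: "w \<in> V" "g *\<^sub>v x = w" by blast
    show ?thesis unfolding that(1)[symmetric] w(2) using w(1) that(2) by (intro eq_vecI) auto
  qed
  have gy: "g *\<^sub>v y = a \<cdot>\<^sub>v y + b \<cdot>\<^sub>v v" using split[OF \<open>_ = b \<cdot>\<^sub>v v\<close>] yV by simp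
  have al: "a = l" "b \<noteq> 0" using quotient_eigenvector[OF yV(3,2,4) gy] by auto
  define w where "w = (l / b) \<cdot>\<^sub>v y"
  have w: "w \<in> V" "h w v = 0" "w \<in> perp E" using yV perp_combination by (auto simp: w_def)
  have vw: "h v w = 0" using w h_orth_sym by simp
  have Nw: "N *\<^sub>v w = v"
    using N_from_g[OF yV(1) vV gy[unfolded al(1)]] al(2) l0 yV(1) by (simp add: w_def smult_smult_assoc)
  have wk: "w \<noteq> k \<cdot>\<^sub>v v" for k
  proof
    assume "w = k \<cdot>\<^sub>v v"
    then have "N *\<^sub>v w = 0\<^sub>v m" by simp
    then show False using Nw v(2) by simp
  qed
  have "Re (h w w) > 0" using collinear_or_positive[OF w(1,2)] wk by blast
  define q where "q = Re (h w w)"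
  have q: "q > 0" "h w w = complex_of_real q" using \<open>Re (h w w) > 0\<close> h_self_real[OF w(1)] by (auto simp: q_def)
  have gw: "g *\<^sub>v w = l \<cdot>\<^sub>v w + l \<cdot>\<^sub>v v" using g_eq[OF w(1)] Nw w by (simp add: smult_add_distrib_vec[of _ m])
  have W_span: "\<exists>c d. x = c \<cdot>\<^sub>v w + d \<cdot>\<^sub>v v" if x: "x \<in> perp E" "h x v = 0" for x
  proof (rule ccontr)
    let ?Y = "{c \<cdot>\<^sub>v w + d \<cdot>\<^sub>v v | c d. True}"
    assume "\<not> ?thesis"
    then have xn: "x \<notin> ?Y" by blast
    have "0 \<cdot>\<^sub>v w + 0 \<cdot>\<^sub>v v = 0\<^sub>v m" using w by simp
    then have Y0: "0\<^sub>v m \<in> ?Y" by (metis (mono_tags, lifting) mem_Collect_eq)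
    have Y1: "k \<cdot>\<^sub>v x \<in> ?Y" if xY: "x \<in> ?Y" for k x
    proof -
      obtain c d where "x = c \<cdot>\<^sub>v w + d \<cdot>\<^sub>v v" using xY by blast
      then have "k \<cdot>\<^sub>v x = (k * c) \<cdot>\<^sub>v w + (k * d) \<cdot>\<^sub>v v" using w by (simp add: smult_add_distrib_vec[of _ m] smult_smult_assoc)
      then show ?thesis by blast
    qed
    obtain x1 a where x1: "x1 \<in> ?W" "x1 \<notin> ?Y" "g *\<^sub>v x1 + (- a) \<cdot>\<^sub>v x1 \<in> ?Y"
      by (rule eigenvector_modulo_subspace[of g ?W ?Y x, OF gM WV W Wg Y0 Y1 _ xn]) (use x in auto)
    have x1V: "x1 \<in> V" "x1 \<in> perp E" "h x1 v = 0" using x1 by (auto simp: perp_def)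
    obtain c d where cd: "g *\<^sub>v x1 + (- a) \<cdot>\<^sub>v x1 = c \<cdot>\<^sub>v w + d \<cdot>\<^sub>v v" using x1(3) by blast
    have gx1: "g *\<^sub>v x1 = a \<cdot>\<^sub>v x1 + (c \<cdot>\<^sub>v w + d \<cdot>\<^sub>v v)" by (rule split[OF cd x1V(1)])
    define k where "k = h x1 w / h w w"
    define x2 where "x2 = x1 + (- k) \<cdot>\<^sub>v w"
    have x2: "x2 \<in> V" "x2 \<in> perp E" "h x2 v = 0" "h x2 w = 0"
      using x1V w perp_combination q by (auto simp: x2_def k_def)
    have x2Y: "x2 \<noteq> c \<cdot>\<^sub>v w + d \<cdot>\<^sub>v v" for c d
    proof
      assume e: "x2 = c \<cdot>\<^sub>v w + d \<cdot>\<^sub>v v"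
      have "x1 = x2 + k \<cdot>\<^sub>v w" unfolding x2_def using x1V w by (intro eq_vecI) auto
      also have "\<dots> = (c + k) \<cdot>\<^sub>v w + d \<cdot>\<^sub>v v" unfolding e using w vV by (intro eq_vecI) (auto simp: algebra_simps)
      finally show False using x1(2) by blast
    qed
    let ?c = "c + a * k - k * l" and ?d = "d - k * l"
    have "g *\<^sub>v x2 = g *\<^sub>v x1 + (- k) \<cdot>\<^sub>v (g *\<^sub>v w)" unfolding x2_def using x1V w by simp
    also have "\<dots> = a \<cdot>\<^sub>v x2 + ?c \<cdot>\<^sub>v w + ?d \<cdot>\<^sub>v v"
      unfolding gx1 gw x2_def using x1V w vV by (intro eq_vecI) (auto simp: algebra_simps)
    finally have gx2: "g *\<^sub>v x2 = a \<cdot>\<^sub>v x2 + ?c \<cdot>\<^sub>v w + ?d \<cdot>\<^sub>v v" .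
    have "h (g *\<^sub>v x2) (g *\<^sub>v w) = 0" using isometry_h[OF g x2(1) w(1)] x2 by simp
    then have "cnj l * (?c * h w w) = 0"
      unfolding gx2 gw using x2 w vw v by simp
    then have c0: "?c = 0" using l0 q by simp
    have gx2': "g *\<^sub>v x2 = a \<cdot>\<^sub>v x2 + ?d \<cdot>\<^sub>v v" using gx2 c0 x2 w by simp
    have x2v: "x2 \<noteq> k \<cdot>\<^sub>v v" for k
    proof
      assume "x2 = k \<cdot>\<^sub>v v"
      then have "x2 = 0 \<cdot>\<^sub>v w + k \<cdot>\<^sub>v v" using w by simp
      then show False using x2Y by blast
    qed
    have a: "a = l" using quotient_eigenvector[OF x2(2,3) x2v gx2'] by simp
    let ?e = "- (?d / l)"
    \<comment> \<open>N maps x2 and w to multiples of v, and this combination of them to 0\<close>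
    define x3 where "x3 = x2 + ?e \<cdot>\<^sub>v w"
    have x3: "x3 \<in> perp E" "h x3 v = 0" using x2 w perp_combination by (auto simp: x3_def)
    have x3v: "x3 \<noteq> k \<cdot>\<^sub>v v" for k
    proof
      assume e: "x3 = k \<cdot>\<^sub>v v"
      have "x2 = x3 + (- ?e) \<cdot>\<^sub>v w" unfolding x3_def using x2 w by (intro eq_vecI) auto
      also have "\<dots> = (- ?e) \<cdot>\<^sub>v w + k \<cdot>\<^sub>v v" unfolding e using w vV by (intro eq_vecI) auto
      finally show False using x2Y by blast
    qed
    have "g *\<^sub>v x3 = g *\<^sub>v x2 + ?e \<cdot>\<^sub>v (g *\<^sub>v w)" unfolding x3_def using x2 w by simp
    also have "\<dots> = l \<cdot>\<^sub>v x3 + 0 \<cdot>\<^sub>v v"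
      unfolding gx2' gw x3_def a using x2 w vV l0 by (intro eq_vecI) (auto simp: field_simps)
    finally have "g *\<^sub>v x3 = l \<cdot>\<^sub>v x3 + 0 \<cdot>\<^sub>v v" .
    from quotient_eigenvector(2)[OF x3 x3v this] show False by simp
  qed
  obtain b0 where b0: "b0 \<in> perp E" "Re (h b0 b0) < 0" using perp_contains_negative[OF E] by blast
  have b0V: "b0 \<in> V" using b0 by (simp add: perp_def)
  \<comment> \<open>subtracting a positive component keeps b0 negative\<close>
  define x0 where "x0 = b0 + (- (h b0 w / h w w)) \<cdot>\<^sub>v w"
  have x0: "x0 \<in> V" "x0 \<in> perp E" "h x0 w = 0"
    using b0V w q perp_combination b0 by (auto simp: x0_def)
  have "Re (h x0 x0) < 0"
  proof -
    have "h x0 x0 = h x0 b0" using x0 b0V w by (subst (2) x0_def) simp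
    also have "\<dots> = h b0 b0 - h b0 w * cnj (h b0 w) / complex_of_real q"
      unfolding x0_def using b0V w q h_commute[OF b0V w(1)] by simp
    also have "\<dots> = h b0 b0 - complex_of_real ((cmod (h b0 w))\<^sup>2 / q)"
      unfolding complex_norm_square[symmetric] by simp
    finally have "Re (h x0 x0) = Re (h b0 b0) - (cmod (h b0 w))\<^sup>2 / q"
      by (simp only: minus_complex.simps Re_complex_of_real)
    moreover have "(cmod (h b0 w))\<^sup>2 / q \<ge> 0" using q by simp
    ultimately show ?thesis using b0(2) by linarith
  qed
  note x0neg = this
  have xx: "h x0 x0 \<noteq> 0" using x0neg by auto
  have wx0: "h w x0 = 0" using x0 w h_orth_sym by simp
  define chi where "chi = h x0 v"
  have chi: "chi \<noteq> 0" "h v x0 = cnj chi" using negative_not_orth[OF x0(1) x0neg] h_commute[OF x0(1) vV] by (auto simp: chi_def)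
  have card: "card E + 3 = m"
  proof -
    let ?y0 = "v + (- (h v x0 / h x0 x0)) \<cdot>\<^sub>v x0"
    note part = hyperbolic_partner[OF x0(1) x0neg]
    have ww: "h w w \<noteq> 0" using q by simp
    note E0 = orthogonal_insert[OF E_facts(5) w(3) ww]
    have x0E0: "x0 \<in> perp (insert w E)" using x0 unfolding perp_def by blast
    note E1 = orthogonal_insert[OF E0(1) x0E0 xx]
    have y0E: "?y0 \<in> perp E" by (intro perp_combination v(1) x0)
    have "h ?y0 w = 0" using w x0 vw by simp
    then have y0E1: "?y0 \<in> perp (insert x0 (insert w E))" using y0E part(2) unfolding perp_def by blast
    note E2 = orthogonal_insert[OF E1(1) y0E1 part(3)]
    have "card (insert ?y0 (insert x0 (insert w E))) = m"
    proof (rule card_complete[OF E2(1)])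
      fix x assume x: "x \<in> perp (insert ?y0 (insert x0 (insert w E)))"
      then have x': "x \<in> V" "x \<in> perp E" "h x x0 = 0" "h x ?y0 = 0" "h x w = 0" by (auto simp: perp_def)
      then have "h x v = 0" using part(4) by blast
      then obtain c d where cd: "x = c \<cdot>\<^sub>v w + d \<cdot>\<^sub>v v" using W_span x' by blast
      have "c = 0" using x'(5) unfolding cd using w vw q by simp
      moreover have "d = 0" using x'(3) unfolding cd using w x0 wx0 chi by simp
      ultimately show "x = 0\<^sub>v m" unfolding cd using w by simp
    qed
    then show ?thesis using E0(2) E1(2) E2(2) E_facts(2) by simp
  qed
  obtain ga de where Nx0: "N *\<^sub>v x0 = ga \<cdot>\<^sub>v w + de \<cdot>\<^sub>v v"
    using W_span[OF N_perp[OF x0(2)] N_orth_v[OF x0(1)]] by blast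
  have gq: "ga * complex_of_real q = - chi"
  proof -
    have "h (N *\<^sub>v x0) w + h x0 v + h (N *\<^sub>v x0) v = 0" using N_skew[OF x0(1) w(1)] Nw by simp
    then have "h (N *\<^sub>v x0) w + chi = 0" using N_orth_v[OF x0(1)] by (simp add: chi_def)
    then show ?thesis unfolding Nx0 using w vw q by (simp add: eq_neg_iff_add_eq_0)
  qed
  have nil: "N *\<^sub>v (N *\<^sub>v (N *\<^sub>v x)) = 0\<^sub>v m" if x: "x \<in> perp E" for x
  proof -
    obtain k z where z: "z \<in> perp E" "h z v = 0" "x = z + k \<cdot>\<^sub>v x0"
      using coordinate[OF x0(2) _ x] chi(1) unfolding chi_def by blast
    obtain c d where d: "z = c \<cdot>\<^sub>v w + d \<cdot>\<^sub>v v" using W_span[OF z(1,2)] by blast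
    show ?thesis unfolding z(3) d using x0 w Nw Nx0 by simp
  qed
  obtain c where c: "cmod c = 1" "c ^ m = 1 / det g" "Re (c * l) > 0" "det g \<noteq> 0"
    using good_scalar[OF g three_le l0] by blast
  define om where "om = csqrt (c * l)"
  have om2: "om * om = c * l" unfolding om_def by (metis power2_csqrt power2_eq_square)
  have re0: "Re om \<noteq> 0"
  proof
    assume "Re om = 0"
    then have "Re (om * om) \<le> 0" by simp
    then show False using om2 c(3) by simp
  qed
  obtain f where f: "isometry f" "f * f = c \<cdot>\<^sub>m g"
    "\<And>x. x \<in> perp E \<Longrightarrow> f *\<^sub>v x = om \<cdot>\<^sub>v (x + (1/2) \<cdot>\<^sub>v (N *\<^sub>v x) + (- 1/8) \<cdot>\<^sub>v (N *\<^sub>v (N *\<^sub>v x)))"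
    "\<And>e. e \<in> E \<Longrightarrow> \<exists>a. f *\<^sub>v e = a \<cdot>\<^sub>v e"
    using unipotent_root[OF nil c(1) om2] by blast
  define C where "C = (cmod chi)\<^sup>2 / q"
  have C: "C > 0" using chi q by (simp add: C_def)
  have chichi: "chi * cnj chi = complex_of_real (C * q)"
    using q by (simp add: C_def complex_norm_square[symmetric])
  define s where "s = Im (de * cnj chi)"
  \<comment> \<open>s + 2 * t becomes the imaginary part of h (N p) p; this value makes h (f p) p real\<close>
  define t where "t = (C / 4 * Im om / Re om - s) / 2"
  define ka where "ka = (\<i> * complex_of_real t) * chi / complex_of_real (C * q)"
  have kac: "ka * cnj chi = \<i> * complex_of_real t"
  proof -
    have "ka * cnj chi = (\<i> * complex_of_real t) * (chi * cnj chi) / complex_of_real (C * q)"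
      by (simp add: ka_def)
    then show ?thesis unfolding chichi using C q by simp
  qed
  \<comment> \<open>half of what is needed to cancel the norm of x0 + ka w\<close>
  define r where "r = - (Re (h x0 x0) + (cmod ka)\<^sup>2 * q) / 2"
  define ta where "ta = complex_of_real r / cnj chi"
  have tac: "ta * cnj chi = complex_of_real r" using chi by (simp add: ta_def)
  define p where "p = x0 + ka \<cdot>\<^sub>v w + ta \<cdot>\<^sub>v v"
  have pV: "p \<in> V" using x0 w by (simp add: p_def)
  have pE: "p \<in> perp E" unfolding p_def by (intro perp_combination x0 w v(1))
  have hvp: "h v p = cnj chi" unfolding p_def using x0 w vw v chi by simp
  have hwp: "h w p = cnj ka * complex_of_real q" unfolding p_def using x0 w wx0 q by simp
  have "h p v = chi" using hvp h_commute[OF vV pV] by simp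
  then have p0: "p \<noteq> 0\<^sub>v m" using chi by auto
  have tac': "cnj ta * chi = complex_of_real r" using arg_cong[OF tac, of cnj] by simp
  have "h p p = h x0 x0 + (ka * cnj ka) * complex_of_real q + (ta * cnj chi + cnj ta * chi)"
    unfolding p_def using x0 w wx0 vw v q chi by (simp add: algebra_simps flip: chi_def)
  also have "\<dots> = complex_of_real (Re (h x0 x0)) + complex_of_real ((cmod ka)\<^sup>2) * complex_of_real q + (complex_of_real r + complex_of_real r)"
    unfolding tac tac' complex_norm_square using h_self_real[OF x0(1)] by simp
  also have "\<dots> = complex_of_real (Re (h x0 x0) + (cmod ka)\<^sup>2 * q + 2 * r)" by simp
  also have "Re (h x0 x0) + (cmod ka)\<^sup>2 * q + 2 * r = 0" by (simp add: r_def field_simps)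
  finally have pp: "h p p = 0" by simp
  have Np: "N *\<^sub>v p = ga \<cdot>\<^sub>v w + (de + ka) \<cdot>\<^sub>v v"
  proof -
    have "N *\<^sub>v p = (ga \<cdot>\<^sub>v w + de \<cdot>\<^sub>v v) + ka \<cdot>\<^sub>v v" unfolding p_def using x0 w Nx0 Nw by simp
    also have "\<dots> = ga \<cdot>\<^sub>v w + (de + ka) \<cdot>\<^sub>v v" using w vV by (intro eq_vecI) (auto simp: algebra_simps)
    finally show ?thesis .
  qed
  have NNp: "N *\<^sub>v (N *\<^sub>v p) = ga \<cdot>\<^sub>v v" unfolding Np using w Nw by simp
  have gac: "ga * cnj chi = - complex_of_real C"
  proof -
    have "(ga * cnj chi) * complex_of_real q = - (chi * cnj chi)" using gq by (simp add: mult.assoc mult.commute[of "cnj chi"]) (simp flip: mult.assoc)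
    also have "\<dots> = (- complex_of_real C) * complex_of_real q" unfolding chichi by simp
    finally have "(ga * cnj chi) * complex_of_real q = (- complex_of_real C) * complex_of_real q" .
    moreover have "complex_of_real q \<noteq> 0" using q by simp
    ultimately show ?thesis by (metis mult_right_cancel)
  qed
  have redc: "2 * Re (de * cnj chi) = - C"
  proof -
    have "h (N *\<^sub>v x0) x0 = de * cnj chi" unfolding Nx0 using x0 w wx0 chi by simp
    moreover have "h x0 (N *\<^sub>v x0) = cnj (h (N *\<^sub>v x0) x0)" by (rule h_commute) (use x0 in auto)
    moreover have "h (N *\<^sub>v x0) (N *\<^sub>v x0) = (ga * complex_of_real q) * cnj ga"
      unfolding Nx0 using w vw v q by simp
    moreover have "\<dots> = - cnj (ga * cnj chi)" unfolding gq by simp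
    moreover have "\<dots> = complex_of_real C" unfolding gac by simp
    ultimately have "de * cnj chi + cnj (de * cnj chi) + complex_of_real C = 0"
      using N_skew[OF x0(1) x0(1)] by simp
    moreover have "Re (X + cnj X + complex_of_real C) = 2 * Re X + C" for X by simp
    ultimately have "2 * Re (de * cnj chi) + C = 0" by (metis zero_complex.simps(1))
    then show ?thesis by linarith
  qed
  have decc: "de * cnj chi = Complex (- C / 2) s" using redc by (simp add: s_def complex_eq_iff)
  have "h (N *\<^sub>v p) p = (ga * complex_of_real q) * cnj ka + de * cnj chi + ka * cnj chi"
    unfolding Np using w pV hvp hwp by (simp add: algebra_simps)
  also have "\<dots> = - cnj (ka * cnj chi) + de * cnj chi + ka * cnj chi" unfolding gq by simp
  also have "\<dots> = Complex (- C / 2) (s + 2 * t)" unfolding kac decc by (simp add: complex_eq_iff)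
  finally have hNp: "h (N *\<^sub>v p) p = Complex (- C / 2) (s + 2 * t)" .
  have st: "s + 2 * t = C / 4 * Im om / Re om" by (simp add: t_def field_simps)
  have hNNp: "h (N *\<^sub>v (N *\<^sub>v p)) p = - complex_of_real C" unfolding NNp using pV hvp gac by simp
  have NNV: "N *\<^sub>v (N *\<^sub>v p) \<in> V" using pV by simp
  have "h (f *\<^sub>v p) p = om * (h p p + (1/2) * h (N *\<^sub>v p) p + (- 1/8) * h (N *\<^sub>v (N *\<^sub>v p)) p)"
    unfolding f(3)[OF pE] using pV NNV by simp
  also have "\<dots> = om * Complex (- C / 8) (C / 8 * Im om / Re om)"
    unfolding pp hNp hNNp st by (simp add: complex_eq_iff)
  finally have hf: "h (f *\<^sub>v p) p = om * Complex (- C / 8) (C / 8 * Im om / Re om)" .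
  have im: "Im (h (f *\<^sub>v p) p) = 0" unfolding hf using re0 by (simp add: field_simps)
  have "h (f *\<^sub>v p) p \<noteq> 0"
  proof -
    have "om \<noteq> 0" using re0 by auto
    moreover have "Complex (- C / 8) (C / 8 * Im om / Re om) \<noteq> 0" using C by (simp add: complex_eq_iff)
    ultimately show ?thesis unfolding hf by simp
  qed
  then obtain A Ci u z where ch: "chain f A Ci u z E"
    using head_null_vector[OF f(1) E f(4) card pE p0 pp im] by blast
  show ?thesis by (rule chain_from_root[OF c(1,2,4) f(2) ch])
qed

lemma triple_square_parabolic: "triple_square g"
  using triple_square_two_step triple_square_three_step by blast

end

context lorentz_space
begin

text \<open>Take any eigenvector \<open>v\<close> in the complement of a maximal \<open>E\<close>: it is negative (elliptic) or null, and in the second case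
its eigenvalue decides between parabolic and loxodromic.\<close>

lemma isometry_is_triple_square:
  assumes g: "isometry g" shows "triple_square g"
proof -
  obtain E where frame: "orthonormal E" "\<And>e. e \<in> E \<Longrightarrow> \<exists>a. g *\<^sub>v e = a \<cdot>\<^sub>v e"
    "\<And>x l. x \<in> perp E \<Longrightarrow> g *\<^sub>v x = l \<cdot>\<^sub>v x \<Longrightarrow> Re (h x x) \<le> 0"
    using maximal_positive_eigenvectors[OF g] by blast
  obtain mu where mu: "\<And>e. e \<in> E \<Longrightarrow> g *\<^sub>v e = mu e \<cdot>\<^sub>v e" using frame(2) by metis
  interpret eigenframe m h g E mu by unfold_locales (use g frame mu in blast)+
  obtain b where b: "b \<in> perp E" "Re (h b b) < 0" using perp_contains_negative[OF frame(1)] by blast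
  have EV: "perp E \<subseteq> V" by (auto simp: perp_def)
  have bn: "b \<notin> {0\<^sub>v m}" using b by auto
  obtain v l where v: "v \<in> perp E" "v \<notin> {0\<^sub>v m}" "g *\<^sub>v v + (- l) \<cdot>\<^sub>v v \<in> {0\<^sub>v m}"
    by (rule eigenvector_modulo_subspace[of g "perp E" "{0\<^sub>v m}" b, OF gM EV perp_add[OF E_facts(1)]
          perp_smult[OF E_facts(1)] g_perp _ _ b(1) bn]) auto
  have vV: "v \<in> V" using v by (simp add: perp_def)
  have gv: "g *\<^sub>v v = l \<cdot>\<^sub>v v" by (rule eq_smult_of_diff_zero) (use v vV in auto)
  have "Re (h v v) \<le> 0" by (rule frame(3)[OF v(1) gv])
  then consider "Re (h v v) < 0" | "Re (h v v) = 0" by linarith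
  then show ?thesis
  proof cases
    case 1
    then show ?thesis using triple_square_elliptic[OF v(1) _ gv] by blast
  next
    case 2
    then have vv: "h v v = 0" using h_self_real[OF vV] by simp
    show ?thesis
    proof (cases "cmod l = 1")
      case True
      interpret parabolic_eigenframe m h g E mu v l by unfold_locales (use v vv gv True in auto)
      show ?thesis by (rule triple_square_parabolic)
    next
      case False
      then show ?thesis using triple_square_loxodromic[OF v(1) _ vv gv] v(2) by blast
    qed
  qed
qed

end

section \<open>The projective unitary group\<close>

context hermitian_space
begin

lemma triple_involution_square:
  assumes "triple_square g" "g \<in> M"
  obtains A B C c where "isometry A" "isometry B" "isometry C" "A * A = 1\<^sub>m m" "B * B = 1\<^sub>m m" "C * C = 1\<^sub>m m"
    "cmod c = 1" "(A * B * C) * (A * B * C) = c \<cdot>\<^sub>m g"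
proof -
  obtain c f A C where c: "cmod c = 1" "f * f = c \<cdot>\<^sub>m g" and r: "reversed_by f A C"
    using assms unfolding triple_square_def by blast
  have f: "isometry f" and A: "involution A" and C: "involution C"
    and rev: "\<And>x. x \<in> V \<Longrightarrow> twice_act C A f x = x"
    using r unfolding reversed_by_def by blast+
  have M: "f \<in> M" "A \<in> M" "C \<in> M" using f A C by auto
  define B where "B = A * f * C"
  have B: "isometry B" unfolding B_def using f A C by simp
  have BM: "B \<in> M" using B by simp
  have Bx: "B *\<^sub>v x = A *\<^sub>v (f *\<^sub>v (C *\<^sub>v x))" if "x \<in> V" for x
    unfolding B_def using that M by (simp add: mult_carrier_mat[of _ m m _ m])
  have sq: "A * A = 1\<^sub>m m" "C * C = 1\<^sub>m m"
    by (rule mat_eq_by_action[of _ m]; use A C M in simp)+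
  have "B * B = 1\<^sub>m m"
  proof (rule mat_eq_by_action[of _ m])
    fix x assume x: "x \<in> V"
    have "C *\<^sub>v (B *\<^sub>v (B *\<^sub>v x)) = twice_act C A f (C *\<^sub>v x)"
      using Bx x M BM by simp
    also have "\<dots> = C *\<^sub>v x" using rev x M by simp
    finally have "C *\<^sub>v (C *\<^sub>v (B *\<^sub>v (B *\<^sub>v x))) = C *\<^sub>v (C *\<^sub>v x)" by simp
    then show "(B * B) *\<^sub>v x = 1\<^sub>m m *\<^sub>v x" using C x BM by simp
  qed (use BM in auto)
  moreover have "A * B * C = f"
  proof (rule mat_eq_by_action[of _ m])
    fix x assume x: "x \<in> V"
    then show "(A * B * C) *\<^sub>v x = f *\<^sub>v x"
      using M BM Bx A C by (simp add: mult_carrier_mat[of _ m m _ m])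
  qed (use M BM in auto)
  ultimately show ?thesis using that[of A B C c] A B C sq c by simp
qed

end

text \<open>A reflection; in the projective group it provides a nontrivial involution, which also shows that this group is not trivial.\<close>

lemma (in lorentz_space) nonscalar_involution:
  obtains R where "involution R" "\<And>c. R \<noteq> c \<cdot>\<^sub>m 1\<^sub>m m"
proof -
  obtain b where b: "b \<in> V" "Re (h b b) < 0" using ex_negative by blast
  have bb: "h b b \<noteq> 0" using b by auto
  have "orthogonal {b}" using b bb by (auto simp: orthogonal_def)
  then obtain x where x: "x \<in> perp {b}" "x \<noteq> 0\<^sub>v m"
    using orthogonal_card_lt[of "{b}"] three_le by auto
  have xV: "x \<in> V" "h x b = 0" using x by (auto simp: perp_def)
  have pos: "Re (h x x) > 0" by (rule positive_if_orth_negative[OF b xV x(2)])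
  have "reflection b \<noteq> c \<cdot>\<^sub>m 1\<^sub>m m" for c
  proof
    assume c: "reflection b = c \<cdot>\<^sub>m 1\<^sub>m m"
    have act: "reflection b *\<^sub>v x = c \<cdot>\<^sub>v x" if "x \<in> V" for x unfolding c using that by (simp add: mv_mat_smult)
    have "h (c \<cdot>\<^sub>v b) b = h ((- 1) \<cdot>\<^sub>v b) b" using act[OF b(1)] stretch_self[OF b(1) bb, of "- 1"] by simp
    then have "c * h b b = (- 1) * h b b" using b(1) by simp
    then have c1: "c = - 1" using bb by (metis mult_right_cancel)
    have "h (c \<cdot>\<^sub>v x) x = h x x" using act[OF xV(1)] stretch_orth[OF b(1) xV] by simp
    then have "- h x x = h x x" using c1 xV by simp
    then show False using pos by simp
  qed
  then show ?thesis using that involution_reflection[OF b(1) bb] by blast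
qed

lemma smult_mem_coset:
  assumes "hermitian_form m h" "A \<in> carrier (unitary_group m h)" "cmod c = 1"
  shows "unit_scalars m #>\<^bsub>unitary_group m h\<^esub> (c \<cdot>\<^sub>m A) = unit_scalars m #>\<^bsub>unitary_group m h\<^esub> A"
proof -
  interpret normal "unit_scalars m" "unitary_group m h" by (rule unit_scalars_normal[OF assms(1)])
  obtain t where "c = cis t" using assms(3) by (metis cis_Arg norm_eq_zero sgn_eq div_by_1 of_real_1 zero_neq_one)
  then have "c \<cdot>\<^sub>m 1\<^sub>m m \<in> unit_scalars m" unfolding unit_scalars_def cis_conv_exp by blast
  moreover have "c \<cdot>\<^sub>m A = (c \<cdot>\<^sub>m 1\<^sub>m m) \<otimes>\<^bsub>unitary_group m h\<^esub> A"
    using assms(2) by (auto simp: unitary_group_def)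
  ultimately show ?thesis
    using assms(2) coset_mult_assoc[of "unit_scalars m" "c \<cdot>\<^sub>m 1\<^sub>m m" A] subset rcos_const[of "c \<cdot>\<^sub>m 1\<^sub>m m"]
    by (metis (no_types, lifting) is_subgroup subgroup.mem_carrier subgroup.rcos_const group_axioms is_group)
qed

theorem corollary1p3:
  fixes n :: nat and h :: "complex vec \<Rightarrow> complex vec \<Rightarrow> complex"
  assumes "n \<ge> 2"
    and "hermitian_form (n + 1) h"
    and "nondegenerate_form (n + 1) h"
    and "has_signature (n + 1) h n 1"
  shows "(\<forall>g\<in>carrier (PU n h).
            \<exists>x\<in>carrier (PU n h). \<exists>y\<in>carrier (PU n h). \<exists>I\<in>carrier (PU n h).
              I \<otimes>\<^bsub>PU n h\<^esub> I = \<one>\<^bsub>PU n h\<^esub> \<and> I \<noteq> \<one>\<^bsub>PU n h\<^esub> \<and>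
              g = commutator (PU n h) x y \<and>
              I \<otimes>\<^bsub>PU n h\<^esub> x \<otimes>\<^bsub>PU n h\<^esub> I = inv\<^bsub>PU n h\<^esub> x \<and>
              I \<otimes>\<^bsub>PU n h\<^esub> y \<otimes>\<^bsub>PU n h\<^esub> I = inv\<^bsub>PU n h\<^esub> y)
         \<and> group_commutator_length (PU n h) = 1"
proof -
  let ?m = "n + 1" let ?U = "unitary_group ?m h" let ?S = "unit_scalars ?m" let ?Q = "PU n h"
  interpret hermitian_space ?m h by unfold_locales (use assms in auto)
  interpret lorentz_space ?m h by (rule lorentz_space_if_signature[OF assms(4) refl assms(1)])
  interpret N: normal ?S ?U by (rule unit_scalars_normal[OF assms(2)])
  interpret Q: group ?Q by (rule PU_is_group[OF assms(2)])
  define pr where "pr = (\<lambda>A. ?S #>\<^bsub>?U\<^esub> A)"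
  have pr_hom: "pr \<in> hom ?U ?Q" unfolding pr_def PU_def by (rule N.r_coset_hom_Mod)
  have U: "A \<in> carrier ?U \<longleftrightarrow> isometry A" for A by (rule carrier_unitary_group)
  have pr_carrier: "pr A \<in> carrier ?Q" if "isometry A" for A
    using pr_hom U that by (auto simp: hom_def)
  have pr_mult: "pr A \<otimes>\<^bsub>?Q\<^esub> pr B = pr (A * B)" if "isometry A" "isometry B" for A B
  proof -
    have "pr (A \<otimes>\<^bsub>?U\<^esub> B) = pr A \<otimes>\<^bsub>?Q\<^esub> pr B" using pr_hom U that by (simp add: hom_mult)
    then show ?thesis by (simp add: unitary_group_def)
  qed
  have one_Q: "\<one>\<^bsub>?Q\<^esub> = ?S" by (simp add: PU_def FactGroup_def)
  have pr_one: "pr A = \<one>\<^bsub>?Q\<^esub> \<longleftrightarrow> A \<in> ?S" if "isometry A" for A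
    unfolding one_Q pr_def using that U N.rcos_const N.rcos_self[of A] N.is_subgroup
    by (metis N.subgroup_axioms N.is_group subgroup.rcos_const group.coset_join1 N.subset)
  have one_S: "1\<^sub>m ?m \<in> ?S" using subgroup.one_closed[OF N.subgroup_axioms] by (simp add: unitary_group_def)
  have pr1: "pr (1\<^sub>m ?m) = \<one>\<^bsub>?Q\<^esub>" using pr_one[OF isometry_one] one_S by blast
  obtain R where R: "involution R" "\<And>c. R \<noteq> c \<cdot>\<^sub>m 1\<^sub>m ?m" using nonscalar_involution by blast
  have iR: "isometry R" by (rule involution_isometry[OF R(1)])
  define s where "s = pr R"
  have s: "s \<in> carrier ?Q" unfolding s_def using iR by (rule pr_carrier)
  have ss: "s \<otimes>\<^bsub>?Q\<^esub> s = \<one>\<^bsub>?Q\<^esub>"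
    unfolding s_def pr_mult[OF iR iR] involution_square[OF R(1)] by (rule pr1)
  have s1: "s \<noteq> \<one>\<^bsub>?Q\<^esub>"
    using pr_one[OF iR] R(2) by (auto simp: s_def unit_scalars_def)
  have main: "\<exists>x\<in>carrier ?Q. \<exists>y\<in>carrier ?Q. \<exists>I\<in>carrier ?Q.
              I \<otimes>\<^bsub>?Q\<^esub> I = \<one>\<^bsub>?Q\<^esub> \<and> I \<noteq> \<one>\<^bsub>?Q\<^esub> \<and> g = commutator ?Q x y \<and>
              I \<otimes>\<^bsub>?Q\<^esub> x \<otimes>\<^bsub>?Q\<^esub> I = inv\<^bsub>?Q\<^esub> x \<and> I \<otimes>\<^bsub>?Q\<^esub> y \<otimes>\<^bsub>?Q\<^esub> I = inv\<^bsub>?Q\<^esub> y"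
    if g: "g \<in> carrier ?Q" for g
  proof -
    obtain G where G: "isometry G" "g = pr G"
      using g U unfolding PU_def FactGroup_def RCOSETS_def pr_def by auto
    obtain A B C c where ABC: "isometry A" "isometry B" "isometry C"
      "A * A = 1\<^sub>m ?m" "B * B = 1\<^sub>m ?m" "C * C = 1\<^sub>m ?m" "cmod c = 1" "(A * B * C) * (A * B * C) = c \<cdot>\<^sub>m G"
      using triple_involution_square[OF isometry_is_triple_square[OF G(1)] isometry_carrier[OF G(1)]] by blast
    have gsq: "g = (pr A \<otimes>\<^bsub>?Q\<^esub> pr B \<otimes>\<^bsub>?Q\<^esub> pr C) \<otimes>\<^bsub>?Q\<^esub> (pr A \<otimes>\<^bsub>?Q\<^esub> pr B \<otimes>\<^bsub>?Q\<^esub> pr C)"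
    proof -
      note AB = isometry_mult[OF ABC(1,2)]
      note ABC' = isometry_mult[OF AB ABC(3)]
      have "pr (c \<cdot>\<^sub>m G) = pr G"
        unfolding pr_def using smult_mem_coset[OF assms(2) _ ABC(7)] G(1) U by blast
      then show ?thesis
        by (simp only: pr_mult[OF ABC(1,2)] pr_mult[OF AB ABC(3)] pr_mult[OF ABC' ABC'] ABC(8) G(2))
    qed
    have sq: "pr A \<otimes>\<^bsub>?Q\<^esub> pr A = \<one>\<^bsub>?Q\<^esub>" "pr B \<otimes>\<^bsub>?Q\<^esub> pr B = \<one>\<^bsub>?Q\<^esub>"
      "pr C \<otimes>\<^bsub>?Q\<^esub> pr C = \<one>\<^bsub>?Q\<^esub>"
      unfolding pr_mult[OF ABC(1,1)] pr_mult[OF ABC(2,2)] pr_mult[OF ABC(3,3)] ABC(4-6) by (rule pr1)+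
    obtain a b c where abc: "a \<in> carrier ?Q" "b \<in> carrier ?Q" "c \<in> carrier ?Q"
      "a \<otimes>\<^bsub>?Q\<^esub> a = \<one>\<^bsub>?Q\<^esub>" "b \<otimes>\<^bsub>?Q\<^esub> b = \<one>\<^bsub>?Q\<^esub>" "c \<otimes>\<^bsub>?Q\<^esub> c = \<one>\<^bsub>?Q\<^esub>" "c \<noteq> \<one>\<^bsub>?Q\<^esub>"
      "g = (a \<otimes>\<^bsub>?Q\<^esub> b \<otimes>\<^bsub>?Q\<^esub> c) \<otimes>\<^bsub>?Q\<^esub> (a \<otimes>\<^bsub>?Q\<^esub> b \<otimes>\<^bsub>?Q\<^esub> c)"
      by (rule Q.nontrivial_third_involution[OF pr_carrier[OF ABC(1)] pr_carrier[OF ABC(2)]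
            pr_carrier[OF ABC(3)] s sq ss s1, folded gsq])
    note com = Q.commutator_of_involution_products[OF abc(1-6)]
    have "g = commutator ?Q (a \<otimes>\<^bsub>?Q\<^esub> c) (c \<otimes>\<^bsub>?Q\<^esub> b)" by (simp only: abc(8) com(1))
    then show ?thesis
      using abc(3,6,7) com(2,3) Q.m_closed[OF abc(1,3)] Q.m_closed[OF abc(3,2)] by blast
  qed
  have "group_commutator_length ?Q = 1"
    unfolding group_commutator_length_def
  proof (rule antisym)
    show "(SUP g\<in>carrier ?Q. commutator_length ?Q g) \<le> 1"
      by (rule SUP_least) (use main Q.commutator_length_le_one in blast)
    show "1 \<le> (SUP g\<in>carrier ?Q. commutator_length ?Q g)"
      by (rule SUP_upper2[of s, OF s]) (rule commutator_length_ge_one[OF s1])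
  qed
  then show ?thesis using main by blast
qed

end
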